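(* Let $\Omega\subset\mathbb{R}^n$ be a bounded open set and let $p\colon\mathbb{R}^n\to[1,\infty)$ be a $C^1$ function with $1<\inf_\Omega p\le\sup_\Omega p<\infty$. If a function $u\in C^1(\Omega)$ is a weak solution of $-\Delta_{p(x)}u=0$ in $\Omega\setminus\{x:u(x)=0\}$, then $u$ is a weak solution of $-\Delta_{p(x)}u=0$ in all of $\Omega$.
   Context: $\Delta_{p(x)}u=\operatorname{div}(|Du|^{p(x)-2}Du)$. A weak solution in an open set $U$ is $u\in W^{1,p(x)}_{loc}(U)$ (variable exponent Sobolev space: $\int_K|u|^{p(x)}+|Du|^{p(x)}<\infty$ for compact $K\subset U$) with $\int_U|Du|^{p(x)-2}Du\cdot D\varphi\,dx=0$ for all $\varphi\in C_0^\infty(U)$. *)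

theory Defs
  imports "HOL-Analysis.Analysis"
begin

definition grad :: "('a::euclidean_space \<Rightarrow> real) \<Rightarrow> 'a \<Rightarrow> 'a" where
  "grad f x = (\<Sum>b\<in>Basis. frechet_derivative f (at x) b *\<^sub>R b)"

fun Ck_on :: "nat \<Rightarrow> 'a::euclidean_space set \<Rightarrow> ('a \<Rightarrow> real) \<Rightarrow> bool" where
  "Ck_on 0 U f = continuous_on U f"
| "Ck_on (Suc k) U f = ((\<forall>x\<in>U. f differentiable (at x)) \<and>
      (\<forall>b\<in>Basis. Ck_on k U (\<lambda>x. frechet_derivative f (at x) b)))"

definition C1_on :: "'a::euclidean_space set \<Rightarrow> ('a \<Rightarrow> real) \<Rightarrow> bool" where
  "C1_on U f = Ck_on 1 U f"

definition smooth_on :: "'a::euclidean_space set \<Rightarrow> ('a \<Rightarrow> real) \<Rightarrow> bool" where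
  "smooth_on U f = (\<forall>k. Ck_on k U f)"

definition test_fun :: "'a::euclidean_space set \<Rightarrow> ('a \<Rightarrow> real) \<Rightarrow> bool" where
  "test_fun U \<phi> = (smooth_on UNIV \<phi> \<and> compact (closure {x. \<phi> x \<noteq> 0})
                    \<and> closure {x. \<phi> x \<noteq> 0} \<subseteq> U)"

definition weak_gradient :: "'a::euclidean_space set \<Rightarrow> ('a \<Rightarrow> real) \<Rightarrow> ('a \<Rightarrow> 'a) \<Rightarrow> bool" where
  "weak_gradient U u g =
     ((\<forall>K. compact K \<and> K \<subseteq> U \<longrightarrow>
          set_integrable lebesgue K u \<and> set_integrable lebesgue K (\<lambda>x. norm (g x))) \<and>
      g \<in> borel_measurable lebesgue \<and>
      (\<forall>\<phi>. test_fun U \<phi> \<longrightarrow> (\<forall>b\<in>Basis.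
          (LINT x:U|lebesgue. u x * (grad \<phi> x \<bullet> b)) = - (LINT x:U|lebesgue. (g x \<bullet> b) * \<phi> x))))"

definition sobolev_loc :: "('a::euclidean_space \<Rightarrow> real) \<Rightarrow> 'a set \<Rightarrow> ('a \<Rightarrow> real) \<Rightarrow> ('a \<Rightarrow> 'a) \<Rightarrow> bool" where
  "sobolev_loc p U u g =
     (weak_gradient U u g \<and>
      (\<forall>K. compact K \<and> K \<subseteq> U \<longrightarrow>
          set_integrable lebesgue K (\<lambda>x. \<bar>u x\<bar> powr p x + norm (g x) powr p x)))"

definition p_harmonic_weak :: "('a::euclidean_space \<Rightarrow> real) \<Rightarrow> 'a set \<Rightarrow> ('a \<Rightarrow> real) \<Rightarrow> bool" where
  "p_harmonic_weak p U u =
     (\<exists>g. sobolev_loc p U u g \<and>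
        (\<forall>\<phi>. test_fun U \<phi> \<longrightarrow>
           (LINT x:U|lebesgue. norm (g x) powr (p x - 2) * (g x \<bullet> grad \<phi> x)) = 0))"

end

theory Submission
  imports Defs "HOL-Computational_Algebra.Polynomial"
begin

text \<open>
  Let \<open>G\<close> be the gradient of \<open>u\<close> and \<open>F = |G|\<^bsup>p-2\<^esup> G\<close>. Near a zero of \<open>u\<close> with \<open>G \<noteq> 0\<close> the fluxes of \<open>F\<close>
  through the level sets \<open>u = \<epsilon>\<close> and \<open>u = -\<epsilon>\<close> cancel in the limit, so \<open>F\<close> is divergence free on
  \<open>G \<noteq> 0\<close>. It remains to cross the critical set. Differentiating the equation there and testing it with
  \<open>\<phi>\<^sup>2 |G|\<^bsup>-a\<^esup> G\<close>, truncated near \<open>G = 0\<close>, gives a bound for \<open>\<integral> \<phi>\<^sup>2 |G|\<^bsup>p-2-a\<^esup> |DG|\<^sup>2\<close> which does not depend on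
  the truncation, for every \<open>a < 1\<close>. If moreover \<open>a > 2 - p\<close>, which is possible because \<open>p > 1\<close>, this bound
  shows that the error made by cutting off the set \<open>|G| \<le> \<epsilon>\<close> in the weak equation tends to zero with \<open>\<epsilon>\<close>.
  All derivatives of \<open>G\<close> are replaced by difference quotients, so that only continuous functions of
  compact support are ever integrated.
\<close>

subsection \<open>Compactly supported functions and weak divergence\<close>

text \<open>The obstacle is that \<open>u\<close> is only C^1: nothing is known about second
  derivatives, and neither the zero set nor the critical set has any structure. No surface measure
  is used. A flux through the levels is spread over a layer by a weight of mass O(\<epsilon>), and
  one integration by parts bounds that mass. The range 2 - p < a < 1 is met uniformly by a = 1 -
  \<beta> when 1 + 2\<beta> \<le> p; then p - 2 + a \<ge> \<beta>, which is the source of the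
  factors \<epsilon>^\<beta>. The test function contains the difference quotient q of
  \<open>u\<close> in place of the gradient, because q is C^1 and its derivatives are the difference
  quotients of \<open>G\<close>. The nonlinear flux is linearised only up to an error \<delta> (1 +
  |Dq|), so a cruder bound for Dq away from the critical set is needed first. That bound depends on
  \<epsilon>, but it enters only multiplied by \<delta>, which is chosen after it. Hence the order
  of the choices: \<kappa> and \<epsilon>, then \<delta>, then the step h.\<close>

definition csupp :: "'a::topological_space set \<Rightarrow> ('a \<Rightarrow> 'b::zero) \<Rightarrow> bool" where
  "csupp U f \<longleftrightarrow> (\<exists>K. compact K \<and> K \<subseteq> U \<and> (\<forall>x. x \<notin> K \<longrightarrow> f x = 0))"

definition Cc :: "'a::euclidean_space set \<Rightarrow> ('a \<Rightarrow> 'b::real_normed_vector) \<Rightarrow> bool" where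
  "Cc U f \<longleftrightarrow> continuous_on UNIV f \<and> csupp U f"

text \<open>Carrying the gradient as an argument keeps the product and chain rules explicit. Compact
  support is asked of \<open>f\<close> only; \<open>C1c_Cc\<close> derives it for
  \<open>Df\<close>.\<close>

definition C1c :: "'a::euclidean_space set \<Rightarrow> ('a \<Rightarrow> real) \<Rightarrow> ('a \<Rightarrow> 'a) \<Rightarrow> bool" where
  "C1c U f Df \<longleftrightarrow> (\<forall>x. GDERIV f x :> Df x) \<and> continuous_on UNIV Df \<and> csupp U f"

lemma csupp_mono: "csupp U f \<Longrightarrow> U \<subseteq> V \<Longrightarrow> csupp V f"
  unfolding csupp_def by blast

lemma csupp_subset: "csupp U f \<Longrightarrow> (\<And>x. f x = 0 \<Longrightarrow> g x = 0) \<Longrightarrow> csupp U g"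
  unfolding csupp_def by metis

lemma csupp_add:
  fixes f g :: "'a::topological_space \<Rightarrow> 'b::monoid_add"
  assumes "csupp U f" "csupp U g" shows "csupp U (\<lambda>x. f x + g x)"
proof -
  obtain K L where "compact K" "K \<subseteq> U" "\<forall>x. x \<notin> K \<longrightarrow> f x = 0"
    "compact L" "L \<subseteq> U" "\<forall>x. x \<notin> L \<longrightarrow> g x = 0"
    using assms unfolding csupp_def by blast
  then show ?thesis unfolding csupp_def
    by (intro exI[of _ "K \<union> L"]) (auto simp: compact_Un)
qed

lemma csupp_diff:
  fixes f g :: "'a::topological_space \<Rightarrow> 'b::group_add"
  assumes "csupp U f" "csupp U g" shows "csupp U (\<lambda>x. f x - g x)"
  using csupp_add[OF assms(1) csupp_subset[OF assms(2), of "\<lambda>x. - g x"]] by simp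

lemma csupp_0 [simp]: "csupp U (\<lambda>x. 0)"
  unfolding csupp_def by (rule exI[of _ "{}"]) auto

lemma csupp_sum:
  fixes f :: "'i \<Rightarrow> 'a::topological_space \<Rightarrow> 'b::comm_monoid_add"
  assumes "\<And>i. i \<in> I \<Longrightarrow> csupp U (f i)" shows "csupp U (\<lambda>x. \<Sum>i\<in>I. f i x)"
  using assms by (induction I rule: infinite_finite_induct) (auto intro: csupp_add)

lemma csupp_translate:
  fixes f :: "'a::euclidean_space \<Rightarrow> 'b::zero"
  assumes "csupp UNIV f" shows "csupp UNIV (\<lambda>x. f (x + a))"
proof -
  obtain K where K: "compact K" "\<forall>x. x \<notin> K \<longrightarrow> f x = 0" using assms unfolding csupp_def by blast
  have "compact ((\<lambda>x. x - a) ` K)" using K(1) by (intro compact_continuous_image continuous_intros)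
  moreover have "x \<notin> (\<lambda>x. x - a) ` K \<Longrightarrow> f (x + a) = 0" for x
    using K(2) by (metis add_diff_cancel image_eqI)
  ultimately show ?thesis unfolding csupp_def by blast
qed

text \<open>The function is zero on the open complement of a compact \<open>K\<close>, and
  \<open>V\<close> together with this complement covers the space by two open sets.\<close>

lemma continuous_on_csupp:
  fixes f :: "'a::euclidean_space \<Rightarrow> 'b::real_normed_vector"
  assumes "open V" "continuous_on V f" "csupp V f"
  shows "continuous_on UNIV f"
proof -
  obtain K where K: "compact K" "K \<subseteq> V" "\<forall>x. x \<notin> K \<longrightarrow> f x = 0" using assms unfolding csupp_def by blast
  have "continuous_on (- K) f"
    by (rule continuous_on_eq[of _ "\<lambda>x. 0"]) (use K(3) in auto)
  then have "continuous_on (V \<union> - K) f"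
    using assms K(1) by (intro continuous_on_open_Un) (auto simp: compact_imp_closed)
  moreover have "V \<union> - K = UNIV" using K by auto
  ultimately show ?thesis by simp
qed

lemma CcD: "Cc U f \<Longrightarrow> continuous_on UNIV f" "Cc U f \<Longrightarrow> csupp U f" by (auto simp: Cc_def)

lemma Cc_mono: "Cc U f \<Longrightarrow> U \<subseteq> V \<Longrightarrow> Cc V f"
  unfolding Cc_def using csupp_mono by blast

lemma Cc_mult_left:
  fixes f g :: "'a::euclidean_space \<Rightarrow> real"
  assumes "continuous_on UNIV g" "Cc U f" shows "Cc U (\<lambda>x. g x * f x)"
  using assms unfolding Cc_def by (auto intro!: continuous_intros elim: csupp_subset)

lemma Cc_mult_right:
  fixes f g :: "'a::euclidean_space \<Rightarrow> real"
  assumes "Cc U f" "continuous_on UNIV g" shows "Cc U (\<lambda>x. f x * g x)"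
  using assms unfolding Cc_def by (auto intro!: continuous_intros elim: csupp_subset)

lemma Cc_scaleR:
  fixes f :: "'a::euclidean_space \<Rightarrow> real" and g :: "'a \<Rightarrow> 'b::real_normed_vector"
  assumes "Cc U f" "continuous_on UNIV g" shows "Cc U (\<lambda>x. f x *\<^sub>R g x)"
  using assms unfolding Cc_def by (auto intro!: continuous_intros elim: csupp_subset)

lemma Cc_inner_left:
  assumes "continuous_on UNIV g" "Cc U f" shows "Cc U (\<lambda>x. g x \<bullet> f x)"
  using assms unfolding Cc_def by (auto intro!: continuous_intros elim: csupp_subset)

lemma Cc_inner_right:
  assumes "Cc U f" "continuous_on UNIV g" shows "Cc U (\<lambda>x. f x \<bullet> g x)"
  using assms unfolding Cc_def by (auto intro!: continuous_intros elim: csupp_subset)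

lemma Cc_norm: "Cc U f \<Longrightarrow> Cc U (\<lambda>x. norm (f x))"
  unfolding Cc_def by (auto intro!: continuous_intros elim: csupp_subset)

lemma Cc_abs: "Cc U f \<Longrightarrow> Cc U (\<lambda>x. \<bar>f x::real\<bar>)"
  using Cc_norm[of U f] by simp

lemma Cc_add: "Cc U f \<Longrightarrow> Cc U g \<Longrightarrow> Cc U (\<lambda>x. f x + g x)"
  unfolding Cc_def by (auto intro!: continuous_intros csupp_add)

lemma Cc_diff: "Cc U f \<Longrightarrow> Cc U g \<Longrightarrow> Cc U (\<lambda>x. f x - g x)"
  unfolding Cc_def by (auto intro!: continuous_intros csupp_diff)

lemma Cc_sum: "(\<And>i. i \<in> I \<Longrightarrow> Cc U (f i)) \<Longrightarrow> Cc U (\<lambda>x. \<Sum>i\<in>I. f i x)"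
  unfolding Cc_def by (auto intro!: continuous_intros csupp_sum)

lemma Cc_translate: "Cc UNIV f \<Longrightarrow> Cc UNIV (\<lambda>x. f (x + a))"
  unfolding Cc_def
  by (auto intro!: csupp_translate continuous_on_compose2[of UNIV f] continuous_intros)

lemma Cc_bounded:
  assumes "Cc U f" obtains B where "0 < B" "\<And>x. norm (f x) \<le> B"
proof -
  obtain K where K: "compact K" "K \<subseteq> U" "\<forall>x. x \<notin> K \<longrightarrow> f x = 0" using assms unfolding Cc_def csupp_def by blast
  have "compact (f ` K)" using K assms unfolding Cc_def
    by (meson compact_continuous_image continuous_on_subset subset_UNIV)
  then obtain B where "B > 0" "\<forall>x\<in>K. norm (f x) \<le> B"
    using compact_imp_bounded bounded_pos by (metis imageI)
  then show ?thesis using K(3) by (intro that[of B]; metis norm_zero order_less_imp_le)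
qed

text \<open>Let \<open>L\<close> be the closed 1-neighbourhood of the compact \<open>K\<close> off
  which \<open>f\<close> vanishes. If one of two points at distance below 1 lies in
  \<open>K\<close>, both lie in \<open>L\<close>, where compactness applies; otherwise both values
  are zero.\<close>

lemma Cc_uniformly_continuous:
  fixes f :: "'a::euclidean_space \<Rightarrow> 'b::real_normed_vector"
  assumes "Cc U f" shows "uniformly_continuous_on UNIV f"
  unfolding uniformly_continuous_on_def
proof (intro allI impI)
  fix e :: real assume e: "0 < e"
  obtain K where K: "compact K" "\<forall>x. x \<notin> K \<longrightarrow> f x = 0" using assms unfolding Cc_def csupp_def by blast
  define L where "L = {x + y |x y. x \<in> K \<and> y \<in> cball 0 (1::real)}"
  have L: "compact L" unfolding L_def by (intro compact_sums K compact_cball)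
  have "uniformly_continuous_on L f"
    using assms L unfolding Cc_def
    by (meson compact_uniformly_continuous continuous_on_subset subset_UNIV)
  then obtain d where d: "d > 0" "\<forall>x\<in>L. \<forall>x'\<in>L. dist x' x < d \<longrightarrow> dist (f x') (f x) < e"
    using e unfolding uniformly_continuous_on_def by metis
  show "\<exists>d>0. \<forall>x\<in>UNIV. \<forall>x'\<in>UNIV. dist x' x < d \<longrightarrow> dist (f x') (f x) < e"
  proof (intro exI[of _ "min d 1"] conjI ballI impI)
    fix x x' :: 'a assume dd: "dist x' x < min d 1"
    have in_L: "a \<in> L" if "b \<in> K" "dist a b < 1" for a b
      unfolding L_def using that
      by (intro CollectI exI[of _ b] exI[of _ "a - b"]) (auto simp: dist_norm norm_minus_commute)
    show "dist (f x') (f x) < e"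
    proof (cases "x \<in> K \<or> x' \<in> K")
      case True
      then have "x \<in> L \<and> x' \<in> L" using in_L[of x x] in_L[of x' x] in_L[of x x'] in_L[of x' x'] dd
        by (auto simp: dist_commute)
      then show ?thesis using d dd by auto
    next
      case False then show ?thesis using K e by simp
    qed
  qed (use d in auto)
qed

lemma Cc_integrable:
  fixes f :: "'a::euclidean_space \<Rightarrow> 'b::{banach,second_countable_topology}"
  assumes "Cc U f" shows "integrable lborel f"
proof -
  obtain K where K: "compact K" "\<forall>x. x \<notin> K \<longrightarrow> f x = 0" using assms unfolding Cc_def csupp_def by blast
  have "integrable lborel (\<lambda>x. indicator K x *\<^sub>R f x)"
    using K assms unfolding Cc_def by (intro borel_integrable_compact) (auto elim: continuous_on_subset)
  moreover have "(\<lambda>x. indicator K x *\<^sub>R f x) = f" using K by (auto simp: indicator_def fun_eq_iff)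
  ultimately show ?thesis by simp
qed

lemma Cc_integral_bound:
  fixes f :: "'a::euclidean_space \<Rightarrow> real"
  assumes "Cc U f" "compact K" "\<And>x. x \<notin> K \<Longrightarrow> f x = 0" "\<And>x. \<bar>f x\<bar> \<le> C"
  shows "\<bar>integral\<^sup>L lborel f\<bar> \<le> C * measure lborel K"
proof -
  have int: "integrable lborel (\<lambda>x. C * indicator K x)"
    using assms(2) by (intro integrable_mult_right integrable_real_indicator)
      (use emeasure_compact_finite[OF assms(2)] in \<open>auto simp: borel_compact less_top\<close>)
  have "\<bar>integral\<^sup>L lborel f\<bar> \<le> (\<integral>x. \<bar>f x\<bar> \<partial>lborel)"
    using integral_norm_bound[of lborel f] by simp
  also have "\<dots> \<le> (\<integral>x. C * indicator K x \<partial>lborel)"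
  proof (rule integral_mono)
    show "\<bar>f x\<bar> \<le> C * indicator K x" for x using assms(3,4)[of x] by (cases "x \<in> K") auto
  qed (use Cc_integrable[OF Cc_abs[OF assms(1)]] int in auto)
  also have "\<dots> = C * measure lborel K" using assms(2)
    by (simp add: borel_compact)
  finally show ?thesis .
qed

lemma lborel_integral_translate:
  fixes f :: "'a::euclidean_space \<Rightarrow> 'b::{banach,second_countable_topology}"
  assumes "f \<in> borel_measurable borel"
  shows "(\<integral>x. f (x + a) \<partial>lborel) = integral\<^sup>L lborel f"
proof -
  have "integral\<^sup>L lborel f = integral\<^sup>L (distr lborel borel ((+) a)) f"
    by (simp add: lborel_distr_plus)
  also have "\<dots> = (\<integral>x. f (a + x) \<partial>lborel)"
    using assms by (intro integral_distr) auto
  finally show ?thesis by (simp add: add.commute)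
qed

lemma Cc_integral_translate:
  fixes f :: "'a::euclidean_space \<Rightarrow> 'b::{banach,second_countable_topology}"
  assumes "Cc U f"
  shows "(\<integral>x. f (x + a) \<partial>lborel) = integral\<^sup>L lborel f"
  using assms unfolding Cc_def by (intro lborel_integral_translate borel_measurable_continuous_onI) auto

section \<open>Gradients, weakly divergence free fields and integration by parts\<close>

lemma GDERIV_continuous_on:
  assumes "\<And>x. GDERIV f x :> Df x" shows "continuous_on S f"
  using assms unfolding gderiv_def
  by (meson continuous_at_imp_continuous_on has_derivative_continuous)

lemma GDERIV_sum:
  assumes "\<And>i. i \<in> I \<Longrightarrow> GDERIV (f i) x :> D i"
  shows "GDERIV (\<lambda>x. \<Sum>i\<in>I. f i x) x :> (\<Sum>i\<in>I. D i)"
  using assms unfolding gderiv_def inner_sum_right by (intro has_derivative_sum)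

lemma GDERIV_zero_outside:
  assumes "GDERIV f x :> D" "closed K" "\<And>y. y \<notin> K \<Longrightarrow> f y = 0" "x \<notin> K"
  shows "D = 0"
proof -
  have "((\<lambda>y. 0::real) has_derivative (\<lambda>h. h \<bullet> D)) (at x)"
  proof (rule has_derivative_transform_within_open[of f _ x UNIV "- K"])
    show "(f has_derivative (\<lambda>h. h \<bullet> D)) (at x)" using assms(1) by (simp add: gderiv_def)
  qed (use assms in \<open>auto simp: open_Compl\<close>)
  then have "(\<lambda>h. h \<bullet> D) = (\<lambda>h. 0)"
    by (rule has_derivative_unique) (rule has_derivative_const)
  from fun_cong[OF this, of D] show ?thesis by simp
qed

definition weakly_div_free :: "'a::euclidean_space set \<Rightarrow> ('a \<Rightarrow> 'a) \<Rightarrow> bool" where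
  "weakly_div_free U F \<longleftrightarrow> (\<forall>\<phi> D\<phi>. C1c U \<phi> D\<phi> \<longrightarrow> (\<integral>x. F x \<bullet> D\<phi> x \<partial>lborel) = 0)"

lemma weakly_div_freeD: "weakly_div_free U F \<Longrightarrow> C1c U \<phi> D\<phi> \<Longrightarrow> (\<integral>x. F x \<bullet> D\<phi> x \<partial>lborel) = 0"
  unfolding weakly_div_free_def by blast

lemma C1c_Cc:
  assumes "C1c U f Df" shows "Cc U f" "Cc U Df"
proof -
  obtain K where K: "compact K" "K \<subseteq> U" "\<forall>x. x \<notin> K \<longrightarrow> f x = 0" using assms unfolding C1c_def csupp_def by blast
  have "\<forall>x. x \<notin> K \<longrightarrow> Df x = 0"
    using assms K GDERIV_zero_outside[of f _ _ K] unfolding C1c_def by (meson compact_imp_closed)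
  then show "Cc U Df" using assms K unfolding Cc_def C1c_def csupp_def by blast
  show "Cc U f" using assms unfolding Cc_def C1c_def by (auto intro: GDERIV_continuous_on)
qed

lemma C1c_mono: "C1c U f Df \<Longrightarrow> U \<subseteq> V \<Longrightarrow> C1c V f Df"
  unfolding C1c_def using csupp_mono by blast

lemma C1c_GDERIV: "C1c U f Df \<Longrightarrow> GDERIV f x :> Df x"
  unfolding C1c_def by blast

lemma C1c_mult:
  assumes "C1c U f Df" "\<And>x. GDERIV g x :> Dg x" "continuous_on UNIV Dg"
  shows "C1c U (\<lambda>x. f x * g x) (\<lambda>x. f x *\<^sub>R Dg x + g x *\<^sub>R Df x)"
  using assms C1c_Cc(1)[OF assms(1)] GDERIV_continuous_on[of g Dg UNIV] unfolding C1c_def Cc_def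
  by (auto intro!: GDERIV_mult continuous_intros elim: csupp_subset)

lemma C1c_translate:
  assumes "C1c UNIV f Df" shows "C1c UNIV (\<lambda>x. f (x + a)) (\<lambda>x. Df (x + a))"
proof -
  have "GDERIV (\<lambda>x. f (x + a)) x :> Df (x + a)" for x
    using C1c_GDERIV[OF assms, of "x + a"] unfolding gderiv_def
    by (rule has_derivative_compose[rotated]) (auto intro!: derivative_eq_intros)
  then show ?thesis using assms Cc_translate[OF C1c_Cc(2)[OF assms]] unfolding C1c_def
    by (auto intro!: csupp_translate simp: Cc_def)
qed

text \<open>Serves for products such as cutoff times \<open>u\<close>, where \<open>u\<close> is
  differentiable on \<open>V\<close> only: off the compact support the product is locally zero, so
  extending the gradient by zero is correct.\<close>

lemma C1c_on_open:
  assumes "open V" "\<And>x. x \<in> V \<Longrightarrow> GDERIV f x :> Df x" "continuous_on V Df" "csupp V f"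
    "\<And>x. x \<notin> V \<Longrightarrow> Df x = 0"
  shows "C1c V f Df"
proof -
  obtain K where K: "compact K" "K \<subseteq> V" "\<forall>x. x \<notin> K \<longrightarrow> f x = 0" using assms unfolding csupp_def by blast
  have out: "GDERIV f x :> 0" if "x \<notin> K" for x
    unfolding gderiv_def
    by (rule has_derivative_transform_within_open[of "\<lambda>y. 0" _ x UNIV "- K"])
      (use K that in \<open>auto simp: compact_imp_closed open_Compl\<close>)
  have D0: "Df x = 0" if "x \<notin> K" for x
    using assms(2,5) GDERIV_zero_outside[of f x "Df x" K] K that by (meson compact_imp_closed)
  have "csupp V Df" using D0 K unfolding csupp_def by blast
  then have "continuous_on UNIV Df" using assms by (intro continuous_on_csupp) auto
  moreover have "GDERIV f x :> Df x" for x
    using assms(2) out[of x] D0[of x] K by (cases "x \<in> K") auto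
  ultimately show ?thesis using assms unfolding C1c_def by auto
qed

text \<open>The mean value inequality for \<open>f\<close> minus the linear function with gradient
  \<open>c\<close>.\<close>

lemma GDERIV_increment_bound:
  assumes "\<And>y. y \<in> closed_segment x x' \<Longrightarrow> GDERIV f y :> Df y"
    "\<And>y. y \<in> closed_segment x x' \<Longrightarrow> norm (Df y - c) \<le> B"
  shows "\<bar>f x' - f x - (x' - x) \<bullet> c\<bar> \<le> B * norm (x' - x)"
proof -
  have "norm ((\<lambda>y. f y - y \<bullet> c) x' - (\<lambda>y. f y - y \<bullet> c) x) \<le> B * norm (x' - x)"
  proof (rule differentiable_bound[where S = "closed_segment x x'" and f' = "\<lambda>y h. h \<bullet> (Df y - c)"])
    show "((\<lambda>y. f y - y \<bullet> c) has_derivative (\<lambda>h. h \<bullet> (Df y - c))) (at y within closed_segment x x')"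
      if "y \<in> closed_segment x x'" for y
      using assms(1)[OF that] unfolding gderiv_def inner_diff_right
      by (intro has_derivative_at_withinI[OF has_derivative_diff] has_derivative_inner_left has_derivative_ident)
    show "onorm (\<lambda>h. h \<bullet> (Df y - c)) \<le> B" if "y \<in> closed_segment x x'" for y
    proof (rule onorm_bound)
      show "0 \<le> B" using assms(2)[OF that] norm_ge_zero order_trans by blast
      show "norm (h \<bullet> (Df y - c)) \<le> B * norm h" for h
        using Cauchy_Schwarz_ineq2[of h "Df y - c"] mult_right_mono[OF assms(2)[OF that], of "norm h"]
        by (simp add: mult.commute)
    qed
  qed (auto simp: convex_closed_segment)
  then show ?thesis by (simp add: inner_diff_left algebra_simps)
qed

lemma C1c_difference_quotient:
  assumes f: "C1c U f Df" and e: "0 < e"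
  obtains d where "0 < d" "\<And>x b h. b \<in> Basis \<Longrightarrow> 0 < h \<Longrightarrow> h < d \<Longrightarrow> \<bar>(f (x + h *\<^sub>R b) - f x) / h - Df x \<bullet> b\<bar> \<le> e"
proof -
  have "uniformly_continuous_on UNIV Df" using C1c_Cc[OF f] Cc_uniformly_continuous by blast
  then obtain d where d: "d > 0" "\<And>x y. dist x y < d \<Longrightarrow> dist (Df x) (Df y) < e"
    using e unfolding uniformly_continuous_on_def by (metis UNIV_I)
  show ?thesis
  proof (rule that[OF d(1)])
    fix x b :: 'a and h :: real assume b: "b \<in> Basis" "0 < h" "h < d"
    have "\<bar>f (x + h *\<^sub>R b) - f x - ((x + h *\<^sub>R b) - x) \<bullet> Df x\<bar> \<le> e * norm ((x + h *\<^sub>R b) - x)"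
    proof (rule GDERIV_increment_bound[of _ _ _ Df])
      fix y assume "y \<in> closed_segment x (x + h *\<^sub>R b)"
      then have "dist y x \<le> norm (h *\<^sub>R b)"
        by (metis add_diff_cancel_left' dist_in_closed_segment(1) dist_norm norm_minus_commute dist_commute)
      then have "dist y x < d" using b by simp
      then show "norm (Df y - Df x) \<le> e" using d(2)[of y x] by (simp add: dist_norm)
    qed (use C1c_GDERIV[OF f] in auto)
    then have "\<bar>(f (x + h *\<^sub>R b) - f x) - h * (Df x \<bullet> b)\<bar> \<le> h * e"
      using b by (simp add: inner_commute algebra_simps)
    then have "\<bar>(f (x + h *\<^sub>R b) - f x) - h * (Df x \<bullet> b)\<bar> / h \<le> e" using b by (simp add: field_simps)
    moreover have "\<bar>(f (x + h *\<^sub>R b) - f x) - h * (Df x \<bullet> b)\<bar> / h = \<bar>(f (x + h *\<^sub>R b) - f x) / h - Df x \<bullet> b\<bar>"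
    proof -
      have "(f (x + h *\<^sub>R b) - f x) / h - Df x \<bullet> b = (f (x + h *\<^sub>R b) - f x - h * (Df x \<bullet> b)) / h"
        using b by (simp add: field_simps)
      then show ?thesis using b by (simp add: abs_divide)
    qed
    ultimately show "\<bar>(f (x + h *\<^sub>R b) - f x) / h - Df x \<bullet> b\<bar> \<le> e" by simp
  qed
qed

text \<open>Difference quotients of \<open>f\<close> have integral zero by translation invariance.
  They converge uniformly to the directional derivative and, for steps below 1, live on one compact
  set \<open>L\<close>, so the limit has integral zero too.\<close>

lemma C1c_integral_deriv:
  assumes f: "C1c U f Df" and b: "b \<in> Basis"
  shows "(\<integral>x. Df x \<bullet> b \<partial>lborel) = 0"
proof -
  note fc = C1c_Cc[OF C1c_mono[OF f subset_UNIV]]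
  obtain K where K: "compact K" "\<forall>x. x \<notin> K \<longrightarrow> f x = 0" using fc unfolding Cc_def csupp_def by blast
  define L where "L = {x + y |x y. x \<in> K \<and> y \<in> cball 0 (1::real)}"
  have L: "compact L" unfolding L_def by (intro compact_sums K compact_cball)
  have in_L: "x \<in> L" if "x + y \<in> K" "norm y \<le> 1" for x y
    unfolding L_def using that
    by (intro CollectI exI[of _ "x + y"] exI[of _ "- y"]) auto
  have "\<bar>\<integral>x. Df x \<bullet> b \<partial>lborel\<bar> \<le> e * measure lborel L" if e: "e > 0" for e
  proof -
    obtain d where d: "d > 0" "\<And>x b h. b \<in> Basis \<Longrightarrow> 0 < h \<Longrightarrow> h < d \<Longrightarrow> \<bar>(f (x + h *\<^sub>R b) - f x) / h - Df x \<bullet> b\<bar> \<le> e"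
      using C1c_difference_quotient[OF f e] by metis
    define h where "h = min d 1 / 2"
    have h: "0 < h" "h < d" "h < 1" using d unfolding h_def by auto
    let ?g = "\<lambda>x. (f (x + h *\<^sub>R b) - f x) / h - Df x \<bullet> b"
    have c1: "Cc UNIV (\<lambda>x. (1/h) * (f (x + h *\<^sub>R b) - f x))"
      by (intro Cc_mult_left Cc_diff Cc_translate fc continuous_intros)
    have c2: "Cc UNIV (\<lambda>x. Df x \<bullet> b)" by (intro Cc_inner_right fc continuous_intros)
    have c3: "Cc UNIV ?g" using Cc_diff[OF c1 c2] by simp
    have "\<bar>integral\<^sup>L lborel ?g\<bar> \<le> e * measure lborel L"
    proof (rule Cc_integral_bound[OF c3 L])
      show "\<bar>?g x\<bar> \<le> e" for x using d(2)[OF b h(1,2)] .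
      show "?g x = 0" if "x \<notin> L" for x
      proof -
        have "x \<notin> K" "x + h *\<^sub>R b \<notin> K" using that in_L[of x 0] in_L[of x "h *\<^sub>R b"] h b by auto
        moreover have "Df x = 0" using GDERIV_zero_outside[OF C1c_GDERIV[OF f], of K x] K \<open>x \<notin> K\<close>
          by (auto simp: compact_imp_closed)
        ultimately show ?thesis using K by simp
      qed
    qed
    moreover have "integral\<^sup>L lborel ?g = - (\<integral>x. Df x \<bullet> b \<partial>lborel)"
    proof -
      have "(\<integral>x. (1/h) * (f (x + h *\<^sub>R b) - f x) \<partial>lborel) = 0"
        using Cc_integral_translate[OF fc(1)] Cc_integrable[OF fc(1)] Cc_integrable[OF Cc_translate[OF fc(1)]]
        by simp
      then show ?thesis using Bochner_Integration.integral_diff[OF Cc_integrable[OF c1] Cc_integrable[OF c2]] by simp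
    qed
    ultimately show ?thesis by simp
  qed
  \<comment> \<open>The accuracy is divided by the measure of \<open>L\<close>; the added 1 covers
    the case of measure zero.\<close>
  then have "\<bar>\<integral>x. Df x \<bullet> b \<partial>lborel\<bar> \<le> 0 + e" if "e > 0" for e
  proof -
    have "\<bar>\<integral>x. Df x \<bullet> b \<partial>lborel\<bar> \<le> e / (measure lborel L + 1) * measure lborel L"
      using that by (intro \<open>\<And>e. e > 0 \<Longrightarrow> _\<close>) (auto simp: add_nonneg_pos)
    also have "\<dots> \<le> e"
    proof -
      have "measure lborel L / (measure lborel L + 1) \<le> 1" by (simp add: divide_le_eq_1 add_nonneg_pos)
      then show ?thesis using that mult_left_mono[of "measure lborel L / (measure lborel L + 1)" 1 e] by simp
    qed
    finally show ?thesis by simp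
  qed
  then show ?thesis using field_le_epsilon[of "\<bar>\<integral>x. Df x \<bullet> b \<partial>lborel\<bar>" 0] by fastforce
qed

lemma C1c_integral_by_parts:
  assumes f: "C1c U f Df" and g: "\<And>x. GDERIV g x :> Dg x" "continuous_on UNIV Dg" and b: "b \<in> Basis"
  shows "(\<integral>x. f x * (Dg x \<bullet> b) \<partial>lborel) = - (\<integral>x. (Df x \<bullet> b) * g x \<partial>lborel)"
proof -
  note fc = C1c_Cc[OF f]
  have gc: "continuous_on UNIV g" using GDERIV_continuous_on g by blast
  have c1: "Cc U (\<lambda>x. f x * (Dg x \<bullet> b))" using fc g by (intro Cc_mult_right continuous_intros) auto
  have c2: "Cc U (\<lambda>x. (Df x \<bullet> b) * g x)" using fc gc by (intro Cc_mult_right Cc_inner_right continuous_intros) auto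
  have "(\<integral>x. f x * (Dg x \<bullet> b) + (Df x \<bullet> b) * g x \<partial>lborel) = 0"
    using C1c_integral_deriv[OF C1c_mult[OF f g] b] by (simp add: inner_add_left algebra_simps)
  then show ?thesis using Bochner_Integration.integral_add[OF Cc_integrable[OF c1] Cc_integrable[OF c2]] by simp
qed

subsection \<open>Mollification\<close>

lemma power_le_exp: "0 \<le> w \<Longrightarrow> 0 < n \<Longrightarrow> w ^ n \<le> real n ^ n * exp w"
proof -
  assume w: "0 \<le> w" "0 < n"
  have "(w / real n) ^ n \<le> (1 + w / real n) ^ n" using w by (intro power_mono) auto
  also have "\<dots> \<le> exp w" using w by (intro exp_ge_one_plus_x_over_n_power_n) auto
  finally show ?thesis using w by (simp add: power_divide field_simps)
qed

text \<open>Handles the points where a piecewise definition changes: the bump at 1 and -1, and the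
  square of the positive part at 0.\<close>

lemma DERIV_zero_quadratic:
  fixes f :: "real \<Rightarrow> real"
  assumes "f x = 0" "\<And>y. \<bar>f y\<bar> \<le> C * (y - x)\<^sup>2"
  shows "(f has_real_derivative 0) (at x)"
proof -
  have "((\<lambda>y. (f y - f x) / (y - x)) \<longlongrightarrow> 0) (at x)"
  proof (rule tendsto_rabs_zero_cancel, rule tendsto_sandwich[of "\<lambda>y. 0" _ _ "\<lambda>y. C * \<bar>y - x\<bar>"])
    show "\<forall>\<^sub>F y in at x. \<bar>(f y - f x) / (y - x)\<bar> \<le> C * \<bar>y - x\<bar>"
    proof (rule eventually_at_filter[THEN iffD2], rule always_eventually, intro allI impI)
      fix y assume "y \<noteq> x"
      then show "\<bar>(f y - f x) / (y - x)\<bar> \<le> C * \<bar>y - x\<bar>"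
        using assms(2)[of y] by (simp add: assms(1) abs_divide pos_divide_le_eq power2_eq_square abs_mult[symmetric] mult.assoc)
    qed
    have "((\<lambda>y. C * \<bar>y - x\<bar>) \<longlongrightarrow> C * \<bar>x - x\<bar>) (at x)" by (intro tendsto_intros)
    then show "((\<lambda>y. C * \<bar>y - x\<bar>) \<longlongrightarrow> 0) (at x)" by simp
  qed auto
  then show ?thesis by (simp add: has_field_derivative_iff)
qed

text \<open>With y = 1 - t^2, encoded as \<open>[:1,0,-1:]\<close>, the derivative of q y^(-2n) exp
  (-1/y) is (q' y^2 + 4 n t q y - 2 t q) y^(-2n-2) exp (-1/y). The step is the new
  numerator.\<close>

definition bump_num_step :: "nat \<Rightarrow> real poly \<Rightarrow> real poly" where
  "bump_num_step n q = pderiv q * [:1,0,-1:]\<^sup>2 + [:0, 2 * real (2 * n):] * q * [:1,0,-1:] - [:0,2:] * q"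

primrec bump_num :: "nat \<Rightarrow> real poly" where
  "bump_num 0 = 1"
| "bump_num (Suc n) = bump_num_step n (bump_num n)"

text \<open>\<open>bump n\<close> is the \<open>n\<close>-th derivative of \<open>exp (-1 / (1 - t\<^sup>2))\<close>, extended by zero.\<close>
definition bump :: "nat \<Rightarrow> real \<Rightarrow> real" where
  "bump n t = (if \<bar>t\<bar> < 1 then poly (bump_num n) t / (1 - t\<^sup>2) ^ (2 * n) * exp (- 1 / (1 - t\<^sup>2)) else 0)"

lemma bump_0_nonneg: "0 \<le> bump 0 t" and bump_0_pos: "\<bar>t\<bar> < 1 \<Longrightarrow> 0 < bump 0 t"
  by (auto simp: bump_def)

lemma bump_zero: "1 \<le> \<bar>t\<bar> \<Longrightarrow> bump n t = 0"
  by (auto simp: bump_def)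

text \<open>Put w = 1 / (1 - t^2). Boundedness of w^(2n+2) exp (-w) leaves two spare factors 1 - t^2
  after the pole of order 2n is paid for, and |1 - t^2| \<le> 2 |t - s| when s is 1 or -1 and |t| <
  1. This flatness gives the derivative zero at the endpoints, for all orders at once.\<close>

lemma bump_quadratic:
  obtains C where "\<And>t s. \<bar>s\<bar> = 1 \<Longrightarrow> \<bar>bump n t\<bar> \<le> C * (t - s)\<^sup>2"
proof -
  have "compact (poly (bump_num n) ` {-1..1})" by (intro compact_continuous_image continuous_intros) auto
  then obtain B where B: "B > 0" "\<forall>t\<in>{-1..1}. \<bar>poly (bump_num n) t\<bar> \<le> B"
    using compact_imp_bounded bounded_pos by (metis imageI real_norm_def)
  define m where "m = 2 * n + 2"
  have "\<bar>bump n t\<bar> \<le> 4 * B * real m ^ m * (t - s)\<^sup>2" if s: "\<bar>s\<bar> = 1" for s t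
  proof (cases "\<bar>t\<bar> < 1")
    case True
    define w where "w = 1 / (1 - t\<^sup>2)"
    have t2: "t\<^sup>2 < 1" using True by (simp add: abs_square_less_1)
    have w: "w > 0" using t2 by (auto simp: w_def)
    have "w ^ m \<le> real m ^ m * exp w" using w by (intro power_le_exp) (auto simp: m_def)
    then have "w ^ m * exp (- w) \<le> real m ^ m" by (simp add: exp_minus field_simps)
    then have "w\<^sup>2 * (w ^ (2 * n) * exp (- w)) \<le> real m ^ m" by (simp add: m_def power_add algebra_simps power2_eq_square)
    then have "w ^ (2 * n) * exp (- w) \<le> real m ^ m * (1 - t\<^sup>2)\<^sup>2"
      using t2 by (simp add: w_def field_simps power_divide)
    moreover have "(1 - t\<^sup>2)\<^sup>2 \<le> 4 * (t - s)\<^sup>2"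
    proof -
      have "s = 1 \<or> s = - 1" using s by auto
      then have "(1 - t\<^sup>2)\<^sup>2 = (t - s)\<^sup>2 * (t + s)\<^sup>2" by (auto simp: power2_eq_square algebra_simps)
      moreover have "(t + s)\<^sup>2 \<le> 2\<^sup>2" using True s by (intro power2_le_iff_abs_le[THEN iffD2]) auto
      ultimately show ?thesis using mult_left_mono[of "(t + s)\<^sup>2" 4 "(t - s)\<^sup>2"] by simp
    qed
    ultimately have "w ^ (2 * n) * exp (- w) \<le> real m ^ m * (4 * (t - s)\<^sup>2)"
      by (meson mult_left_mono order_trans zero_le_power of_nat_0_le_iff)
    moreover have "\<bar>bump n t\<bar> = \<bar>poly (bump_num n) t\<bar> * (w ^ (2 * n) * exp (- w))"
      using True t2 by (simp add: bump_def w_def abs_mult power_one_over field_simps)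
    moreover have "\<bar>poly (bump_num n) t\<bar> \<le> B" using B(2)[rule_format, of t] True by (simp add: abs_less_iff)
    ultimately have "\<bar>bump n t\<bar> \<le> B * (real m ^ m * (4 * (t - s)\<^sup>2))"
      using w B by (auto intro!: mult_mono)
    then show ?thesis by (simp add: algebra_simps)
  next
    case False
    then show ?thesis using B by (simp add: bump_zero)
  qed
  then show ?thesis using that by blast
qed

lemma bump_deriv: "(bump n has_real_derivative bump (Suc n) t) (at t)"
proof -
  consider "\<bar>t\<bar> < 1" | "\<bar>t\<bar> = 1" | "\<bar>t\<bar> > 1" by linarith
  then show ?thesis
  proof cases
    case 1
    let ?f = "\<lambda>t. poly (bump_num n) t / (1 - t\<^sup>2) ^ (2 * n) * exp (- 1 / (1 - t\<^sup>2))"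
    have t2: "1 - t\<^sup>2 > 0" using 1 by (simp add: abs_square_less_1)
    define y where "y = 1 - t\<^sup>2"
    define e where "e = exp (- 1 / y)"
    define q where "q = poly (bump_num n) t"
    define q' where "q' = poly (pderiv (bump_num n)) t"
    have y: "y > 0" using t2 y_def by simp
    \<comment> \<open>For n = 0 the exponent \<open>2 * n - Suc 0\<close> is truncated to 0; the
      factor \<open>2 * n\<close> makes the identity true in that case as well.\<close>
    have yp: "real (2 * n) * (y ^ (2 * n - Suc 0)) * y = real (2 * n) * y ^ (2 * n)"
      by (cases n) (auto simp: power_Suc2[symmetric] mult.assoc simp del: power_Suc)
    have "(?f has_real_derivative
        ((q' * y ^ (2 * n) - q * (real (2 * n) * (- (2 * t)) * y ^ (2 * n - Suc 0))) / (y ^ (2 * n) * y ^ (2 * n)) * e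
        + q / y ^ (2 * n) * (e * (- (2 * t) / (y * y))))) (at t)"
    proof (rule DERIV_mult'[THEN DERIV_cong])
      show "((\<lambda>t. poly (bump_num n) t / (1 - t\<^sup>2) ^ (2 * n)) has_real_derivative
        (q' * y ^ (2 * n) - q * (real (2 * n) * (- (2 * t)) * y ^ (2 * n - Suc 0))) / (y ^ (2 * n) * y ^ (2 * n))) (at t)"
        unfolding q_def q'_def y_def using t2
        by (auto intro!: derivative_eq_intros)
      show "((\<lambda>t. exp (- 1 / (1 - t\<^sup>2))) has_real_derivative e * (- (2 * t) / (y * y))) (at t)"
        unfolding e_def y_def using t2
        by (auto intro!: derivative_eq_intros simp: power2_eq_square)
    qed (auto simp: q_def e_def y_def)
    also have "(q' * y ^ (2 * n) - q * (real (2 * n) * (- (2 * t)) * y ^ (2 * n - Suc 0))) / (y ^ (2 * n) * y ^ (2 * n)) * e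
        + q / y ^ (2 * n) * (e * (- (2 * t) / (y * y)))
      = (q' * y\<^sup>2 + 2 * real (2 * n) * t * q * y - 2 * t * q) / y ^ (2 * Suc n) * e"
    proof -
      define Y where "Y = y ^ (2 * n)"
      define P where "P = y ^ (2 * n - Suc 0)"
      define N where "N = real (2 * n)"
      have Y: "Y > 0" using y by (simp add: Y_def)
      have "N * P * y = N * Y" using yp by (simp add: Y_def P_def N_def)
      then have NP: "N * P = N * Y / y" using y by (simp add: field_simps)
      have "q * (N * (- (2 * t)) * P) = - (2 * t * q) * (N * P)" by (simp add: algebra_simps)
      then have A: "q * (N * (- (2 * t)) * P) = - (2 * t * q) * (N * Y / y)" by (simp only: NP)
      have B: "y ^ (2 * Suc n) = Y * y\<^sup>2" by (simp add: Y_def power_add power2_eq_square)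
      have "(q' * Y - (- (2 * t * q) * (N * Y / y))) / (Y * Y) * e + q / Y * (e * (- (2 * t) / (y * y)))
         = (q' * y\<^sup>2 + 2 * N * t * q * y - 2 * t * q) / (Y * y\<^sup>2) * e"
        using y Y by (simp add: field_simps power2_eq_square)
      then show ?thesis unfolding B Y_def[symmetric] N_def[symmetric] P_def[symmetric] A .
    qed
    also have "\<dots> = bump (Suc n) t"
      using 1 by (simp add: bump_def bump_num_step_def y_def e_def q_def q'_def power2_eq_square algebra_simps)
    finally have der: "(?f has_real_derivative bump (Suc n) t) (at t)" .
    show ?thesis
    proof (rule has_field_derivative_transform_within_open[OF der])
      show "t \<in> {-1<..<1}" using 1 by (simp add: abs_less_iff)
      show "?f x = bump n x" if "x \<in> {-1<..<1}" for x using that by (simp add: bump_def abs_less_iff)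
    qed simp
  next
    case 2
    obtain C where C: "\<And>r s. \<bar>s\<bar> = 1 \<Longrightarrow> \<bar>bump n r\<bar> \<le> C * (r - s)\<^sup>2"
      by (rule bump_quadratic[of n]) (rule that, assumption)
    have "(bump n has_real_derivative 0) (at t)"
      by (rule DERIV_zero_quadratic[of _ _ C, OF bump_zero C]) (use 2 in simp_all)
    then show ?thesis using 2 by (simp add: bump_zero)
  next
    case 3
    have op: "open {t::real. \<bar>t\<bar> > 1}" by (intro open_Collect_less continuous_intros)
    have "((\<lambda>t. 0) has_real_derivative 0) (at t)" by simp
    then have "(bump n has_real_derivative 0) (at t)"
      by (rule has_field_derivative_transform_within_open[OF _ op]) (use 3 in \<open>simp_all add: bump_zero\<close>)
    then show ?thesis using 3 by (simp add: bump_zero)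
  qed
qed

text \<open>The multi-index \<open>m\<close> counts the derivatives taken in each coordinate,
  without the chain rule factors 1/\<sigma>. The family is closed under differentiation up to such
  factors, which makes smoothness an induction over \<open>m\<close>.\<close>

definition bump_kernel :: "real \<Rightarrow> ('a \<Rightarrow> nat) \<Rightarrow> 'a::euclidean_space \<Rightarrow> real" where
  "bump_kernel \<sigma> m x = (\<Prod>b\<in>Basis. bump (m b) ((x \<bullet> b) / \<sigma>))"

definition bump_kernel_grad :: "real \<Rightarrow> ('a \<Rightarrow> nat) \<Rightarrow> 'a::euclidean_space \<Rightarrow> 'a" where
  "bump_kernel_grad \<sigma> m x = (\<Sum>b\<in>Basis. (bump_kernel \<sigma> (m(b := Suc (m b))) x / \<sigma>) *\<^sub>R b)"

lemma bump_kernel_GDERIV: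
  assumes "0 < \<sigma>" shows "GDERIV (bump_kernel \<sigma> m) x :> bump_kernel_grad \<sigma> m x"
proof -
  have "((\<lambda>x. bump (m b) ((x \<bullet> b) / \<sigma>)) has_derivative (\<lambda>h. bump (Suc (m b)) ((x \<bullet> b) / \<sigma>) * ((h \<bullet> b) / \<sigma>))) (at x)" for b
  proof (rule has_derivative_compose[of "\<lambda>x. (x \<bullet> b) / \<sigma>" "\<lambda>h. (h \<bullet> b) / \<sigma>" x UNIV "bump (m b)"])
    show "((\<lambda>x. x \<bullet> b / \<sigma>) has_derivative (\<lambda>h. h \<bullet> b / \<sigma>)) (at x)"
      using bounded_linear_imp_has_derivative[OF bounded_linear_scaleR_right[THEN bounded_linear_compose, OF bounded_linear_inner_left], of "inverse \<sigma>" b]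
      by (simp add: divide_inverse mult.commute)
    show "(bump (m b) has_derivative (*) (bump (Suc (m b)) (x \<bullet> b / \<sigma>))) (at (x \<bullet> b / \<sigma>))"
      using bump_deriv[of "m b" "x \<bullet> b / \<sigma>"] unfolding has_field_derivative_def .
  qed
  then have der: "(bump_kernel \<sigma> m has_derivative (\<lambda>h. \<Sum>b\<in>Basis. bump (Suc (m b)) ((x \<bullet> b) / \<sigma>) * ((h \<bullet> b) / \<sigma>) *
     (\<Prod>c\<in>Basis - {b}. bump (m c) ((x \<bullet> c) / \<sigma>)))) (at x)"
    unfolding bump_kernel_def[abs_def] by (intro has_derivative_prod)
  have eq: "bump (Suc (m b)) ((x \<bullet> b) / \<sigma>) * ((h \<bullet> b) / \<sigma>) * (\<Prod>c\<in>Basis - {b}. bump (m c) ((x \<bullet> c) / \<sigma>))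
     = h \<bullet> ((bump_kernel \<sigma> (m(b := Suc (m b))) x / \<sigma>) *\<^sub>R b)" if "b \<in> Basis" for b h
  proof -
    have "bump_kernel \<sigma> (m(b := Suc (m b))) x = bump (Suc (m b)) ((x \<bullet> b) / \<sigma>) * (\<Prod>c\<in>Basis - {b}. bump (m c) ((x \<bullet> c) / \<sigma>))"
      unfolding bump_kernel_def using that by (subst prod.remove[of _ b]) (auto intro!: prod.cong)
    then show ?thesis by simp
  qed
  show ?thesis unfolding gderiv_def bump_kernel_grad_def inner_sum_right
    by (rule has_derivative_eq_rhs[OF der]) (intro ext sum.cong refl eq)
qed

lemma bump_kernel_continuous: "0 < \<sigma> \<Longrightarrow> continuous_on UNIV (bump_kernel \<sigma> m)"
  by (rule GDERIV_continuous_on[OF bump_kernel_GDERIV])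

lemma bump_kernel_zero:
  fixes x :: "'a::euclidean_space" and \<sigma> :: real
  assumes "0 < \<sigma>" "\<sigma> * DIM('a) < norm x" shows "bump_kernel \<sigma> m x = 0"
proof -
  have "\<exists>b\<in>Basis. \<sigma> < \<bar>x \<bullet> b\<bar>"
  proof (rule ccontr)
    assume "\<not> ?thesis"
    then have "(\<Sum>b\<in>Basis. \<bar>x \<bullet> b\<bar>) \<le> (\<Sum>b\<in>(Basis::'a set). \<sigma>)" by (intro sum_mono) (auto simp: not_less)
    then show False using norm_le_l1[of x] assms by (simp add: mult.commute)
  qed
  then obtain b where b: "b \<in> Basis" "\<sigma> < \<bar>x \<bullet> b\<bar>" by blast
  then have "bump (m b) ((x \<bullet> b) / \<sigma>) = 0" using assms by (intro bump_zero) (auto simp: field_simps)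
  then show ?thesis unfolding bump_kernel_def using b(1) by (intro prod_zero) auto
qed

lemma bump_kernel_C1c:
  assumes "0 < \<sigma>" shows "C1c UNIV (bump_kernel \<sigma> m) (bump_kernel_grad \<sigma> m)"
  unfolding C1c_def
proof (intro conjI allI)
  show "continuous_on UNIV (bump_kernel_grad \<sigma> m)" unfolding bump_kernel_grad_def[abs_def] divide_inverse
    by (intro continuous_intros bump_kernel_continuous assms)
  show "csupp UNIV (bump_kernel \<sigma> m)" unfolding csupp_def
    by (intro exI[of _ "cball 0 (\<sigma> * DIM('a))"]) (use bump_kernel_zero[OF assms] in \<open>auto simp: not_le\<close>)
qed (rule bump_kernel_GDERIV[OF assms])

text \<open>The kernel is taken at y - x, so each derivative in x raises one entry of
  \<open>m\<close> and brings the factor -1/\<sigma>.\<close>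

definition kconv :: "real \<Rightarrow> ('a \<Rightarrow> nat) \<Rightarrow> ('a \<Rightarrow> real) \<Rightarrow> 'a::euclidean_space \<Rightarrow> real" where
  "kconv \<sigma> m f x = (\<integral>y. bump_kernel \<sigma> m (y - x) * f y \<partial>lborel)"

lemma bump_kernel_shift_continuous:
  "0 < \<sigma> \<Longrightarrow> continuous_on UNIV (\<lambda>y. bump_kernel \<sigma> m (y - x))"
  by (rule continuous_on_compose2[OF bump_kernel_continuous]) (auto intro!: continuous_intros)

lemma bump_kernel_grad_shift_continuous:
  "0 < \<sigma> \<Longrightarrow> continuous_on UNIV (\<lambda>y. bump_kernel_grad \<sigma> m (y - x))"
  using bump_kernel_C1c[of \<sigma> m] unfolding C1c_def
  by (auto intro!: continuous_intros continuous_on_compose2[of UNIV "bump_kernel_grad \<sigma> m" UNIV "\<lambda>y. y - x"])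

text \<open>Differentiation under the integral sign: the gradient of the kernel is uniformly
  continuous, so its first order Taylor error is at most e' |h| for all y simultaneously, and
  integrating against |f| preserves this order.\<close>

lemma kconv_GDERIV:
  assumes s: "0 < \<sigma>" and f: "Cc U f"
  shows "GDERIV (kconv \<sigma> m f) x :> (\<Sum>b\<in>Basis. (- kconv \<sigma> (m(b := Suc (m b))) f x / \<sigma>) *\<^sub>R b)"
proof -
  let ?k = "bump_kernel \<sigma> m" and ?D = "bump_kernel_grad \<sigma> m"
  define E where "E = - (\<integral>y. f y *\<^sub>R ?D (y - x) \<partial>lborel)"
  note kc = bump_kernel_shift_continuous[OF s] and kg = bump_kernel_grad_shift_continuous[OF s]
  have fi: "integrable lborel (\<lambda>y. f y *\<^sub>R ?D (y - x))"
    by (rule Cc_integrable[OF Cc_scaleR[OF f kg]])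
  have uc: "uniformly_continuous_on UNIV ?D" using C1c_Cc[OF bump_kernel_C1c[OF s]] Cc_uniformly_continuous by blast
  have "((kconv \<sigma> m f) has_derivative (\<lambda>h. h \<bullet> E)) (at x)"
    unfolding has_derivative_at_alt
  proof (intro conjI allI impI)
    show "bounded_linear (\<lambda>h. h \<bullet> E)" by (rule bounded_linear_inner_left)
    fix e :: real assume e: "0 < e"
    define M where "M = (\<integral>y. \<bar>f y\<bar> \<partial>lborel)"
    have M: "M \<ge> 0" unfolding M_def by simp
    define e' where "e' = e / (M + 1)"
    have e': "e' > 0" "e' * M \<le> e" using e M by (auto simp: e'_def field_simps intro!: add_nonneg_pos mult_left_mono)
    obtain d where d: "d > 0" "\<And>a b. dist a b < d \<Longrightarrow> dist (?D a) (?D b) < e'"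
      using uc e' unfolding uniformly_continuous_on_def by (metis UNIV_I)
    show "\<exists>d>0. \<forall>y. norm (y - x) < d \<longrightarrow> norm (kconv \<sigma> m f y - kconv \<sigma> m f x - (y - x) \<bullet> E) \<le> e * norm (y - x)"
    proof (intro exI[of _ d] conjI allI impI d(1))
      fix z assume z: "norm (z - x) < d"
      let ?h = "z - x"
      have bnd: "\<bar>?k (y - z) - ?k (y - x) + ?h \<bullet> ?D (y - x)\<bar> \<le> e' * norm ?h" for y
      proof -
        have "\<bar>?k (y - z) - ?k (y - x) - ((y - z) - (y - x)) \<bullet> ?D (y - x)\<bar> \<le> e' * norm ((y - z) - (y - x))"
        proof (rule GDERIV_increment_bound[of _ _ _ ?D])
          fix w assume "w \<in> closed_segment (y - x) (y - z)"
          then have "dist w (y - x) \<le> norm ((y - z) - (y - x))"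
            by (metis dist_in_closed_segment(1) dist_norm norm_minus_commute dist_commute)
          then have "dist w (y - x) < d" using z by (simp add: norm_minus_commute)
          then show "norm (?D w - ?D (y - x)) \<le> e'" using d(2)[of w "y - x"] by (simp add: dist_norm)
        qed (use bump_kernel_GDERIV[OF s] in auto)
        moreover have "(y - z) - (y - x) = - ?h" by simp
        ultimately show ?thesis by (simp only: inner_minus_left norm_minus_cancel diff_minus_eq_add)
      qed
      have hE: "?h \<bullet> E = - (\<integral>y. f y * (?h \<bullet> ?D (y - x)) \<partial>lborel)"
        using fi unfolding E_def by (simp flip: integral_inner_right)
      have i1: "integrable lborel (\<lambda>y. ?k (y - z) * f y)" for z by (rule Cc_integrable[OF Cc_mult_left[OF kc f]])
      have i2: "integrable lborel (\<lambda>y. f y * (?h \<bullet> ?D (y - x)))"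
        by (rule Cc_integrable[OF Cc_mult_right[OF f]]) (intro continuous_intros kg)
      have "kconv \<sigma> m f z - kconv \<sigma> m f x - ?h \<bullet> E
        = (\<integral>y. ?k (y - z) * f y - ?k (y - x) * f y + f y * (?h \<bullet> ?D (y - x)) \<partial>lborel)"
        unfolding kconv_def hE using i1 i2 by simp
      also have "\<bar>\<dots>\<bar> \<le> (\<integral>y. e' * norm ?h * \<bar>f y\<bar> \<partial>lborel)"
      proof (rule order_trans[OF integral_abs_bound], rule integral_mono)
        show "integrable lborel (\<lambda>y. \<bar>?k (y - z) * f y - ?k (y - x) * f y + f y * (?h \<bullet> ?D (y - x))\<bar>)"
          using i1 i2 by auto
        show "integrable lborel (\<lambda>y. e' * norm ?h * \<bar>f y\<bar>)" using Cc_integrable[OF f] by auto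
        fix y
        have "\<bar>?k (y - z) * f y - ?k (y - x) * f y + f y * (?h \<bullet> ?D (y - x))\<bar>
           = \<bar>?k (y - z) - ?k (y - x) + ?h \<bullet> ?D (y - x)\<bar> * \<bar>f y\<bar>"
          by (simp add: abs_mult[symmetric] algebra_simps)
        also have "\<dots> \<le> e' * norm ?h * \<bar>f y\<bar>" by (rule mult_right_mono[OF bnd]) simp
        finally show "\<bar>?k (y - z) * f y - ?k (y - x) * f y + f y * (?h \<bullet> ?D (y - x))\<bar> \<le> e' * norm ?h * \<bar>f y\<bar>" .
      qed
      also have "\<dots> = (e' * M) * norm ?h" by (simp add: M_def)
      also have "\<dots> \<le> e * norm ?h" by (rule mult_right_mono[OF e'(2)]) simp
      finally show "norm (kconv \<sigma> m f z - kconv \<sigma> m f x - ?h \<bullet> E) \<le> e * norm ?h" by simp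
    qed
  qed
  moreover have "E = (\<Sum>b\<in>Basis. (- kconv \<sigma> (m(b := Suc (m b))) f x / \<sigma>) *\<^sub>R b)"
  proof (rule euclidean_eqI)
    fix b :: 'a assume b: "b \<in> Basis"
    have "E \<bullet> b = - (\<integral>y. f y * (?D (y - x) \<bullet> b) \<partial>lborel)"
      using fi unfolding E_def by (simp flip: integral_inner_left)
    also have "\<dots> = - (\<integral>y. (bump_kernel \<sigma> (m(b := Suc (m b))) (y - x) * f y) / \<sigma> \<partial>lborel)"
      using b by (simp add: bump_kernel_grad_def inner_sum_left inner_Basis if_distrib sum.delta' mult.commute cong: if_cong)
    also have "\<dots> = - kconv \<sigma> (m(b := Suc (m b))) f x / \<sigma>"
      by (simp add: kconv_def)
    finally show "E \<bullet> b = (\<Sum>b\<in>Basis. (- kconv \<sigma> (m(b := Suc (m b))) f x / \<sigma>) *\<^sub>R b) \<bullet> b"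
      using b by (simp add: inner_sum_left inner_Basis if_distrib sum.delta' cong: if_cong)
  qed
  ultimately show ?thesis unfolding gderiv_def by simp
qed

lemma GDERIV_grad:
  fixes f :: "'a::euclidean_space \<Rightarrow> real"
  assumes "GDERIV f x :> D"
  shows "f differentiable (at x)" "frechet_derivative f (at x) = (\<lambda>h. h \<bullet> D)" "grad f x = D"
proof -
  show "f differentiable (at x)" using assms unfolding gderiv_def differentiable_def by blast
  show *: "frechet_derivative f (at x) = (\<lambda>h. h \<bullet> D)"
    using assms unfolding gderiv_def by (simp add: frechet_derivative_at[symmetric])
  show "grad f x = D" unfolding grad_def * by (subst inner_commute) (rule euclidean_representation)
qed

text \<open>The constant \<open>c\<close> and the multi-index are generalised because a partial
  derivative is again a multiple, by -c/\<sigma>, of a \<open>kconv\<close> with a larger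
  multi-index.\<close>

lemma kconv_Ck: "0 < \<sigma> \<Longrightarrow> Cc U f \<Longrightarrow> Ck_on k UNIV (\<lambda>x. c * kconv \<sigma> m f x)"
proof (induction k arbitrary: c m)
  case 0
  have "continuous_on UNIV (kconv \<sigma> m f)" by (rule GDERIV_continuous_on[OF kconv_GDERIV[OF 0]])
  then show ?case by (auto intro!: continuous_intros)
next
  case (Suc k)
  let ?D = "\<lambda>x. (\<Sum>b\<in>Basis. (- kconv \<sigma> (m(b := Suc (m b))) f x / \<sigma>) *\<^sub>R b)"
  have D: "GDERIV (\<lambda>x. c * kconv \<sigma> m f x) x :> c *\<^sub>R ?D x" for x
    using GDERIV_mult[OF GDERIV_const kconv_GDERIV[OF Suc.prems], of c] by simp
  have "Ck_on k UNIV (\<lambda>x. frechet_derivative (\<lambda>x. c * kconv \<sigma> m f x) (at x) b)" if b: "b \<in> Basis" for b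
  proof -
    have "frechet_derivative (\<lambda>x. c * kconv \<sigma> m f x) (at x) b = (- c / \<sigma>) * kconv \<sigma> (m(b := Suc (m b))) f x" for x
      unfolding GDERIV_grad(2)[OF D] using b by (simp add: inner_sum_right inner_Basis if_distrib cong: if_cong)
    then show ?thesis by (simp only: Suc.IH[OF Suc.prems])
  qed
  then show ?case using GDERIV_grad(1)[OF D] by auto
qed

definition mollify :: "real \<Rightarrow> ('a \<Rightarrow> real) \<Rightarrow> 'a::euclidean_space \<Rightarrow> real" where
  "mollify \<sigma> f x = inverse (\<integral>y. bump_kernel \<sigma> (\<lambda>_. 0) (y::'a) \<partial>lborel) * kconv \<sigma> (\<lambda>_. 0) f x"

lemma bump_kernel_nonneg: "0 \<le> bump_kernel \<sigma> (\<lambda>_. 0) x"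
  unfolding bump_kernel_def by (intro prod_nonneg) (auto simp: bump_0_nonneg)

lemma bump_kernel_integral_pos:
  fixes \<sigma> :: real
  assumes "0 < \<sigma>" shows "0 < (\<integral>y. bump_kernel \<sigma> (\<lambda>_. 0) (y::'a::euclidean_space) \<partial>lborel)"
proof -
  let ?k = "bump_kernel \<sigma> (\<lambda>_. 0) :: 'a \<Rightarrow> real"
  have k0: "?k 0 > 0" unfolding bump_kernel_def by (intro prod_pos) (auto simp: bump_0_pos)
  have "open {x. ?k x > ?k 0 / 2}" by (intro open_Collect_less continuous_intros bump_kernel_continuous assms)
  then obtain e where e: "e > 0" "ball 0 e \<subseteq> {x. ?k x > ?k 0 / 2}" using k0 open_contains_ball
    by (metis (no_types, lifting) field_sum_of_halves less_add_same_cancel1 mem_Collect_eq half_gt_zero)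
  have "0 < ?k 0 / 2 * measure lborel (ball (0::'a) e)" using k0 e content_ball_pos[OF e(1), of "0::'a"] by simp
  also have "\<dots> = (\<integral>x. ?k 0 / 2 * indicator (ball (0::'a) e) x \<partial>lborel)" by simp
  also have "\<dots> \<le> integral\<^sup>L lborel ?k"
  proof (rule integral_mono)
    show "integrable lborel (\<lambda>x. ?k 0 / 2 * indicator (ball (0::'a) e) x)"
      using emeasure_bounded_finite[of "ball (0::'a) e"] by (intro integrable_mult_right integrable_real_indicator) (auto simp: less_top)
    show "integrable lborel ?k" by (rule Cc_integrable[OF C1c_Cc(1)[OF bump_kernel_C1c[OF assms]]])
    show "?k 0 / 2 * indicator (ball (0::'a) e) x \<le> ?k x" for x
      using e(2) bump_kernel_nonneg[of \<sigma> x] by (cases "x \<in> ball 0 e") (auto simp: less_imp_le)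
  qed
  finally show ?thesis .
qed

lemma mollify_smooth: "0 < \<sigma> \<Longrightarrow> Cc U f \<Longrightarrow> smooth_on UNIV (mollify \<sigma> f)"
  unfolding smooth_on_def mollify_def[abs_def] using kconv_Ck by blast

text \<open>A mollification is an average of values at distance at most \<sigma> times the
  dimension; that radius encloses the cube supporting the kernel. Uniform convergence, vanishing off
  a neighbourhood and equality to 1 inside a cutoff are all instances.\<close>

lemma mollify_near:
  fixes \<sigma> :: real and f :: "'a::euclidean_space \<Rightarrow> real"
  assumes s: "0 < \<sigma>" and f: "continuous_on UNIV f"
    and e: "\<And>y. norm (y - x) \<le> \<sigma> * DIM('a) \<Longrightarrow> \<bar>f y - c\<bar> \<le> e"
  shows "\<bar>mollify \<sigma> f x - c\<bar> \<le> e"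
proof -
  let ?k = "bump_kernel \<sigma> (\<lambda>_. 0) :: 'a \<Rightarrow> real"
  define Z where "Z = integral\<^sup>L lborel ?k"
  have Z: "Z > 0" unfolding Z_def by (rule bump_kernel_integral_pos[OF s])
  have kC: "Cc UNIV (\<lambda>y. ?k (y - x))" using Cc_translate[OF C1c_Cc(1)[OF bump_kernel_C1c[OF s]], of "\<lambda>_. 0" "- x"] by simp
  have Zx: "(\<integral>y. ?k (y - x) \<partial>lborel) = Z"
    using Cc_integral_translate[OF C1c_Cc(1)[OF bump_kernel_C1c[OF s]], of "\<lambda>_. 0" "- x"] by (simp add: Z_def)
  have "kconv \<sigma> (\<lambda>_. 0) f x - c * Z = (\<integral>y. ?k (y - x) * f y - c * ?k (y - x) \<partial>lborel)"
    unfolding kconv_def Zx[symmetric]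
    using Cc_integrable[OF Cc_mult_right[OF kC f]] Cc_integrable[OF kC] by simp
  also have "\<bar>\<dots>\<bar> \<le> (\<integral>y. e * ?k (y - x) \<partial>lborel)"
  proof (rule order_trans[OF integral_abs_bound], rule integral_mono)
    fix y
    have "\<bar>?k (y - x) * f y - c * ?k (y - x)\<bar> = ?k (y - x) * \<bar>f y - c\<bar>"
    proof -
      have "?k (y - x) * f y - c * ?k (y - x) = ?k (y - x) * (f y - c)" by (simp add: algebra_simps)
      then show ?thesis using bump_kernel_nonneg[of \<sigma> "y - x"] by (simp only: abs_mult abs_of_nonneg)
    qed
    also have "\<dots> \<le> ?k (y - x) * e"
    proof (cases "norm (y - x) \<le> \<sigma> * DIM('a)")
      case True then show ?thesis using e bump_kernel_nonneg by (intro mult_left_mono) auto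
    next
      case False then show ?thesis using bump_kernel_zero[OF s, of "y - x"] by simp
    qed
    finally show "\<bar>?k (y - x) * f y - c * ?k (y - x)\<bar> \<le> e * ?k (y - x)" by (simp add: mult.commute)
  qed (use Cc_integrable[OF Cc_mult_right[OF kC f]] Cc_integrable[OF kC] in auto)
  also have "\<dots> = e * Z" by (simp add: Zx)
  finally have "\<bar>kconv \<sigma> (\<lambda>_. 0) f x - c * Z\<bar> / Z \<le> e" using Z by (simp add: field_simps)
  moreover have "mollify \<sigma> f x - c = (kconv \<sigma> (\<lambda>_. 0) f x - c * Z) / Z"
    using Z by (simp add: mollify_def Z_def[symmetric] field_simps)
  ultimately show ?thesis using Z by (simp add: abs_divide)
qed

text \<open>The derivative first falls on the kernel; integrating by parts moves it to
  \<open>f\<close>. Gradients therefore converge by the same averaging argument as values.\<close>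

lemma mollify_GDERIV:
  fixes f :: "'a::euclidean_space \<Rightarrow> real"
  assumes s: "0 < \<sigma>" and f: "C1c U f Df"
  shows "GDERIV (mollify \<sigma> f) x :> (\<Sum>b\<in>Basis. mollify \<sigma> (\<lambda>y. Df y \<bullet> b) x *\<^sub>R b)"
proof -
  let ?k = "bump_kernel \<sigma> (\<lambda>_. 0) :: 'a \<Rightarrow> real"
  let ?Z = "integral\<^sup>L lborel ?k"
  note fc = C1c_Cc[OF f]
  have "kconv \<sigma> ((\<lambda>_. 0)(b := Suc 0)) f x / \<sigma> = - kconv \<sigma> (\<lambda>_. 0) (\<lambda>y. Df y \<bullet> b) x" if b: "b \<in> Basis" for b
  proof -
    have G: "GDERIV (\<lambda>y. ?k (y - x)) y :> bump_kernel_grad \<sigma> (\<lambda>_. 0) (y - x)" for y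
      using C1c_GDERIV[OF C1c_translate[OF bump_kernel_C1c[OF s]], of "\<lambda>_. 0" "- x"] by simp
    have "(\<integral>y. f y * (bump_kernel_grad \<sigma> (\<lambda>_. 0) (y - x) \<bullet> b) \<partial>lborel) = - (\<integral>y. (Df y \<bullet> b) * ?k (y - x) \<partial>lborel)"
      by (rule C1c_integral_by_parts[OF f G bump_kernel_grad_shift_continuous[OF s] b])
    moreover have "bump_kernel_grad \<sigma> (\<lambda>_. 0) z \<bullet> b = bump_kernel \<sigma> ((\<lambda>_. 0)(b := Suc 0)) z / \<sigma>" for z
      using b by (simp add: bump_kernel_grad_def inner_sum_left inner_Basis if_distrib sum.delta' cong: if_cong)
    ultimately show ?thesis by (simp add: kconv_def mult.commute)
  qed
  then have "(\<Sum>b\<in>Basis. mollify \<sigma> (\<lambda>y. Df y \<bullet> b) x *\<^sub>R b) =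
    inverse ?Z *\<^sub>R (\<Sum>b\<in>Basis. (- kconv \<sigma> ((\<lambda>_. 0)(b := Suc 0)) f x / \<sigma>) *\<^sub>R b)"
    unfolding mollify_def scaleR_sum_right by (intro sum.cong) auto
  then show ?thesis using GDERIV_mult[OF GDERIV_const kconv_GDERIV[OF s fc(1)], of "inverse ?Z" "\<lambda>_. 0" x]
    unfolding mollify_def[abs_def] by simp
qed

section \<open>Test functions, smooth approximation and cutoffs\<close>

lemma Ck_1_GDERIV:
  assumes "Ck_on 1 U f" "x \<in> U" shows "GDERIV f x :> grad f x"
proof -
  have d: "(f has_derivative frechet_derivative f (at x)) (at x)"
    using assms frechet_derivative_works by auto
  have "frechet_derivative f (at x) h = h \<bullet> grad f x" for h
  proof -
    interpret linear "frechet_derivative f (at x)" using d has_derivative_linear by blast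
    have "frechet_derivative f (at x) h = frechet_derivative f (at x) (\<Sum>b\<in>Basis. (h \<bullet> b) *\<^sub>R b)"
      by (simp add: euclidean_representation)
    also have "\<dots> = h \<bullet> grad f x" unfolding grad_def by (simp add: sum scale inner_sum_right mult.commute)
    finally show ?thesis .
  qed
  then show ?thesis using d unfolding gderiv_def by presburger
qed

lemma Ck_1_continuous_grad:
  assumes "Ck_on 1 U f" shows "continuous_on U (grad f)"
  using assms unfolding grad_def[abs_def] by (auto intro!: continuous_intros)

lemma test_fun_C1c:
  assumes "test_fun U f" shows "C1c U f (grad f)"
proof -
  have "Ck_on 1 UNIV f" using assms unfolding test_fun_def smooth_on_def by blast
  moreover have "csupp U f" unfolding csupp_def
    using assms closure_subset[of "{x. f x \<noteq> 0}"] unfolding test_fun_def by blast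
  ultimately show ?thesis unfolding C1c_def by (auto intro: Ck_1_GDERIV Ck_1_continuous_grad)
qed

lemma test_funI:
  fixes f :: "'a::euclidean_space \<Rightarrow> real"
  assumes "smooth_on UNIV f" "compact K" "K \<subseteq> U" "\<And>x. x \<notin> K \<Longrightarrow> f x = 0"
  shows "test_fun U f"
proof -
  have "closure {x. f x \<noteq> 0} \<subseteq> K" using assms by (intro closure_minimal) (auto simp: compact_imp_closed)
  moreover from this have "compact (closure {x. f x \<noteq> 0})"
    using compact_Int_closed[OF assms(2), of "closure {x. f x \<noteq> 0}"] by (simp add: Int_absorb1)
  ultimately show ?thesis unfolding test_fun_def using assms by auto
qed

lemma compact_neighbourhood:
  fixes K :: "'a::euclidean_space set"
  assumes "compact K" "open U" "K \<subseteq> U"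
  obtains r L where "0 < r" "compact L" "L \<subseteq> U" "\<And>x y. x \<in> K \<Longrightarrow> dist x y \<le> r \<Longrightarrow> y \<in> L"
proof -
  obtain e where e: "e > 0" "(\<Union>x\<in>K. ball x e) \<subseteq> U"
    using compact_subset_open_imp_ball_epsilon_subset[OF assms] by blast
  define L where "L = {x + y |x y. x \<in> K \<and> y \<in> cball 0 (e / 2)}"
  have "compact L" unfolding L_def by (intro compact_sums assms compact_cball)
  moreover have "L \<subseteq> U" using e unfolding L_def by (force simp: dist_norm)
  moreover have "y \<in> L" if "x \<in> K" "dist x y \<le> e / 2" for x y
    unfolding L_def using that by (intro CollectI exI[of _ x] exI[of _ "y - x"]) (auto simp: dist_norm norm_minus_commute)
  ultimately show ?thesis using that[of "e / 2" L] e by auto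
qed

lemma mollify_zero:
  fixes \<sigma> :: real and f :: "'a::euclidean_space \<Rightarrow> real"
  assumes "0 < \<sigma>" "continuous_on UNIV f" "\<And>y. norm (y - x) \<le> \<sigma> * DIM('a) \<Longrightarrow> f y = 0"
  shows "mollify \<sigma> f x = 0"
  using mollify_near[OF assms(1,2), of x 0 0] assms(3) by auto

lemma mollify_uniform:
  fixes f :: "'a::euclidean_space \<Rightarrow> real"
  assumes f: "Cc U f" and e: "0 < e"
  obtains s where "0 < s" "\<And>\<sigma> x. 0 < \<sigma> \<Longrightarrow> \<sigma> < s \<Longrightarrow> \<bar>mollify \<sigma> f x - f x\<bar> \<le> e"
proof -
  obtain d where d: "d > 0" "\<And>x y. dist x y < d \<Longrightarrow> dist (f x) (f y) < e"
    using Cc_uniformly_continuous[OF f] e unfolding uniformly_continuous_on_def by (metis UNIV_I)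
  show ?thesis
  proof (rule that[of "d / DIM('a)"])
    fix \<sigma> :: real and x :: 'a assume s: "0 < \<sigma>" "\<sigma> < d / DIM('a)"
    then have "\<sigma> * DIM('a) < d" by (simp add: field_simps)
    then show "\<bar>mollify \<sigma> f x - f x\<bar> \<le> e" using d(2)
      by (intro mollify_near s CcD[OF f]) (auto simp: dist_norm intro: less_imp_le)
  qed (use d in auto)
qed

text \<open>The set \<open>L\<close> is fixed before the accuracy, so that all approximations can be
  controlled by one cutoff. The gradient clause is conditional so that a merely continuous
  \<open>f\<close> is covered too.\<close>

lemma Cc_test_fun_approx:
  fixes f :: "'a::euclidean_space \<Rightarrow> real"
  assumes U: "open U" and f: "Cc U f"
  obtains L where "compact L" "L \<subseteq> U" "\<And>x. x \<notin> L \<Longrightarrow> f x = 0"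
    "\<And>e. 0 < e \<Longrightarrow> \<exists>g. test_fun U g \<and> (\<forall>x. x \<notin> L \<longrightarrow> g x = 0) \<and> (\<forall>x. \<bar>g x - f x\<bar> \<le> e) \<and>
       (\<forall>Df. C1c U f Df \<longrightarrow> (\<forall>x. norm (grad g x - Df x) \<le> e))"
proof -
  obtain K where K: "compact K" "K \<subseteq> U" "\<And>x. x \<notin> K \<Longrightarrow> f x = 0"
    using f unfolding Cc_def csupp_def by blast
  obtain r L where L: "0 < r" "compact L" "L \<subseteq> U" "\<And>x y. x \<in> K \<Longrightarrow> dist x y \<le> r \<Longrightarrow> y \<in> L"
    using compact_neighbourhood[OF K(1) U K(2)] by metis
  show ?thesis
  proof (rule that[OF L(2,3)])
    show "f x = 0" if "x \<notin> L" for x using K(3) L(4)[of x x] L(1) that by fastforce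
    fix e :: real assume e: "0 < e"
    obtain s1 where s1: "0 < s1" "\<And>\<sigma> x. 0 < \<sigma> \<Longrightarrow> \<sigma> < s1 \<Longrightarrow> \<bar>mollify \<sigma> f x - f x\<bar> \<le> e"
      using mollify_uniform[OF f e] by metis
    have "\<exists>s2>0. \<forall>Df \<sigma> x. C1c U f Df \<longrightarrow> 0 < \<sigma> \<longrightarrow> \<sigma> < s2 \<longrightarrow> norm (grad (mollify \<sigma> f) x - Df x) \<le> e"
    proof (cases "\<exists>Df. C1c U f Df")
      case True
      then obtain Df where Df: "C1c U f Df" by blast
      have e': "0 < e / DIM('a)" using e by simp
      have cb: "Cc U (\<lambda>y. Df y \<bullet> b)" for b by (intro Cc_inner_right C1c_Cc(2)[OF Df] continuous_intros)
      have "\<exists>s>0. \<forall>\<sigma> x. 0 < \<sigma> \<longrightarrow> \<sigma> < s \<longrightarrow> \<bar>mollify \<sigma> (\<lambda>y. Df y \<bullet> b) x - Df x \<bullet> b\<bar> \<le> e / DIM('a)" for b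
        using mollify_uniform[OF cb e'] by metis
      then obtain S where S: "\<And>b. S b > 0" "\<And>b \<sigma> x. 0 < \<sigma> \<Longrightarrow> \<sigma> < S b \<Longrightarrow> \<bar>mollify \<sigma> (\<lambda>y. Df y \<bullet> b) x - Df x \<bullet> b\<bar> \<le> e / DIM('a)"
        by metis
      have "norm (grad (mollify \<sigma> f) x - Df' x) \<le> e" if \<sigma>: "0 < \<sigma>" "\<sigma> < Min (S ` Basis)" and Df': "C1c U f Df'" for \<sigma> x Df'
      proof -
        have eq: "Df' x = Df x" using GDERIV_grad(3) C1c_GDERIV Df Df' by metis
        have "(grad (mollify \<sigma> f) x - Df x) \<bullet> b = mollify \<sigma> (\<lambda>y. Df y \<bullet> b) x - Df x \<bullet> b" if "b \<in> Basis" for b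
          unfolding GDERIV_grad(3)[OF mollify_GDERIV[OF \<sigma>(1) Df]]
          using that by (simp add: inner_diff_left inner_sum_left inner_Basis if_distrib sum.delta' cong: if_cong)
        then have "(\<Sum>b\<in>Basis. \<bar>(grad (mollify \<sigma> f) x - Df x) \<bullet> b\<bar>) \<le> (\<Sum>b\<in>(Basis::'a set). e / DIM('a))"
          using S(2) \<sigma> by (intro sum_mono) auto
        also have "\<dots> = e" by simp
        finally show ?thesis unfolding eq using norm_le_l1 order_trans by blast
      qed
      then show ?thesis using S(1) by (intro exI[of _ "Min (S ` Basis)"]) auto
    qed (auto intro: exI[of _ 1])
    then obtain s2 where s2: "s2 > 0"
      "\<And>Df \<sigma> x. C1c U f Df \<Longrightarrow> 0 < \<sigma> \<Longrightarrow> \<sigma> < s2 \<Longrightarrow> norm (grad (mollify \<sigma> f) x - Df x) \<le> e" by blast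
    define t where "t = min (min s1 s2) (r / DIM('a))"
    have t: "0 < t" "t \<le> s1" "t \<le> s2" "t \<le> r / DIM('a)" using s1 s2 L(1) by (simp_all add: t_def)
    define \<sigma> where "\<sigma> = t / 2"
    have \<sigma>: "0 < \<sigma>" "\<sigma> < s1" "\<sigma> < s2" using t by (simp_all add: \<sigma>_def)
    have "\<sigma> \<le> r / DIM('a)" using t unfolding \<sigma>_def by linarith
    then have \<sigma>r: "\<sigma> * DIM('a) \<le> r" by (simp add: field_simps)
    have zero: "mollify \<sigma> f x = 0" if "x \<notin> L" for x
      using that K(3) L(4)[of _ x] \<sigma>r by (intro mollify_zero \<sigma> CcD[OF f]) (force simp: dist_norm)
    have "test_fun U (mollify \<sigma> f)"
      using mollify_smooth[OF \<sigma>(1) f] L zero by (intro test_funI[of _ L]) auto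
    then show "\<exists>g. test_fun U g \<and> (\<forall>x. x \<notin> L \<longrightarrow> g x = 0) \<and> (\<forall>x. \<bar>g x - f x\<bar> \<le> e) \<and>
       (\<forall>Df. C1c U f Df \<longrightarrow> (\<forall>x. norm (grad g x - Df x) \<le> e))"
      using zero s1(2) s2(2) \<sigma> by (intro exI[of _ "mollify \<sigma> f"]) auto
  qed
qed

text \<open>A piecewise linear function of the distance to \<open>K\<close> is mollified. The value
  1 is reached on an open neighbourhood \<open>V\<close>, not only on \<open>K\<close>, so that the
  gradient of the cutoff vanishes near \<open>K\<close>.\<close>

lemma smooth_cutoff:
  fixes K :: "'a::euclidean_space set"
  assumes K: "compact K" and U: "open U" "K \<subseteq> U"
  obtains z V where "test_fun U z" "open V" "K \<subseteq> V" "V \<subseteq> U" "\<And>x. x \<in> V \<Longrightarrow> z x = 1" "\<And>x. 0 \<le> z x" "\<And>x. z x \<le> 1"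
proof -
  obtain r L where L: "0 < r" "compact L" "L \<subseteq> U" "\<And>x y. x \<in> K \<Longrightarrow> dist x y \<le> r \<Longrightarrow> y \<in> L"
    using compact_neighbourhood[OF K U] by metis
  show ?thesis
  proof (cases "K = {}")
    \<comment> \<open>By convention \<open>infdist\<close> to the empty set is 0, so the distance
      construction would give the constant 1.\<close>
    case True
    have "smooth_on UNIV (\<lambda>x::'a. 0::real)"
    proof -
      have "Ck_on k UNIV (\<lambda>x::'a. 0::real)" for k
        by (induction k) (auto simp: frechet_derivative_const)
      then show ?thesis by (simp add: smooth_on_def)
    qed
    then have "test_fun U (\<lambda>x. 0)" by (intro test_funI[of _ "{}"]) auto
    then show ?thesis using that[of "\<lambda>x. 0" "{}"] True by simp
  next
    case False
    define f where "f x = max 0 (min 1 (3 - (6 / r) * infdist x K))" for x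
    have fc: "continuous_on UNIV f" unfolding f_def[abs_def] by (intro continuous_intros)
    have f01: "0 \<le> f x" "f x \<le> 1" for x unfolding f_def by auto
    have clK: "closed K" using K compact_imp_closed by blast
    have f0: "f x = 0" if "r / 2 \<le> infdist x K" for x
      using that L(1) unfolding f_def by (auto simp: field_simps)
    have f1: "f x = 1" if "infdist x K \<le> r / 3" for x
      using that L(1) unfolding f_def by (auto simp: field_simps)
    have near: "\<exists>k\<in>K. dist k x \<le> infdist x K" for x
      using infdist_attains_inf[OF clK False, of x] by (metis dist_commute order_refl)
    have csf: "Cc U f" unfolding Cc_def csupp_def
    proof (intro conjI fc exI[of _ L] L allI impI)
      fix x assume "x \<notin> L"
      then show "f x = 0" using near[of x] L(1,4) f0[of x] by fastforce
    qed
    \<comment> \<open>The averaging radius becomes r/12, the gap between r/4, which bounds the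
      distance on \<open>V\<close>, and r/3, up to which \<open>f\<close> is 1. At distance at least
      r from \<open>K\<close> the averaged points stay beyond r/2, where \<open>f\<close> is
      0.\<close>
    define \<sigma> where "\<sigma> = r / (12 * DIM('a))"
    have \<sigma>: "\<sigma> > 0" "\<sigma> * DIM('a) = r / 12" using L(1) by (auto simp: \<sigma>_def field_simps)
    have z01: "\<bar>mollify \<sigma> f x - 1 / 2\<bar> \<le> 1 / 2" for x
      using f01 by (intro mollify_near \<sigma> fc) (auto simp: abs_le_iff field_simps)
    have infd: "infdist y K \<le> infdist x K + norm (y - x)" for x y
      using infdist_triangle[of y K x] by (simp add: dist_norm)
    define V where "V = U \<inter> {x. infdist x K < r / 4}"
    show ?thesis
    proof (rule that[of "mollify \<sigma> f" V])
      show "test_fun U (mollify \<sigma> f)"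
      proof (rule test_funI[OF mollify_smooth[OF \<sigma>(1) csf] L(2,3)])
        fix x assume x: "x \<notin> L"
        have rx: "r \<le> infdist x K" using near[of x] x L(4)[of _ x] by fastforce
        show "mollify \<sigma> f x = 0"
        proof (intro mollify_zero \<sigma> fc f0)
          fix y :: 'a assume "norm (y - x) \<le> \<sigma> * DIM('a)"
          then show "r / 2 \<le> infdist y K" using infd[of x y] rx \<sigma>(2) L(1) by (simp add: norm_minus_commute)
        qed
      qed
      show "open V" unfolding V_def by (intro open_Int U open_Collect_less continuous_intros)
      show "K \<subseteq> V" unfolding V_def using U L(1) by auto
      show "V \<subseteq> U" unfolding V_def by blast
      have "0 \<le> mollify \<sigma> f x \<and> mollify \<sigma> f x \<le> 1" for x using z01[of x] unfolding abs_le_iff by linarith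
      then show "0 \<le> mollify \<sigma> f x" "mollify \<sigma> f x \<le> 1" for x by auto
      show "mollify \<sigma> f x = 1" if x: "x \<in> V" for x
      proof -
        have "\<bar>mollify \<sigma> f x - 1\<bar> \<le> 0"
        proof (intro mollify_near \<sigma> fc)
          fix y assume "norm (y - x) \<le> \<sigma> * DIM('a)"
          then show "\<bar>f y - 1\<bar> \<le> 0" using f1[of y] infd[of y x] x \<sigma>(2) L(1) unfolding V_def by auto
        qed
        then show ?thesis by simp
      qed
    qed
  qed
qed

lemma smooth_cutoff_Cc:
  fixes K :: "'a::euclidean_space set"
  assumes "compact K" "open U" "K \<subseteq> U"
  obtains z :: "'a \<Rightarrow> real" where "Cc U z" "\<And>x. 0 \<le> z x" "\<And>x. x \<in> K \<Longrightarrow> z x = 1"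
proof -
  obtain z V where z: "test_fun U z" "K \<subseteq> V" "\<And>x. x \<in> V \<Longrightarrow> z x = 1" "\<And>x. 0 \<le> z x"
    using smooth_cutoff[OF assms] by metis
  show ?thesis
  proof (rule that)
    show "Cc U z" by (rule C1c_Cc(1)[OF test_fun_C1c[OF z(1)]])
  qed (use z in auto)
qed

subsection \<open>Removing the regular zeros\<close>

lemma test_fun_grad_component:
  assumes "test_fun U f" and b: "b \<in> Basis"
  obtains D where "C1c U (\<lambda>x. grad f x \<bullet> b) D"
proof -
  have gb: "grad f x \<bullet> b = frechet_derivative f (at x) b" for x
    using b by (simp add: grad_def inner_sum_left inner_Basis if_distrib sum.delta' cong: if_cong)
  have "Ck_on (Suc 1) UNIV f" using assms unfolding test_fun_def smooth_on_def by blast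
  then have "Ck_on 1 UNIV (\<lambda>x. grad f x \<bullet> b)" unfolding gb using b by auto
  moreover have "csupp U (\<lambda>x. grad f x \<bullet> b)"
    by (rule csupp_subset[OF CcD(2)[OF C1c_Cc(2)[OF test_fun_C1c[OF assms(1)]]]]) simp
  ultimately have "C1c U (\<lambda>x. grad f x \<bullet> b) (grad (\<lambda>x. grad f x \<bullet> b))"
    unfolding C1c_def by (auto intro: Ck_1_GDERIV Ck_1_continuous_grad)
  then show ?thesis using that by blast
qed

lemma Cc_integral_mono:
  fixes f g :: "'a::euclidean_space \<Rightarrow> real"
  assumes "Cc U f" "Cc V g" "\<And>x. f x \<le> g x"
  shows "integral\<^sup>L lborel f \<le> integral\<^sup>L lborel g"
  using assms Cc_integrable by (intro integral_mono) auto

lemma Cc_integral_abs_mono: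
  fixes f g :: "'a::euclidean_space \<Rightarrow> real"
  assumes "Cc U f" "Cc V g" "\<And>x. \<bar>f x\<bar> \<le> g x"
  shows "\<bar>integral\<^sup>L lborel f\<bar> \<le> integral\<^sup>L lborel g"
proof -
  have "\<bar>integral\<^sup>L lborel f\<bar> \<le> (\<integral>x. \<bar>f x\<bar> \<partial>lborel)" by (rule integral_abs_bound)
  also have "\<dots> \<le> integral\<^sup>L lborel g" by (rule Cc_integral_mono[OF Cc_abs[OF assms(1)] assms(2,3)])
  finally show ?thesis .
qed

lemma Cc_dominated:
  fixes f z :: "'a::euclidean_space \<Rightarrow> real"
  assumes "Cc U f" "\<And>x. 0 \<le> z x" "\<And>x. f x \<noteq> 0 \<Longrightarrow> z x = 1"
  obtains B where "0 < B" "\<And>x. \<bar>f x\<bar> \<le> B * z x"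
proof -
  obtain B where B: "B > 0" "\<And>x. norm (f x) \<le> B" using Cc_bounded[OF assms(1)] by metis
  have "\<bar>f x\<bar> \<le> B * z x" for x using B(2)[of x] assms(2,3)[of x] B(1) by (cases "f x = 0") auto
  then show ?thesis using that B(1) by blast
qed

lemma compact_bounded_below:
  fixes G :: "'a::euclidean_space \<Rightarrow> 'b::real_normed_vector"
  assumes "compact K" "continuous_on UNIV G" "\<And>x. x \<in> K \<Longrightarrow> G x \<noteq> 0"
  obtains m where "0 < m" "\<And>x. x \<in> K \<Longrightarrow> m \<le> norm (G x)"
proof (cases "K = {}")
  case False
  have "continuous_on K (\<lambda>x. norm (G x))" using assms(2) by (intro continuous_intros) (auto elim: continuous_on_subset)
  then obtain y where "y \<in> K" "\<forall>x\<in>K. norm (G y) \<le> norm (G x)"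
    using continuous_attains_inf[OF assms(1) False] by blast
  then show ?thesis using that[of "norm (G y)"] assms(3) by auto
qed (use that[of 1] in auto)

text \<open>The weight \<open>1 / (1 + (u / \<epsilon>)\<^sup>2)\<close> is \<open>\<epsilon>\<close> times the derivative of \<open>arctan (u / \<epsilon>)\<close> along
  a field transversal to the level sets, so its mass is \<open>O(\<epsilon>)\<close> where the gradient does not vanish.\<close>
lemma level_set_mass:
  fixes u :: "'a::euclidean_space \<Rightarrow> real"
  assumes u: "C1c UNIV u G" and V: "open V" and \<eta>: "Cc (V \<inter> {x. G x \<noteq> 0}) \<eta>"
  obtains C where "0 \<le> C" "\<And>\<epsilon>. 0 < \<epsilon> \<Longrightarrow> (\<integral>x. \<bar>\<eta> x\<bar> * inverse (1 + (u x / \<epsilon>)\<^sup>2) \<partial>lborel) \<le> C * \<epsilon>"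
proof -
  let ?W = "V \<inter> {x. G x \<noteq> 0}"
  have Gc: "continuous_on UNIV G" and uc: "continuous_on UNIV u" using C1c_Cc[OF u] CcD by auto
  have W: "open ?W" using V Gc by (intro open_Int open_Collect_neq continuous_intros) auto
  obtain K where K: "compact K" "K \<subseteq> ?W" "\<And>x. x \<notin> K \<Longrightarrow> \<eta> x = 0" using \<eta> unfolding Cc_def csupp_def by blast
  obtain z V1 where z: "test_fun ?W z" "open V1" "K \<subseteq> V1" "\<And>x. x \<in> V1 \<Longrightarrow> z x = 1" "\<And>x. 0 \<le> z x" "\<And>x. z x \<le> 1"
    using smooth_cutoff[OF K(1) W K(2)] by metis
  note zC = test_fun_C1c[OF z(1)]
  obtain L where L: "compact L" "L \<subseteq> ?W" "\<And>x. x \<notin> L \<Longrightarrow> z x = 0"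
    using C1c_Cc(1)[OF zC] unfolding Cc_def csupp_def by blast
  obtain m where m: "0 < m" "\<And>x. x \<in> L \<Longrightarrow> m \<le> norm (G x)"
    using compact_bounded_below[OF L(1) Gc] L(2) by blast
  \<comment> \<open>The transversal field must be differentiable, but \<open>G\<close> is only
    continuous. A gradient within m/2 of \<open>G\<close> still satisfies
    \<open>grad g x \<bullet> G x \<ge> m\<^sup>2 / 2\<close> where |G| \<ge> m.\<close>
  obtain g where g: "test_fun UNIV g" "\<And>x. norm (grad g x - G x) \<le> m / 2"
    using Cc_test_fun_approx[OF open_UNIV C1c_Cc(1)[OF u]] m(1) u by (metis half_gt_zero)
  have gc: "continuous_on UNIV (grad g)" using test_fun_C1c[OF g(1)] unfolding C1c_def by blast
  have gG: "m\<^sup>2 / 2 * z x \<le> z x * (grad g x \<bullet> G x)" for x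
  proof (cases "x \<in> L")
    case True
    have "\<bar>(grad g x - G x) \<bullet> G x\<bar> \<le> m / 2 * norm (G x)"
      using Cauchy_Schwarz_ineq2[of "grad g x - G x" "G x"] mult_right_mono[OF g(2), of "norm (G x)" x] by simp
    moreover have "grad g x \<bullet> G x = (grad g x - G x) \<bullet> G x + norm (G x) * norm (G x)"
      by (simp add: inner_diff_left dot_square_norm power2_eq_square)
    moreover have "m * norm (G x) \<le> norm (G x) * norm (G x)" "m * m \<le> m * norm (G x)"
      using m(1) m(2)[OF True] by (auto intro!: mult_right_mono mult_left_mono)
    ultimately have le: "m\<^sup>2 / 2 \<le> grad g x \<bullet> G x" unfolding power2_eq_square by (simp add: abs_le_iff field_simps)
    then show ?thesis using mult_left_mono[OF le z(5)[of x]] by (simp add: mult.commute)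
  qed (simp add: L)
  have "\<exists>D. C1c UNIV (\<lambda>x. grad g x \<bullet> b) D" if "b \<in> Basis" for b using test_fun_grad_component[OF g(1) that] by blast
  then obtain Dg where Dg: "\<And>b. b \<in> Basis \<Longrightarrow> C1c UNIV (\<lambda>x. grad g x \<bullet> b) (Dg b)" by metis
  define Y where "Y b x = z x * (grad g x \<bullet> b)" for b x
  define DY where "DY b x = z x *\<^sub>R Dg b x + (grad g x \<bullet> b) *\<^sub>R grad z x" for b x
  have YC: "C1c ?W (Y b) (DY b)" if "b \<in> Basis" for b
    unfolding Y_def[abs_def] DY_def[abs_def] using Dg[OF that] by (intro C1c_mult zC) (auto simp: C1c_def)
  \<comment> \<open>After integration by parts only |arctan| \<le> 2 and the derivatives of the
    fixed field \<open>Y\<close> remain, so this constant does not see \<epsilon>.\<close>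
  define C1 where "C1 = (\<Sum>b\<in>Basis. (\<integral>x. \<bar>DY b x \<bullet> b\<bar> * 2 \<partial>lborel))"
  have C1: "C1 \<ge> 0" unfolding C1_def by (intro sum_nonneg Bochner_Integration.integral_nonneg) auto
  obtain B where B: "0 < B" "\<And>x. \<bar>\<eta> x\<bar> \<le> B * z x"
  proof (rule Cc_dominated[OF \<eta> z(5)])
    show "z x = 1" if "\<eta> x \<noteq> 0" for x using that K(3) z(3,4) by blast
  qed blast
  define c where "c = m\<^sup>2 / 2"
  have c: "c > 0" using m(1) by (simp add: c_def)
  show ?thesis
  proof (rule that[of "B / c * C1"])
    show "0 \<le> B / c * C1" using B c C1 by simp
    fix \<epsilon> :: real assume \<epsilon>: "0 < \<epsilon>"
    let ?w = "\<lambda>x. inverse (1 + (u x / \<epsilon>)\<^sup>2)"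
    have wc: "continuous_on UNIV ?w"
      by (intro continuous_intros uc) (use \<epsilon> in \<open>auto simp: add_nonneg_eq_0_iff\<close>)
    have w0: "0 < ?w x" for x by (simp add: add_pos_nonneg)
    have aD: "GDERIV (\<lambda>x. arctan (u x / \<epsilon>)) x :> (?w x / \<epsilon>) *\<^sub>R G x" for x
      by (rule GDERIV_DERIV_compose[OF C1c_GDERIV[OF u]]) (use \<epsilon> in \<open>auto intro!: derivative_eq_intros simp: field_simps\<close>)
    have ac: "continuous_on UNIV (\<lambda>x. (?w x / \<epsilon>) *\<^sub>R G x)"
      by (rule continuous_on_scaleR[OF continuous_on_divide[OF wc continuous_on_const] Gc]) (use \<epsilon> in auto)
    have acb: "continuous_on UNIV (\<lambda>x. (?w x / \<epsilon>) *\<^sub>R G x \<bullet> b)" for b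
      by (rule continuous_on_inner[OF ac continuous_on_const])
    have "(\<integral>x. \<bar>\<eta> x\<bar> * ?w x \<partial>lborel) \<le> (\<integral>x. (B / c * \<epsilon>) * (\<Sum>b\<in>Basis. Y b x * ((?w x / \<epsilon>) *\<^sub>R G x \<bullet> b)) \<partial>lborel)"
    proof (rule Cc_integral_mono)
      show "Cc ?W (\<lambda>x. \<bar>\<eta> x\<bar> * ?w x)" by (intro Cc_mult_right Cc_abs \<eta> wc)
      show "Cc ?W (\<lambda>x. (B / c * \<epsilon>) * (\<Sum>b\<in>Basis. Y b x * ((?w x / \<epsilon>) *\<^sub>R G x \<bullet> b)))"
        by (intro Cc_mult_left[OF continuous_on_const] Cc_sum Cc_mult_right C1c_Cc(1)[OF YC] acb)
      fix x
      have "(\<Sum>b\<in>Basis. Y b x * ((?w x / \<epsilon>) *\<^sub>R G x \<bullet> b)) = (?w x / \<epsilon>) * (z x * (grad g x \<bullet> G x))"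
        unfolding Y_def by (subst (2) euclidean_inner) (simp add: sum_distrib_left mult_ac)
      moreover have "\<bar>\<eta> x\<bar> * ?w x \<le> (B / c) * ?w x * (c * z x)"
        using mult_right_mono[OF B(2)[of x], of "?w x"] w0[of x] c by (simp add: mult_ac)
      moreover have "\<dots> \<le> (B / c) * ?w x * (z x * (grad g x \<bullet> G x))"
        using gG[of x] B(1) c w0[of x] unfolding c_def[symmetric] by (intro mult_left_mono) auto
      ultimately show "\<bar>\<eta> x\<bar> * ?w x \<le> (B / c * \<epsilon>) * (\<Sum>b\<in>Basis. Y b x * ((?w x / \<epsilon>) *\<^sub>R G x \<bullet> b))"
        using \<epsilon> by (simp add: mult_ac)
    qed
    also have "\<dots> = (B / c * \<epsilon>) * (\<Sum>b\<in>Basis. (\<integral>x. Y b x * ((?w x / \<epsilon>) *\<^sub>R G x \<bullet> b) \<partial>lborel))"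
      by (subst integral_mult_right_zero, subst Bochner_Integration.integral_sum)
        (auto intro!: Cc_integrable[where U = ?W] Cc_mult_right C1c_Cc(1)[OF YC] acb simp del: inner_scaleR_left)
    also have "\<dots> \<le> (B / c * \<epsilon>) * C1"
    proof (rule mult_left_mono)
      show "(\<Sum>b\<in>Basis. (\<integral>x. Y b x * ((?w x / \<epsilon>) *\<^sub>R G x \<bullet> b) \<partial>lborel)) \<le> C1"
        unfolding C1_def
      proof (rule sum_mono)
        fix b :: 'a assume b: "b \<in> Basis"
        have "(\<integral>x. Y b x * ((?w x / \<epsilon>) *\<^sub>R G x \<bullet> b) \<partial>lborel) = - (\<integral>x. (DY b x \<bullet> b) * arctan (u x / \<epsilon>) \<partial>lborel)"
          by (rule C1c_integral_by_parts[OF YC[OF b] aD ac b])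
        also have "\<dots> \<le> \<bar>\<integral>x. (DY b x \<bullet> b) * arctan (u x / \<epsilon>) \<partial>lborel\<bar>" by simp
        also have "\<dots> \<le> (\<integral>x. \<bar>DY b x \<bullet> b\<bar> * 2 \<partial>lborel)"
        proof (rule Cc_integral_abs_mono)
          show "Cc ?W (\<lambda>x. (DY b x \<bullet> b) * arctan (u x / \<epsilon>))"
            by (intro Cc_mult_right Cc_inner_right C1c_Cc(2)[OF YC[OF b]] GDERIV_continuous_on[OF aD] continuous_intros)
          show "Cc ?W (\<lambda>x. \<bar>DY b x \<bullet> b\<bar> * 2)"
            by (intro Cc_mult_right Cc_abs Cc_inner_right C1c_Cc(2)[OF YC[OF b]] continuous_intros)
          fix x
          have "\<bar>arctan (u x / \<epsilon>)\<bar> \<le> 2" using arctan_lbound[of "u x / \<epsilon>"] arctan_ubound[of "u x / \<epsilon>"] pi_less_4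
            unfolding abs_le_iff by linarith
          then show "\<bar>(DY b x \<bullet> b) * arctan (u x / \<epsilon>)\<bar> \<le> \<bar>DY b x \<bullet> b\<bar> * 2"
            unfolding abs_mult by (intro mult_left_mono) auto
        qed
        finally show "(\<integral>x. Y b x * ((?w x / \<epsilon>) *\<^sub>R G x \<bullet> b) \<partial>lborel) \<le> (\<integral>x. \<bar>DY b x \<bullet> b\<bar> * 2 \<partial>lborel)" .
      qed
    qed (use B c \<epsilon> in auto)
    finally show "(\<integral>x. \<bar>\<eta> x\<bar> * ?w x \<partial>lborel) \<le> B / c * C1 * \<epsilon>" by (simp add: mult_ac)
  qed
qed

text \<open>\<open>1 - spike (u / \<epsilon>)\<close> is a \<open>C\<^sup>1\<close> cutoff that vanishes where \<open>|u| \<le> \<epsilon>\<close>.\<close>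
definition spike :: "real \<Rightarrow> real" where
  "spike t = inverse (1 + (max 0 (t\<^sup>2 - 1))\<^sup>2)"

definition spike' :: "real \<Rightarrow> real" where
  "spike' t = - (4 * t * max 0 (t\<^sup>2 - 1)) / (1 + (max 0 (t\<^sup>2 - 1))\<^sup>2)\<^sup>2"

lemma DERIV_max0_sq: "((\<lambda>s::real. (max 0 s)\<^sup>2) has_real_derivative 2 * max 0 s) (at s)"
proof -
  consider "s < 0" | "s = 0" | "s > 0" by linarith
  then show ?thesis
  proof cases
    case 1
    have "((\<lambda>s::real. 0) has_real_derivative 2 * max 0 s) (at s)" using 1 by simp
    then show ?thesis
      by (rule has_field_derivative_transform_within_open[of _ _ _ "{..<0}"]) (use 1 in \<open>simp_all add: max_def\<close>)
  next
    case 2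
    have "((\<lambda>s::real. (max 0 s)\<^sup>2) has_real_derivative 0) (at 0)"
      by (rule DERIV_zero_quadratic[where C = 1]) (auto simp: max_def)
    then show ?thesis using 2 by simp
  next
    case 3
    have "((\<lambda>s::real. s\<^sup>2) has_real_derivative 2 * max 0 s) (at s)" using 3 by (auto intro!: derivative_eq_intros)
    then show ?thesis
      by (rule has_field_derivative_transform_within_open[of _ _ _ "{0<..}"]) (use 3 in \<open>simp_all add: max_def\<close>)
  qed
qed

lemma spike_deriv: "(spike has_real_derivative spike' t) (at t)"
proof -
  have *: "((\<lambda>t. 1 + (max 0 (t\<^sup>2 - 1))\<^sup>2) has_real_derivative 2 * max 0 (t\<^sup>2 - 1) * (2 * t)) (at t)"
    by (rule derivative_eq_intros DERIV_chain2[OF DERIV_max0_sq, of "\<lambda>t. t\<^sup>2 - 1"] refl | simp)+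
  have "1 + (max 0 (t\<^sup>2 - 1))\<^sup>2 \<noteq> 0" by (metis add_nonneg_pos less_numeral_extra(1) less_numeral_extra(3) add.commute zero_le_power2)
  from DERIV_inverse_fun[OF * this] show ?thesis
    unfolding spike_def[abs_def] spike'_def by (simp add: field_simps power2_eq_square)
qed

lemma spike'_continuous: "continuous_on UNIV spike'"
proof -
  have "1 + (max 0 (t\<^sup>2 - 1))\<^sup>2 \<noteq> 0" for t :: real
    by (metis add_nonneg_pos less_numeral_extra(1) less_numeral_extra(3) add.commute zero_le_power2)
  then show ?thesis unfolding spike'_def[abs_def] by (intro continuous_intros) auto
qed

lemma spike_near_zero: "\<bar>t\<bar> \<le> 1 \<Longrightarrow> spike t = 1"
  by (simp add: spike_def abs_square_le_1)

text \<open>Domination by 1 / (1 + t^2) brings the cutoff, and by \<open>spike'_bound\<close> also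
  its derivative, under \<open>level_set_mass\<close>.\<close>

lemma spike_bound: "0 \<le> spike t" "spike t \<le> 3 * inverse (1 + t\<^sup>2)"
proof -
  define m where "m = max 0 (t\<^sup>2 - 1)"
  have m: "0 \<le> m" "t\<^sup>2 \<le> 1 + m" by (auto simp: m_def)
  have "0 \<le> (m - 1)\<^sup>2" by simp
  then have "2 * m \<le> m\<^sup>2 + 1" by (simp add: power2_diff)
  then have "1 + t\<^sup>2 \<le> 3 * (1 + m\<^sup>2)" using m zero_le_power2[of m] unfolding distrib_left by linarith
  then show "spike t \<le> 3 * inverse (1 + t\<^sup>2)" unfolding spike_def m_def[symmetric]
    using m by (simp add: field_simps add_pos_nonneg)
  show "0 \<le> spike t" by (simp add: spike_def add_nonneg_nonneg)
qed

text \<open>With m = max 0 (t^2 - 1), the inequalities 2|t| \<le> 1 + t^2 \<le> 2 + m, (2 + m)^2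
  \<le> 8 (1 + m^2) and 2m \<le> 1 + m^2 bound 4 |t| m (1 + t^2) by 8 (1 + m^2)^2.\<close>

lemma spike'_bound: "\<bar>spike' t\<bar> \<le> 8 * inverse (1 + t\<^sup>2)"
proof -
  define m where "m = max 0 (t\<^sup>2 - 1)"
  have m: "0 \<le> m" "t\<^sup>2 \<le> 1 + m" by (auto simp: m_def)
  have "0 \<le> (\<bar>t\<bar> - 1)\<^sup>2" by simp
  then have t: "2 * \<bar>t\<bar> \<le> 1 + t\<^sup>2" by (simp add: power2_diff)
  have "(2 * \<bar>t\<bar>) * (1 + t\<^sup>2) \<le> (1 + t\<^sup>2) * (1 + t\<^sup>2)" using t by (intro mult_right_mono) auto
  also have "\<dots> \<le> (2 + m) * (2 + m)" using m by (intro mult_mono) auto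
  also have "\<dots> \<le> 8 * (1 + m\<^sup>2)"
  proof -
    have "4 * m \<le> m\<^sup>2 + 4" using zero_le_power2[of "m - 2"] by (simp add: power2_diff)
    moreover have "(2 + m) * (2 + m) = 4 + 4 * m + m\<^sup>2" by (simp add: power2_eq_square algebra_simps)
    ultimately show ?thesis using zero_le_power2[of m] unfolding distrib_left by linarith
  qed
  finally have "(2 * \<bar>t\<bar>) * (1 + t\<^sup>2) * (2 * m) \<le> 8 * (1 + m\<^sup>2) * (2 * m)" using m by (intro mult_right_mono) auto
  also have "\<dots> \<le> 8 * (1 + m\<^sup>2) * (1 + m\<^sup>2)"
    using zero_le_power2[of "m - 1"] by (intro mult_left_mono) (auto simp: power2_diff)
  finally have *: "4 * \<bar>t\<bar> * m * (1 + t\<^sup>2) \<le> 8 * (1 + m\<^sup>2)\<^sup>2" by (simp add: power2_eq_square mult_ac)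
  have "0 < 1 + m\<^sup>2" by (simp add: add_pos_nonneg)
  then have pos1: "0 < (1 + m\<^sup>2)\<^sup>2" by (rule zero_less_power)
  have pos2: "0 < 1 + t\<^sup>2" by (simp add: add_pos_nonneg)
  note pos = pos1 pos2
  have "\<bar>spike' t\<bar> = 4 * \<bar>t\<bar> * m / (1 + m\<^sup>2)\<^sup>2" unfolding spike'_def m_def[symmetric]
    using m pos by (simp only: abs_divide abs_minus_cancel abs_mult abs_of_nonneg abs_of_pos abs_numeral)
  also have "\<dots> \<le> 8 / (1 + t\<^sup>2)"
    using * by (simp only: pos_divide_le_eq[OF pos(1)] times_divide_eq_left pos_le_divide_eq[OF pos(2)])
  finally show ?thesis by (simp add: divide_inverse)
qed

text \<open>Testing with \<phi> times 1 - spike (u/\<epsilon>) leaves the product of \<phi> F with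
  the gradient of spike (u/\<epsilon>). Its absolute integral is only O(1), not small: the
  derivative is of size 1/\<epsilon> on a layer of mass O(\<epsilon>). The cancellation appears when
  the field \<phi> F is replaced by a smooth \<open>Y\<close> up to \<delta>: for \<open>Y\<close>
  an integration by parts gives O(\<epsilon>), and the replacement costs O(\<delta>). No derivative
  of \<open>F\<close> is needed.\<close>

lemma divergence_free_across_regular_zeros:
  fixes u :: "'a::euclidean_space \<Rightarrow> real" and F :: "'a \<Rightarrow> 'a"
  assumes u: "C1c UNIV u G" and V: "open V" and Fc: "continuous_on UNIV F"
    and H: "weakly_div_free (V \<inter> {x. u x \<noteq> 0}) F"
  shows "weakly_div_free (V \<inter> {x. G x \<noteq> 0}) F"
  unfolding weakly_div_free_def
proof (intro allI impI)
  fix \<phi> D\<phi> assume \<phi>: "C1c (V \<inter> {x. G x \<noteq> 0}) \<phi> D\<phi>"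
  let ?W = "V \<inter> {x. G x \<noteq> 0}"
  have Gc: "continuous_on UNIV G" and uc: "continuous_on UNIV u" using C1c_Cc[OF u] CcD by auto
  have W: "open ?W" using V Gc by (intro open_Int open_Collect_neq continuous_intros) auto
  note \<phi>c = C1c_Cc[OF \<phi>]
  obtain M where M: "M > 0" "\<And>x. norm (G x) \<le> M" using Cc_bounded[OF C1c_Cc(2)[OF u]] by metis
  define X where "X b x = \<phi> x * (F x \<bullet> b)" for b x
  have XC: "Cc ?W (X b)" for b unfolding X_def[abs_def] using Fc by (intro Cc_mult_right \<phi>c continuous_intros)
  \<comment> \<open>The sets \<open>L b\<close> come before the accuracy \<delta>, so the cutoff
    \<open>z\<close> over their union and its mass constant \<open>Cz\<close> do not depend on
    \<delta>.\<close>
  have "\<exists>L. compact L \<and> L \<subseteq> ?W \<and> (\<forall>x. x \<notin> L \<longrightarrow> X b x = 0) \<and>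
    (\<forall>e>0. \<exists>g. test_fun ?W g \<and> (\<forall>x. x \<notin> L \<longrightarrow> g x = 0) \<and> (\<forall>x. \<bar>g x - X b x\<bar> \<le> e))" for b
  proof (rule Cc_test_fun_approx[OF W XC[of b]])
    fix L assume L: "compact L" "L \<subseteq> ?W" "\<And>x. x \<notin> L \<Longrightarrow> X b x = 0"
      and A: "\<And>e. 0 < e \<Longrightarrow> \<exists>g. test_fun ?W g \<and> (\<forall>x. x \<notin> L \<longrightarrow> g x = 0) \<and> (\<forall>x. \<bar>g x - X b x\<bar> \<le> e) \<and>
       (\<forall>Df. C1c ?W (X b) Df \<longrightarrow> (\<forall>x. norm (grad g x - Df x) \<le> e))"
    have "\<exists>g. test_fun ?W g \<and> (\<forall>x. x \<notin> L \<longrightarrow> g x = 0) \<and> (\<forall>x. \<bar>g x - X b x\<bar> \<le> e)" if "e > 0" for e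
      using A[OF that] by blast
    then show ?thesis using L by blast
  qed
  from choice[OF allI[OF this]] obtain L where "\<forall>b. compact (L b) \<and> L b \<subseteq> ?W \<and> (\<forall>x. x \<notin> L b \<longrightarrow> X b x = 0) \<and>
    (\<forall>e>0. \<exists>g. test_fun ?W g \<and> (\<forall>x. x \<notin> L b \<longrightarrow> g x = 0) \<and> (\<forall>x. \<bar>g x - X b x\<bar> \<le> e))" ..
  then have L: "\<And>b. compact (L b)" "\<And>b. L b \<subseteq> ?W" "\<And>b x. x \<notin> L b \<Longrightarrow> X b x = 0"
    "\<And>b e. e > 0 \<Longrightarrow> \<exists>g. test_fun ?W g \<and> (\<forall>x. x \<notin> L b \<longrightarrow> g x = 0) \<and> (\<forall>x. \<bar>g x - X b x\<bar> \<le> e)"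
    by simp_all
  have "compact (\<Union>b\<in>Basis. L b)" "(\<Union>b\<in>Basis. L b) \<subseteq> ?W" using L by (auto intro!: compact_UN)
  then obtain z V1 where z: "test_fun ?W z" "(\<Union>b\<in>Basis. L b) \<subseteq> V1" "\<And>x. x \<in> V1 \<Longrightarrow> z x = 1" "\<And>x. 0 \<le> z x"
    using smooth_cutoff[OF _ W] by metis
  have zc: "Cc ?W z" using C1c_Cc(1)[OF test_fun_C1c[OF z(1)]] .
  let ?w = "\<lambda>\<epsilon> x. inverse (1 + (u x / \<epsilon>)\<^sup>2)"
  obtain Cz where Cz: "0 \<le> Cz" "\<And>\<epsilon>. 0 < \<epsilon> \<Longrightarrow> (\<integral>x. \<bar>z x\<bar> * ?w \<epsilon> x \<partial>lborel) \<le> Cz * \<epsilon>"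
    by (rule level_set_mass[OF u V zc]) (rule that; assumption)
  have FD: "Cc ?W (\<lambda>x. F x \<bullet> D\<phi> x)" using Fc \<phi>c by (intro Cc_inner_left)
  obtain C0 where C0: "0 \<le> C0" "\<And>\<epsilon>. 0 < \<epsilon> \<Longrightarrow> (\<integral>x. \<bar>F x \<bullet> D\<phi> x\<bar> * ?w \<epsilon> x \<partial>lborel) \<le> C0 * \<epsilon>"
    by (rule level_set_mass[OF u V FD]) (rule that; assumption)
  define I where "I = (\<integral>x. F x \<bullet> D\<phi> x \<partial>lborel)"
  define d where "d = real DIM('a)"
  have main: "\<bar>I\<bar> \<le> 8 * Cz * d * M * \<delta>" if \<delta>: "\<delta> > 0" for \<delta>
  proof -
    from choice[OF allI[OF L(4)[OF \<delta>]]] obtain Y where "\<forall>b. test_fun ?W (Y b) \<and>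
      (\<forall>x. x \<notin> L b \<longrightarrow> Y b x = 0) \<and> (\<forall>x. \<bar>Y b x - X b x\<bar> \<le> \<delta>)" ..
    then have Y: "\<And>b. test_fun ?W (Y b)" "\<And>b x. x \<notin> L b \<Longrightarrow> Y b x = 0" "\<And>b x. \<bar>Y b x - X b x\<bar> \<le> \<delta>"
      by simp_all
    note YC = test_fun_C1c[OF Y(1)]
    have SC: "Cc ?W (\<lambda>x. \<Sum>b\<in>Basis. \<bar>grad (Y b) x \<bullet> b\<bar>)"
      by (intro Cc_sum Cc_abs Cc_inner_right C1c_Cc(2)[OF YC] continuous_intros)
    obtain CY where CY: "0 \<le> CY" "\<And>\<epsilon>. 0 < \<epsilon> \<Longrightarrow> (\<integral>x. \<bar>\<Sum>b\<in>Basis. \<bar>grad (Y b) x \<bullet> b\<bar>\<bar> * ?w \<epsilon> x \<partial>lborel) \<le> CY * \<epsilon>"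
      by (rule level_set_mass[OF u V SC]) (rule that; assumption)
    have eps: "\<bar>I\<bar> \<le> (3 * C0 + 3 * CY) * \<epsilon> + 8 * Cz * d * M * \<delta>" if \<epsilon>: "\<epsilon> > 0" for \<epsilon>
    proof -
      let ?b = "\<lambda>x. spike (u x / \<epsilon>)" and ?b' = "\<lambda>x. spike' (u x / \<epsilon>) / \<epsilon>"
      have wc: "continuous_on UNIV (?w \<epsilon>)"
        by (intro continuous_intros uc) (use \<epsilon> in \<open>auto simp: add_nonneg_eq_0_iff\<close>)
      have bD: "GDERIV ?b x :> ?b' x *\<^sub>R G x" for x
        by (rule GDERIV_DERIV_compose[OF C1c_GDERIV[OF u]])
          (use DERIV_chain2[OF spike_deriv DERIV_cdivide[OF DERIV_ident], of \<epsilon> "u x"] in simp)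
      have b'c: "continuous_on UNIV ?b'"
        by (intro continuous_on_divide continuous_on_compose2[OF spike'_continuous] uc continuous_on_const) (use \<epsilon> in auto)
      have bDc: "continuous_on UNIV (\<lambda>x. ?b' x *\<^sub>R G x)" by (rule continuous_on_scaleR[OF b'c Gc])
      have bDb: "continuous_on UNIV (\<lambda>x. (?b' x *\<^sub>R G x) \<bullet> b)" for b
        by (rule continuous_on_inner[OF bDc continuous_on_const])
      have bc: "continuous_on UNIV ?b" by (rule GDERIV_continuous_on[OF bD])
      have hc: "continuous_on UNIV (\<lambda>x. 1 - ?b x)" by (rule continuous_on_diff[OF continuous_on_const bc])
      have nbDc: "continuous_on UNIV (\<lambda>x. - (?b' x *\<^sub>R G x))" by (rule continuous_on_minus[OF bDc])
      have hD: "GDERIV (\<lambda>x. 1 - ?b x) x :> - (?b' x *\<^sub>R G x)" for x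
        using GDERIV_diff[OF GDERIV_const bD, of 1] by simp
      have "C1c ?W (\<lambda>x. \<phi> x * (1 - ?b x)) (\<lambda>x. \<phi> x *\<^sub>R (- (?b' x *\<^sub>R G x)) + (1 - ?b x) *\<^sub>R D\<phi> x)"
        by (rule C1c_mult[OF \<phi> hD nbDc])
      moreover have "csupp (V \<inter> {x. u x \<noteq> 0}) (\<lambda>x. \<phi> x * (1 - ?b x))"
      proof -
        obtain K where K: "compact K" "K \<subseteq> ?W" "\<And>x. x \<notin> K \<Longrightarrow> \<phi> x = 0" using \<phi>c unfolding Cc_def csupp_def by blast
        have "closed {x. \<epsilon> \<le> \<bar>u x\<bar>}" by (intro closed_Collect_le continuous_intros uc)
        then have "compact (K \<inter> {x. \<epsilon> \<le> \<bar>u x\<bar>})" using K(1) by blast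
        moreover have "\<phi> x * (1 - ?b x) = 0" if "x \<notin> K \<inter> {x. \<epsilon> \<le> \<bar>u x\<bar>}" for x
        proof (cases "x \<in> K")
          case True
          then have "\<bar>u x / \<epsilon>\<bar> \<le> 1" using that \<epsilon> by (auto simp: abs_divide field_simps)
          then show ?thesis using spike_near_zero by simp
        qed (simp add: K(3))
        ultimately show ?thesis unfolding csupp_def
          using K(2) \<epsilon> by (intro exI[of _ "K \<inter> {x. \<epsilon> \<le> \<bar>u x\<bar>}"]) auto
      qed
      ultimately have "C1c (V \<inter> {x. u x \<noteq> 0}) (\<lambda>x. \<phi> x * (1 - ?b x)) (\<lambda>x. \<phi> x *\<^sub>R (- (?b' x *\<^sub>R G x)) + (1 - ?b x) *\<^sub>R D\<phi> x)"
        unfolding C1c_def by blast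
      from weakly_div_freeD[OF H this] have 0: "(\<integral>x. F x \<bullet> (\<phi> x *\<^sub>R (- (?b' x *\<^sub>R G x)) + (1 - ?b x) *\<^sub>R D\<phi> x) \<partial>lborel) = 0" .
      \<comment> \<open>\<open>T1\<close> is the part of the integrand lost near the zero set;
        \<open>T2\<close> carries the smooth field and is integrated by parts; \<open>T3\<close> is
        the approximation error, with mass O(\<epsilon>) against size \<delta>/\<epsilon>.\<close>
      define T1 where "T1 x = (F x \<bullet> D\<phi> x) * ?b x" for x
      define T2 where "T2 x = (\<Sum>b\<in>Basis. Y b x * ((?b' x *\<^sub>R G x) \<bullet> b))" for x
      define T3 where "T3 x = (\<Sum>b\<in>Basis. (X b x - Y b x) * ((?b' x *\<^sub>R G x) \<bullet> b))" for x
      have T1C: "Cc ?W T1" unfolding T1_def[abs_def] by (intro Cc_mult_right FD bc)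
      have T2C: "Cc ?W T2" unfolding T2_def[abs_def]
        by (intro Cc_sum Cc_mult_right C1c_Cc(1)[OF YC] bDb)
      have T3C: "Cc ?W T3" unfolding T3_def[abs_def]
        by (intro Cc_sum Cc_mult_right Cc_diff XC C1c_Cc(1)[OF YC] bDb)
      have "F x \<bullet> D\<phi> x = T1 x + T2 x + T3 x + F x \<bullet> (\<phi> x *\<^sub>R (- (?b' x *\<^sub>R G x)) + (1 - ?b x) *\<^sub>R D\<phi> x)" for x
      proof -
        have "T2 x + T3 x = (\<Sum>b\<in>Basis. X b x * ((?b' x *\<^sub>R G x) \<bullet> b))"
          unfolding T2_def T3_def by (simp add: sum.distrib[symmetric] left_diff_distrib del: inner_scaleR_left)
        also have "\<dots> = \<phi> x * (F x \<bullet> (?b' x *\<^sub>R G x))"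
          unfolding X_def by (subst (2) euclidean_inner) (simp add: sum_distrib_left mult_ac)
        finally show ?thesis unfolding T1_def by (simp add: inner_add_right algebra_simps)
      qed
      moreover have "integrable lborel (\<lambda>x. F x \<bullet> (\<phi> x *\<^sub>R (- (?b' x *\<^sub>R G x)) + (1 - ?b x) *\<^sub>R D\<phi> x))"
      proof (intro Cc_integrable[where U = ?W] Cc_inner_left Fc Cc_add Cc_scaleR[OF \<phi>c(1) nbDc])
        show "Cc ?W (\<lambda>x. (1 - ?b x) *\<^sub>R D\<phi> x)"
          unfolding Cc_def using \<phi>c(2) continuous_on_scaleR[OF hc]
          by (auto simp: Cc_def elim: csupp_subset)
      qed
      ultimately have I: "I = integral\<^sup>L lborel T1 + integral\<^sup>L lborel T2 + integral\<^sup>L lborel T3"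
        unfolding I_def using 0 Cc_integrable[OF T1C] Cc_integrable[OF T2C] Cc_integrable[OF T3C] by simp
      have "\<bar>integral\<^sup>L lborel T1\<bar> \<le> (\<integral>x. 3 * (\<bar>F x \<bullet> D\<phi> x\<bar> * ?w \<epsilon> x) \<partial>lborel)"
      proof (rule Cc_integral_abs_mono[OF T1C])
        show "Cc ?W (\<lambda>x. 3 * (\<bar>F x \<bullet> D\<phi> x\<bar> * ?w \<epsilon> x))" by (intro Cc_mult_left[OF continuous_on_const] Cc_mult_right[OF _ wc] Cc_abs FD)
        show "\<bar>T1 x\<bar> \<le> 3 * (\<bar>F x \<bullet> D\<phi> x\<bar> * ?w \<epsilon> x)" for x
          using mult_left_mono[OF spike_bound(2)[of "u x / \<epsilon>"], of "\<bar>F x \<bullet> D\<phi> x\<bar>"] spike_bound(1)[of "u x / \<epsilon>"]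
          unfolding T1_def abs_mult by (simp add: mult_ac)
      qed
      then have B1: "\<bar>integral\<^sup>L lborel T1\<bar> \<le> 3 * C0 * \<epsilon>" using C0(2)[OF \<epsilon>] by simp
      have "integral\<^sup>L lborel T2 = (\<Sum>b\<in>Basis. (\<integral>x. Y b x * ((?b' x *\<^sub>R G x) \<bullet> b) \<partial>lborel))"
        unfolding T2_def by (rule Bochner_Integration.integral_sum)
          (intro Cc_integrable[where U = ?W] Cc_mult_right C1c_Cc(1)[OF YC] bDb)
      also have "\<dots> = (\<Sum>b\<in>Basis. - (\<integral>x. (grad (Y b) x \<bullet> b) * ?b x \<partial>lborel))"
        by (intro sum.cong refl C1c_integral_by_parts[OF YC bD bDc])
      also have "\<dots> = - (\<integral>x. (\<Sum>b\<in>Basis. (grad (Y b) x \<bullet> b) * ?b x) \<partial>lborel)"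
        by (subst Bochner_Integration.integral_sum)
          (auto simp: sum_negf intro!: Cc_integrable[where U = ?W] Cc_mult_right[OF _ bc] Cc_inner_right C1c_Cc(2)[OF YC] continuous_on_const)
      finally have "\<bar>integral\<^sup>L lborel T2\<bar> = \<bar>\<integral>x. (\<Sum>b\<in>Basis. (grad (Y b) x \<bullet> b) * ?b x) \<partial>lborel\<bar>" by simp
      also have "\<dots> \<le> (\<integral>x. 3 * (\<bar>\<Sum>b\<in>Basis. \<bar>grad (Y b) x \<bullet> b\<bar>\<bar> * ?w \<epsilon> x) \<partial>lborel)"
      proof (rule Cc_integral_abs_mono)
        show "Cc ?W (\<lambda>x. \<Sum>b\<in>Basis. (grad (Y b) x \<bullet> b) * ?b x)"
          by (intro Cc_sum Cc_mult_right[OF _ bc] Cc_inner_right C1c_Cc(2)[OF YC] continuous_on_const)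
        show "Cc ?W (\<lambda>x. 3 * (\<bar>\<Sum>b\<in>Basis. \<bar>grad (Y b) x \<bullet> b\<bar>\<bar> * ?w \<epsilon> x))"
          by (intro Cc_mult_left[OF continuous_on_const] Cc_mult_right[OF _ wc] Cc_sum Cc_abs Cc_inner_right C1c_Cc(2)[OF YC] continuous_on_const)
        fix x
        have "\<bar>\<Sum>b\<in>Basis. (grad (Y b) x \<bullet> b) * ?b x\<bar> \<le> (\<Sum>b\<in>Basis. \<bar>grad (Y b) x \<bullet> b\<bar> * ?b x)"
          using spike_bound(1) by (intro order_trans[OF sum_abs] sum_mono) (auto simp: abs_mult)
        also have "\<dots> \<le> (\<Sum>b\<in>Basis. \<bar>grad (Y b) x \<bullet> b\<bar>) * (3 * ?w \<epsilon> x)"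
          unfolding sum_distrib_right using spike_bound(2) by (intro sum_mono mult_left_mono) auto
        finally show "\<bar>\<Sum>b\<in>Basis. (grad (Y b) x \<bullet> b) * ?b x\<bar> \<le> 3 * (\<bar>\<Sum>b\<in>Basis. \<bar>grad (Y b) x \<bullet> b\<bar>\<bar> * ?w \<epsilon> x)"
          by (simp add: sum_nonneg mult_ac)
      qed
      finally have B2: "\<bar>integral\<^sup>L lborel T2\<bar> \<le> 3 * CY * \<epsilon>" using CY(2)[OF \<epsilon>] by simp
      have "\<bar>integral\<^sup>L lborel T3\<bar> \<le> (\<integral>x. (8 * d * M * \<delta> / \<epsilon>) * (\<bar>z x\<bar> * ?w \<epsilon> x) \<partial>lborel)"
      proof (rule Cc_integral_abs_mono[OF T3C])
        show "Cc ?W (\<lambda>x. (8 * d * M * \<delta> / \<epsilon>) * (\<bar>z x\<bar> * ?w \<epsilon> x))" by (intro Cc_mult_left[OF continuous_on_const] Cc_mult_right[OF _ wc] Cc_abs zc)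
        fix x
        have "\<bar>(X b x - Y b x) * ((?b' x *\<^sub>R G x) \<bullet> b)\<bar> \<le> (\<delta> * z x) * ((8 * ?w \<epsilon> x / \<epsilon>) * M)" if b: "b \<in> Basis" for b
        proof (cases "x \<in> L b")
          case False then show ?thesis using L(3) Y(2) z(4)[of x] \<delta> M \<epsilon> by (simp add: add_nonneg_nonneg)
        next
          case True
          then have z1: "z x = 1" using z(2,3) b by blast
          have "\<bar>G x \<bullet> b\<bar> \<le> M" using Basis_le_norm[OF b, of "G x"] M(2)[of x] by linarith
          moreover have "\<bar>?b' x\<bar> \<le> 8 * ?w \<epsilon> x / \<epsilon>" using spike'_bound[of "u x / \<epsilon>"] \<epsilon> by (simp add: abs_divide divide_right_mono)
          moreover have nn: "0 \<le> 8 * ?w \<epsilon> x / \<epsilon>" using \<epsilon> by (simp add: add_nonneg_nonneg)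
          ultimately have h1: "\<bar>?b' x\<bar> * \<bar>G x \<bullet> b\<bar> \<le> (8 * ?w \<epsilon> x / \<epsilon>) * M"
            by (intro mult_mono abs_ge_zero)
          have h2: "\<bar>X b x - Y b x\<bar> \<le> \<delta>" using Y(3)[of b x] by (simp add: abs_minus_commute)
          show ?thesis using mult_mono[OF h2 h1 less_imp_le[OF \<delta>] mult_nonneg_nonneg[OF abs_ge_zero abs_ge_zero]]
            unfolding z1 abs_mult inner_scaleR_left mult_1_right .
        qed
        then have "(\<Sum>b\<in>Basis. \<bar>(X b x - Y b x) * ((?b' x *\<^sub>R G x) \<bullet> b)\<bar>) \<le> (\<Sum>b\<in>(Basis::'a set). (\<delta> * z x) * ((8 * ?w \<epsilon> x / \<epsilon>) * M))"
          by (rule sum_mono)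
        then have "\<bar>T3 x\<bar> \<le> d * ((\<delta> * z x) * ((8 * ?w \<epsilon> x / \<epsilon>) * M))"
          unfolding T3_def d_def by (intro order_trans[OF sum_abs]) simp
        also have "\<dots> = (8 * d * M * \<delta> / \<epsilon>) * (\<bar>z x\<bar> * ?w \<epsilon> x)" using z(4)[of x] by simp
        finally show "\<bar>T3 x\<bar> \<le> (8 * d * M * \<delta> / \<epsilon>) * (\<bar>z x\<bar> * ?w \<epsilon> x)" .
      qed
      also have "\<dots> = (8 * d * M * \<delta> / \<epsilon>) * (\<integral>x. \<bar>z x\<bar> * ?w \<epsilon> x \<partial>lborel)" by (rule integral_mult_right_zero)
      also have "\<dots> \<le> (8 * d * M * \<delta> / \<epsilon>) * (Cz * \<epsilon>)"
        using Cz(2)[OF \<epsilon>] \<delta> \<epsilon> M by (intro mult_left_mono) (auto simp: d_def)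
      also have "\<dots> = 8 * Cz * d * M * \<delta>" using \<epsilon> by simp
      finally show ?thesis using B1 B2 I by (simp add: algebra_simps abs_le_iff)
    qed
    \<comment> \<open>The constant \<open>CY\<close> involves derivatives of \<open>Y\<close> and is
      not controlled as \<delta> shrinks, so \<epsilon> goes to zero with \<delta> fixed.\<close>
    define c where "c = 3 * C0 + 3 * CY"
    have c: "c \<ge> 0" using C0 CY by (simp add: c_def)
    show ?thesis
    proof (rule field_le_epsilon)
      fix e :: real assume e: "0 < e"
      have "\<bar>I\<bar> \<le> c * (e / (c + 1)) + 8 * Cz * d * M * \<delta>" using eps[of "e / (c + 1)"] e c by (simp add: c_def[symmetric])
      moreover have "c * (e / (c + 1)) \<le> e" using e c by (simp add: field_simps)
      ultimately show "\<bar>I\<bar> \<le> 8 * Cz * d * M * \<delta> + e" by simp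
    qed
  qed
  define c where "c = 8 * Cz * d * M"
  have c: "c \<ge> 0" using Cz M by (simp add: c_def d_def)
  have "\<bar>I\<bar> \<le> 0"
  proof (rule field_le_epsilon)
    fix e :: real assume e: "0 < e"
    have "\<bar>I\<bar> \<le> c * (e / (c + 1))" using main[of "e / (c + 1)"] e c by (simp add: c_def[symmetric])
    also have "\<dots> \<le> e" using e c by (simp add: field_simps)
    finally show "\<bar>I\<bar> \<le> 0 + e" by simp
  qed
  then show "(\<integral>x. F x \<bullet> D\<phi> x \<partial>lborel) = 0" by (simp add: I_def)
qed

subsection \<open>The linearised flux\<close>

text \<open>The derivative is taken at a base point \<open>a\<close> different from both
  \<open>x\<close> and \<open>y\<close>. This strict form is required because the flux will be
  compared at two neighbouring points while being linearised at the difference quotient.\<close>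

lemma uniformly_strictly_differentiable:
  fixes f :: "'a::euclidean_space \<Rightarrow> 'b::euclidean_space" and f' :: "'a \<Rightarrow> 'a \<Rightarrow>\<^sub>L 'b"
  assumes S: "open S" and f: "\<And>x. x \<in> S \<Longrightarrow> (f has_derivative blinfun_apply (f' x)) (at x)"
    and f': "continuous_on S f'" and K: "compact K" "K \<subseteq> S" and e: "0 < e"
  obtains d where "0 < d" "\<And>a x y. a \<in> K \<Longrightarrow> dist a x < d \<Longrightarrow> dist a y < d \<Longrightarrow> norm (f y - f x - f' a (y - x)) \<le> e * norm (y - x)"
proof -
  obtain r L where L: "0 < r" "compact L" "L \<subseteq> S" "\<And>x y. x \<in> K \<Longrightarrow> dist x y \<le> r \<Longrightarrow> y \<in> L"
    using compact_neighbourhood[OF K(1) S K(2)] by metis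
  have "uniformly_continuous_on L f'" using f' L by (meson compact_uniformly_continuous continuous_on_subset)
  then obtain d1 where d1: "d1 > 0" "\<And>x y. x \<in> L \<Longrightarrow> y \<in> L \<Longrightarrow> dist x y < d1 \<Longrightarrow> dist (f' x) (f' y) < e"
    using e unfolding uniformly_continuous_on_def by metis
  show ?thesis
  proof (rule that[of "min r d1"])
    fix a x y assume a: "a \<in> K" "dist a x < min r d1" "dist a y < min r d1"
    have bL: "z \<in> L" if "z \<in> ball a (min r d1)" for z using L(4)[OF a(1), of z] that by simp
    have aL: "a \<in> L" using L(4)[OF a(1), of a] L(1) by simp
    have "norm (f y - f x - blinfun_apply (f' a) (y - x)) \<le> norm (y - x) * e"
    proof (rule differentiable_bound_linearization[where S = "ball a (min r d1)" and f' = "\<lambda>z. blinfun_apply (f' z)"])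
      fix t :: real assume t: "t \<in> {0..1}"
      have "(1 - t) *\<^sub>R x + t *\<^sub>R y \<in> ball a (min r d1)"
        using a t by (intro convexD[OF convex_ball]) auto
      then show "x + t *\<^sub>R (y - x) \<in> ball a (min r d1)" by (simp add: algebra_simps)
    next
      fix z assume z: "z \<in> ball a (min r d1)"
      then have "z \<in> S" using bL L(3) by blast
      then show "(f has_derivative blinfun_apply (f' z)) (at z within ball a (min r d1))"
        using f has_derivative_at_withinI by blast
      have "dist (f' z) (f' a) < e" using d1(2)[OF bL[OF z] aL] z by (simp add: dist_commute)
      then have "norm (f' z - f' a) \<le> e" by (simp add: dist_norm)
      moreover have "blinfun_apply (f' z) - blinfun_apply (f' a) = blinfun_apply (f' z - f' a)"
        by (auto simp: blinfun.diff_left)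
      ultimately show "onorm (blinfun_apply (f' z) - blinfun_apply (f' a)) \<le> e" by (simp add: norm_blinfun.rep_eq)
    qed (use L(1) d1(1) in simp)
    then show "norm (f y - f x - blinfun_apply (f' a) (y - x)) \<le> e * norm (y - x)" by (simp add: mult.commute)
  qed (use L(1) d1(1) in simp)
qed

text \<open>The derivative of (x, z) \<mapsto> |z|^(p(x)-2) z in direction (\<xi>, w), divided by
  |z|^(p-2); \<open>c\<close> stands for p - 2 and \<open>P\<close> for the gradient of p. The
  logarithm comes from differentiating the exponent.\<close>

definition plap_linear :: "real \<Rightarrow> 'a::euclidean_space \<Rightarrow> 'a \<Rightarrow> 'a \<Rightarrow> 'a \<Rightarrow> 'a" where
  "plap_linear c P z \<xi> w = w + (c * (w \<bullet> z) / (norm z)\<^sup>2 + (\<xi> \<bullet> P) * ln (norm z)) *\<^sub>R z"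

lemma plap_flux_has_derivative:
  fixes p :: "'a::euclidean_space \<Rightarrow> real"
  assumes p: "\<And>x. GDERIV p x :> Dp x" and z: "z \<noteq> 0"
  shows "((\<lambda>y. norm (snd y) powr (p (fst y) - 2) *\<^sub>R snd y) has_derivative
    (\<lambda>h. norm z powr (p x - 2) *\<^sub>R plap_linear (p x - 2) (Dp x) z (fst h) (snd h))) (at (x, z))"
proof -
  have n: "((\<lambda>y. norm (snd y)) has_derivative (\<lambda>h. snd h \<bullet> sgn z)) (at (x, z))"
    by (rule has_derivative_compose[OF has_derivative_snd[OF has_derivative_ident], where g = norm])
      (use has_derivative_norm[OF z] in simp)
  have pf: "((\<lambda>y. p (fst y) - 2) has_derivative (\<lambda>h. fst h \<bullet> Dp x)) (at (x, z))"
  proof -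
    have "((\<lambda>y. p (fst y)) has_derivative (\<lambda>h. fst h \<bullet> Dp x)) (at (x, z))"
      by (rule has_derivative_compose[OF has_derivative_fst[OF has_derivative_ident], where g = p])
        (use p[of x, unfolded gderiv_def] in simp)
    from has_derivative_diff[OF this has_derivative_const] show ?thesis by simp
  qed
  have "((\<lambda>y. norm (snd y) powr (p (fst y) - 2)) has_derivative
    (\<lambda>h. norm z powr (p x - 2) * ((fst h \<bullet> Dp x) * ln (norm z) + (snd h \<bullet> sgn z) * (p x - 2) / norm z))) (at (x, z))"
    using has_derivative_powr[OF n pf] z by simp
  from has_derivative_scaleR[OF this has_derivative_snd[OF has_derivative_ident]]
  show ?thesis
  proof (rule has_derivative_eq_rhs, intro ext)
    fix h :: "'a \<times> 'a"
    have "snd h \<bullet> sgn z * (p x - 2) / norm z = (p x - 2) * (snd h \<bullet> z) / (norm z)\<^sup>2"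
      by (simp add: sgn_div_norm power2_eq_square field_simps)
    then show "norm (snd (x, z)) powr (p (fst (x, z)) - 2) *\<^sub>R snd h +
         (norm z powr (p x - 2) * (fst h \<bullet> Dp x * ln (norm z) + snd h \<bullet> sgn z * (p x - 2) / norm z)) *\<^sub>R snd (x, z) =
         norm z powr (p x - 2) *\<^sub>R plap_linear (p x - 2) (Dp x) z (fst h) (snd h)"
      by (simp add: plap_linear_def scaleR_add_right algebra_simps)
  qed
qed

text \<open>As a function of the pair (x, z) the flux is C^1 off z = 0. The bounds \<open>m\<close>
  and \<open>M\<close> confine z to a compact annulus, on which strict differentiability is
  uniform.\<close>

lemma plap_flux_linearization:
  fixes p :: "'a::euclidean_space \<Rightarrow> real"
  assumes p: "\<And>x. GDERIV p x :> Dp x" "continuous_on UNIV Dp"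
    and K: "compact K" and m: "0 < m" and e: "0 < e"
  obtains d where "0 < d" "\<And>x z x1 z1 x2 z2. x \<in> K \<Longrightarrow> m \<le> norm z \<Longrightarrow> norm z \<le> M \<Longrightarrow>
     norm (x1 - x) < d \<Longrightarrow> norm (z1 - z) < d \<Longrightarrow> norm (x2 - x) < d \<Longrightarrow> norm (z2 - z) < d \<Longrightarrow>
     norm (norm z2 powr (p x2 - 2) *\<^sub>R z2 - norm z1 powr (p x1 - 2) *\<^sub>R z1
        - norm z powr (p x - 2) *\<^sub>R plap_linear (p x - 2) (Dp x) z (x2 - x1) (z2 - z1))
     \<le> e * (norm (x2 - x1) + norm (z2 - z1))"
proof -
  let ?f = "\<lambda>y::'a \<times> 'a. norm (snd y) powr (p (fst y) - 2) *\<^sub>R snd y"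
  let ?D = "\<lambda>y h::'a \<times> 'a. norm (snd y) powr (p (fst y) - 2) *\<^sub>R plap_linear (p (fst y) - 2) (Dp (fst y)) (snd y) (fst h) (snd h)"
  define f' where "f' y = Blinfun (?D y)" for y
  let ?S = "{y::'a \<times> 'a. snd y \<noteq> 0}"
  have S: "open ?S" by (intro open_Collect_neq continuous_intros)
  have der: "(?f has_derivative ?D y) (at y)" if "y \<in> ?S" for y
    using plap_flux_has_derivative[OF p(1), of "snd y" "fst y"] that by simp
  have app: "blinfun_apply (f' y) = ?D y" if "y \<in> ?S" for y
    unfolding f'_def using has_derivative_bounded_linear[OF der[OF that]] by (rule bounded_linear_Blinfun_apply)
  have pc: "continuous_on UNIV p" using GDERIV_continuous_on p(1) by blast
  have cont: "continuous_on ?S f'"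
  proof (rule continuous_on_blinfun_componentwise)
    fix i :: "'a \<times> 'a" assume "i \<in> Basis"
    have "continuous_on ?S (\<lambda>y. ?D y i)" unfolding plap_linear_def
      by (intro continuous_intros continuous_on_compose2[OF pc] continuous_on_compose2[OF p(2)]) auto
    then show "continuous_on ?S (\<lambda>y. blinfun_apply (f' y) i)"
      by (rule continuous_on_eq) (simp add: app)
  qed
  let ?A = "cball (0::'a) M \<inter> {z. m \<le> norm z}"
  have "compact ?A" by (intro compact_Int_closed compact_cball closed_Collect_le continuous_intros)
  then have KA: "compact (K \<times> ?A)" by (rule compact_Times[OF K])
  have sub: "K \<times> ?A \<subseteq> ?S" using m by auto
  have fd: "(?f has_derivative blinfun_apply (f' y)) (at y)" if "y \<in> ?S" for y
    using der[OF that] app[OF that] by simp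
  obtain d where d: "0 < d" "\<And>a x y. a \<in> K \<times> ?A \<Longrightarrow> dist a x < d \<Longrightarrow> dist a y < d \<Longrightarrow>
      norm (?f y - ?f x - f' a (y - x)) \<le> e * norm (y - x)"
    by (rule uniformly_strictly_differentiable[OF S fd cont KA sub e]) (assumption, (rule that; assumption))
  show ?thesis
  proof (rule that[of "d / 2"])
    fix x z x1 z1 x2 z2 :: 'a
    assume *: "x \<in> K" "m \<le> norm z" "norm z \<le> M" "norm (x1 - x) < d / 2" "norm (z1 - z) < d / 2"
       "norm (x2 - x) < d / 2" "norm (z2 - z) < d / 2"
    have le: "norm (a, b) \<le> norm a + norm b" for a b :: 'a by (simp add: norm_Pair_le)
    have "dist (x1, z1) (x, z) < d" "dist (x2, z2) (x, z) < d"
      using le[of "x1 - x" "z1 - z"] le[of "x2 - x" "z2 - z"] * by (auto simp: dist_norm)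
    then have "dist (x, z) (x1, z1) < d" "dist (x, z) (x2, z2) < d" by (simp_all add: dist_commute)
    moreover have "(x, z) \<in> K \<times> ?A" using * by simp
    ultimately have "norm (?f (x2, z2) - ?f (x1, z1) - f' (x, z) ((x2, z2) - (x1, z1))) \<le> e * norm ((x2, z2) - (x1, z1))"
      by (intro d(2))
    also have "\<dots> \<le> e * (norm (x2 - x1) + norm (z2 - z1))" using le e by simp
    also have "blinfun_apply (f' (x, z)) = ?D (x, z)" using app sub \<open>(x, z) \<in> K \<times> ?A\<close> by blast
    finally show "norm (norm z2 powr (p x2 - 2) *\<^sub>R z2 - norm z1 powr (p x1 - 2) *\<^sub>R z1
        - norm z powr (p x - 2) *\<^sub>R plap_linear (p x - 2) (Dp x) z (x2 - x1) (z2 - z1))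
     \<le> e * (norm (x2 - x1) + norm (z2 - z1))" by simp
  qed (use d(1) in simp)
qed

lemma young: "0 < k \<Longrightarrow> x * y \<le> k * x\<^sup>2 + y\<^sup>2 / (4 * (k::real))"
proof -
  assume k: "0 < k"
  have "0 \<le> (2 * k * x - y)\<^sup>2 / (4 * k)" using k by simp
  also have "(2 * k * x - y)\<^sup>2 / (4 * k) = k * x\<^sup>2 + y\<^sup>2 / (4 * k) - x * y"
    using k by (simp add: power2_eq_square field_simps)
  finally show ?thesis by simp
qed

lemma norm_basis_combination_le:
  fixes N :: "'a::euclidean_space \<Rightarrow> 'b::real_normed_vector"
  shows "norm (\<Sum>i\<in>Basis. (y \<bullet> i) *\<^sub>R N i) \<le> norm y * sqrt (\<Sum>i\<in>Basis. (norm (N i))\<^sup>2)"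
proof -
  have "norm (\<Sum>i\<in>Basis. (y \<bullet> i) *\<^sub>R N i) \<le> (\<Sum>i\<in>Basis. \<bar>y \<bullet> i\<bar> * \<bar>norm (N i)\<bar>)"
    by (rule order_trans[OF norm_sum]) simp
  also have "\<dots> \<le> L2_set (\<lambda>i. y \<bullet> i) Basis * L2_set (\<lambda>i. norm (N i)) Basis" by (rule L2_set_mult_ineq)
  also have "L2_set (\<lambda>i. y \<bullet> i) Basis = norm y" unfolding L2_set_def
    by (subst norm_eq_sqrt_inner, rule arg_cong[where f = sqrt], subst euclidean_inner) (simp add: power2_eq_square)
  finally show ?thesis by (simp add: L2_set_def)
qed

text \<open>The sum on the right is the integrand of the equation for the difference quotients, tested with
  \<open>\<phi>\<^sup>2 \<theta>(|q|\<^sup>2) q\<close>, where \<open>z = q\<close>, \<open>N i\<close> is the \<open>i\<close>-th derivative of the gradient and \<open>s = |z|\<close>.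
  The Cauchy-Schwarz inequality for the form \<open>B w \<bullet> w\<close> absorbs the term with \<open>\<theta>'\<close>, even though
  \<open>\<theta>\<close> may decrease like \<open>s powr (- a)\<close>, because \<open>a < 1\<close>.\<close>
lemma plap_form_coercive:
  fixes N :: "'a::euclidean_space \<Rightarrow> 'a" and z P D :: 'a
  assumes \<beta>: "0 < \<beta>" "\<beta> \<le> 1 / 2" and c: "2 * \<beta> - 1 \<le> c" and z: "z \<noteq> 0"
    and a: "0 \<le> a" "a \<le> 1 - \<beta>" and \<theta>: "0 \<le> \<theta>" "0 \<le> e" and \<theta>': "2 * \<theta>' * (norm z)\<^sup>2 = e - a * \<theta>"
    and R: "1 \<le> R" "\<bar>\<phi>\<bar> \<le> R" "norm D \<le> R" "norm P \<le> R" "1 + \<bar>c\<bar> \<le> R"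
  defines "W \<equiv> \<Sum>i\<in>Basis. (z \<bullet> i) *\<^sub>R N i"
  shows "\<beta>\<^sup>2 * \<phi>\<^sup>2 * \<theta> * (\<Sum>i\<in>Basis. (norm (N i))\<^sup>2)
      - 5 * R ^ 4 / \<beta>\<^sup>2 * (norm z)\<^sup>2 * (1 + (ln (norm z))\<^sup>2) * (\<theta> + e)
    \<le> (\<Sum>i\<in>Basis. plap_linear c P z i (N i) \<bullet>
          ((2 * \<phi> * \<theta> * (z \<bullet> i)) *\<^sub>R D + \<phi>\<^sup>2 *\<^sub>R (\<theta> *\<^sub>R N i + (2 * \<theta>' * (z \<bullet> i)) *\<^sub>R W)))"
proof -
  define s where "s = norm z"
  define l where "l = ln s"
  define n where "n = sqrt (\<Sum>i\<in>Basis. (norm (N i))\<^sup>2)"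
  define NP where "NP = (\<Sum>i\<in>Basis. (P \<bullet> i) *\<^sub>R N i)"
  define B where "B w = w + (c * (w \<bullet> z) / s\<^sup>2) *\<^sub>R z" for w
  have s: "s > 0" using z by (simp add: s_def)
  have n2: "n\<^sup>2 = (\<Sum>i\<in>Basis. (norm (N i))\<^sup>2)" and n0: "0 \<le> n" unfolding n_def by (simp_all add: sum_nonneg)
  have Wn: "norm W \<le> s * n" unfolding W_def n_def s_def by (rule norm_basis_combination_le)
  have NPn: "norm NP \<le> R * n"
  proof -
    have "norm NP \<le> norm P * n" unfolding NP_def n_def by (rule norm_basis_combination_le)
    also have "\<dots> \<le> R * n" using R n0 by (intro mult_right_mono) auto
    finally show ?thesis .
  qed
  have Blin: "linear B" unfolding B_def
    by (rule linearI) (auto simp: inner_add_left algebra_simps add_divide_distrib)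
  have Bsym: "B v \<bullet> w = B w \<bullet> v" for v w
    unfolding B_def by (simp add: inner_add_left inner_commute[of v w] inner_commute[of z w] inner_commute[of z v])
  have BW: "(\<Sum>i\<in>Basis. (z \<bullet> i) *\<^sub>R B (N i)) = B W"
    unfolding W_def using Blin by (simp add: linear_sum linear_cmul)
  have zz: "(\<Sum>i\<in>Basis. (z \<bullet> i)\<^sup>2) = s\<^sup>2" unfolding s_def
    by (subst power2_norm_eq_inner, subst (2) euclidean_inner) (simp add: power2_eq_square)
  have Pz: "(\<Sum>i\<in>Basis. (i \<bullet> P) * (z \<bullet> i)) = P \<bullet> z"
    by (subst (2) euclidean_inner) (simp add: inner_commute)
  have Bz: "B w \<bullet> z = (1 + c) * (w \<bullet> z)" for w
    using s unfolding B_def s_def by (simp add: inner_add_left power2_norm_eq_inner[symmetric] algebra_simps)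
  \<comment> \<open>The form has eigenvalue 1 + c along z and 1 across it. Both are at least
    2\<beta>, since 2\<beta> \<le> 1.\<close>
  have Qlow: "2 * \<beta> * (norm w)\<^sup>2 \<le> B w \<bullet> w" for w
  proof -
    have cs: "(w \<bullet> z)\<^sup>2 / s\<^sup>2 \<le> (norm w)\<^sup>2"
      using Cauchy_Schwarz_ineq[of w z] s by (simp add: s_def power2_norm_eq_inner field_simps)
    have eq: "B w \<bullet> w = (norm w)\<^sup>2 + c * ((w \<bullet> z)\<^sup>2 / s\<^sup>2)"
      unfolding B_def inner_add_left inner_scaleR_left inner_commute[of z w]
      by (simp add: power2_norm_eq_inner) (simp add: power2_eq_square)
    have x0: "0 \<le> (w \<bullet> z)\<^sup>2 / s\<^sup>2" by simp
    have "(2 * \<beta> - 1) * (norm w)\<^sup>2 \<le> (2 * \<beta> - 1) * ((w \<bullet> z)\<^sup>2 / s\<^sup>2)"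
      using cs \<beta> by (intro mult_left_mono_neg) auto
    also have "\<dots> \<le> c * ((w \<bullet> z)\<^sup>2 / s\<^sup>2)" using c x0 by (intro mult_right_mono)
    finally show ?thesis unfolding eq by (simp add: algebra_simps)
  qed
  have Q0: "0 \<le> B w \<bullet> w" for w using Qlow[of w] \<beta> by (smt (verit) mult_nonneg_nonneg zero_le_power2)
  define SQ where "SQ = (\<Sum>i\<in>Basis. B (N i) \<bullet> N i)"
  have SQlow: "2 * \<beta> * n\<^sup>2 \<le> SQ" unfolding SQ_def n2 sum_distrib_left by (intro sum_mono Qlow)
  \<comment> \<open>Cauchy-Schwarz for the nonnegative form: its sum over the vectors s^2 N_i - z_i
    W is nonnegative, and expanding with \<open>BW\<close> and \<open>zz\<close> gives the
    inequality.\<close>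
  have QW: "B W \<bullet> W \<le> s\<^sup>2 * SQ"
  proof -
    have "0 \<le> (\<Sum>i\<in>Basis. B (s\<^sup>2 *\<^sub>R N i - (z \<bullet> i) *\<^sub>R W) \<bullet> (s\<^sup>2 *\<^sub>R N i - (z \<bullet> i) *\<^sub>R W))"
      by (intro sum_nonneg Q0)
    also have "\<dots> = (\<Sum>i\<in>Basis. s\<^sup>2 * s\<^sup>2 * (B (N i) \<bullet> N i) - 2 * s\<^sup>2 * (((z \<bullet> i) *\<^sub>R B (N i)) \<bullet> W) + (z \<bullet> i)\<^sup>2 * (B W \<bullet> W))"
    proof (rule sum.cong[OF refl])
      fix i
      show "B (s\<^sup>2 *\<^sub>R N i - (z \<bullet> i) *\<^sub>R W) \<bullet> (s\<^sup>2 *\<^sub>R N i - (z \<bullet> i) *\<^sub>R W) =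
        s\<^sup>2 * s\<^sup>2 * (B (N i) \<bullet> N i) - 2 * s\<^sup>2 * (((z \<bullet> i) *\<^sub>R B (N i)) \<bullet> W) + (z \<bullet> i)\<^sup>2 * (B W \<bullet> W)"
        using Bsym[of W "N i"]
        by (simp add: linear_diff[OF Blin] linear_cmul[OF Blin] inner_diff_left inner_diff_right power2_eq_square algebra_simps)
    qed
    also have "\<dots> = s\<^sup>2 * s\<^sup>2 * SQ - 2 * s\<^sup>2 * (B W \<bullet> W) + s\<^sup>2 * (B W \<bullet> W)"
      unfolding sum.distrib sum_subtractf sum_distrib_left[symmetric] sum_distrib_right[symmetric] inner_sum_left[symmetric] BW zz SQ_def ..
    finally have "s\<^sup>2 * (B W \<bullet> W) \<le> s\<^sup>2 * (s\<^sup>2 * SQ)" by (simp add: algebra_simps)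
    then show ?thesis by (rule mult_left_le_imp_le) (use s in simp)
  qed
  define w where "w = norm W / s"
  have w: "0 \<le> w" "w \<le> n" "norm W = s * w" using s Wn by (auto simp: w_def field_simps)
  define k where "k = e - a * \<theta>"
  have \<theta>'k: "2 * \<theta>' = k / s\<^sup>2" using \<theta>' s by (simp add: k_def s_def field_simps)
  have total: "(\<Sum>i\<in>Basis. plap_linear c P z i (N i) \<bullet>
          ((2 * \<phi> * \<theta> * (z \<bullet> i)) *\<^sub>R D + \<phi>\<^sup>2 *\<^sub>R (\<theta> *\<^sub>R N i + (2 * \<theta>' * (z \<bullet> i)) *\<^sub>R W)))
    = \<phi>\<^sup>2 * (\<theta> * SQ + 2 * \<theta>' * (B W \<bullet> W) + l * \<theta> * (z \<bullet> NP) + 2 * \<theta>' * l * (P \<bullet> z) * (z \<bullet> W))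
      + 2 * \<phi> * \<theta> * (B W \<bullet> D + l * (P \<bullet> z) * (z \<bullet> D))"
  proof -
    have "plap_linear c P z i (N i) \<bullet>
          ((2 * \<phi> * \<theta> * (z \<bullet> i)) *\<^sub>R D + \<phi>\<^sup>2 *\<^sub>R (\<theta> *\<^sub>R N i + (2 * \<theta>' * (z \<bullet> i)) *\<^sub>R W))
      = \<phi>\<^sup>2 * \<theta> * (B (N i) \<bullet> N i) + \<phi>\<^sup>2 * (2 * \<theta>') * (((z \<bullet> i) *\<^sub>R B (N i)) \<bullet> W)
        + \<phi>\<^sup>2 * l * \<theta> * (((P \<bullet> i) *\<^sub>R N i) \<bullet> z) + \<phi>\<^sup>2 * (2 * \<theta>') * l * (z \<bullet> W) * ((i \<bullet> P) * (z \<bullet> i))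
        + 2 * \<phi> * \<theta> * (((z \<bullet> i) *\<^sub>R B (N i)) \<bullet> D) + 2 * \<phi> * \<theta> * l * (z \<bullet> D) * ((i \<bullet> P) * (z \<bullet> i))" for i
    proof -
      have "plap_linear c P z i (N i) = B (N i) + ((i \<bullet> P) * l) *\<^sub>R z"
        unfolding plap_linear_def B_def s_def l_def by (simp add: algebra_simps)
      then show ?thesis
        by (simp add: inner_add_left inner_add_right inner_commute[of P i] inner_commute[of "N i" z] algebra_simps)
    qed
    then have "(\<Sum>i\<in>Basis. plap_linear c P z i (N i) \<bullet>
          ((2 * \<phi> * \<theta> * (z \<bullet> i)) *\<^sub>R D + \<phi>\<^sup>2 *\<^sub>R (\<theta> *\<^sub>R N i + (2 * \<theta>' * (z \<bullet> i)) *\<^sub>R W)))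
      = (\<Sum>i\<in>Basis. \<phi>\<^sup>2 * \<theta> * (B (N i) \<bullet> N i) + \<phi>\<^sup>2 * (2 * \<theta>') * (((z \<bullet> i) *\<^sub>R B (N i)) \<bullet> W)
        + \<phi>\<^sup>2 * l * \<theta> * (((P \<bullet> i) *\<^sub>R N i) \<bullet> z) + \<phi>\<^sup>2 * (2 * \<theta>') * l * (z \<bullet> W) * ((i \<bullet> P) * (z \<bullet> i))
        + 2 * \<phi> * \<theta> * (((z \<bullet> i) *\<^sub>R B (N i)) \<bullet> D) + 2 * \<phi> * \<theta> * l * (z \<bullet> D) * ((i \<bullet> P) * (z \<bullet> i)))"
      by (rule sum.cong[OF refl])
    also have "\<dots> = \<phi>\<^sup>2 * \<theta> * SQ + \<phi>\<^sup>2 * (2 * \<theta>') * (B W \<bullet> W) + \<phi>\<^sup>2 * l * \<theta> * (NP \<bullet> z)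
        + \<phi>\<^sup>2 * (2 * \<theta>') * l * (z \<bullet> W) * (P \<bullet> z) + 2 * \<phi> * \<theta> * (B W \<bullet> D) + 2 * \<phi> * \<theta> * l * (z \<bullet> D) * (P \<bullet> z)"
      unfolding sum.distrib sum_distrib_left[symmetric] inner_sum_left[symmetric] BW NP_def[symmetric] Pz SQ_def ..
    finally show ?thesis by (simp add: inner_commute[of NP z] algebra_simps)
  qed
  \<comment> \<open>The negative term -a \<theta> takes at most the fraction a of \<open>SQ\<close>;
    of the rest, 1 - a \<ge> \<beta> and \<open>SQlow\<close> leave 2\<beta>^2 n^2. The part with
    \<open>e\<close> is kept because it absorbs a logarithmic term in \<open>y2\<close>.\<close>
  have main: "2 * \<beta>\<^sup>2 * \<theta> * n\<^sup>2 + 2 * \<beta> * e * w\<^sup>2 \<le> \<theta> * SQ + 2 * \<theta>' * (B W \<bullet> W)"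
  proof -
    have "a * \<theta> * ((B W \<bullet> W) / s\<^sup>2) \<le> a * \<theta> * SQ" using QW s a \<theta> by (intro mult_left_mono) (auto simp: field_simps)
    moreover have "e * (2 * \<beta> * w\<^sup>2) \<le> e * ((B W \<bullet> W) / s\<^sup>2)"
      using Qlow[of W] s \<theta> w(3) by (intro mult_left_mono) (auto simp: field_simps power_mult_distrib)
    moreover have "2 * \<theta>' * (B W \<bullet> W) = e * ((B W \<bullet> W) / s\<^sup>2) - a * \<theta> * ((B W \<bullet> W) / s\<^sup>2)"
      unfolding \<theta>'k k_def by (simp add: diff_divide_distrib algebra_simps)
    moreover have "\<theta> * (2 * \<beta>\<^sup>2 * n\<^sup>2) \<le> \<theta> * ((1 - a) * SQ)"
    proof (rule mult_left_mono[OF _ \<theta>(1)])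
      have "\<beta> * (2 * \<beta> * n\<^sup>2) \<le> (1 - a) * SQ" using \<beta> a SQlow by (intro mult_mono) auto
      then show "2 * \<beta>\<^sup>2 * n\<^sup>2 \<le> (1 - a) * SQ" by (simp add: power2_eq_square algebra_simps)
    qed
    ultimately show ?thesis by (simp add: algebra_simps)
  qed
  have Pzb: "\<bar>P \<bullet> z\<bar> \<le> R * s"
    unfolding s_def by (rule order_trans[OF Cauchy_Schwarz_ineq2 mult_right_mono[OF R(4) norm_ge_zero]])
  have kb: "\<bar>k\<bar> \<le> e + \<theta>"
  proof -
    have "a * \<theta> \<le> \<theta>" using a \<beta> \<theta> by (intro mult_left_le_one_le) auto
    moreover have "0 \<le> a * \<theta>" using a \<theta> by simp
    ultimately show ?thesis using \<theta> unfolding k_def by linarith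
  qed
  have t1: "\<bar>l * \<theta> * (z \<bullet> NP)\<bar> \<le> \<theta> * (\<bar>l\<bar> * R * s * n)"
  proof -
    have "\<bar>z \<bullet> NP\<bar> \<le> s * (R * n)"
      unfolding s_def by (rule order_trans[OF Cauchy_Schwarz_ineq2 mult_left_mono[OF NPn norm_ge_zero]])
    then have "(\<bar>l\<bar> * \<theta>) * \<bar>z \<bullet> NP\<bar> \<le> (\<bar>l\<bar> * \<theta>) * (s * (R * n))" using \<theta> by (intro mult_left_mono) auto
    then show ?thesis using \<theta> by (simp add: abs_mult algebra_simps)
  qed
  have t2: "\<bar>2 * \<theta>' * l * (P \<bullet> z) * (z \<bullet> W)\<bar> \<le> (e + \<theta>) * (\<bar>l\<bar> * R * s * w)"
  proof -
    have "\<bar>z \<bullet> W\<bar> \<le> s * (s * w)" using Cauchy_Schwarz_ineq2[of z W] w(3) by (simp add: s_def)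
    then have "\<bar>P \<bullet> z\<bar> * \<bar>z \<bullet> W\<bar> \<le> (R * s) * (s * (s * w))" using Pzb R s by (intro mult_mono) auto
    then have "(\<bar>k\<bar> * \<bar>l\<bar> / s\<^sup>2) * (\<bar>P \<bullet> z\<bar> * \<bar>z \<bullet> W\<bar>) \<le> (\<bar>k\<bar> * \<bar>l\<bar> / s\<^sup>2) * ((R * s) * (s * (s * w)))"
      by (intro mult_left_mono) auto
    also have "\<dots> = \<bar>k\<bar> * (\<bar>l\<bar> * R * s * w)" using s by (simp add: power2_eq_square field_simps)
    also have "\<dots> \<le> (e + \<theta>) * (\<bar>l\<bar> * R * s * w)" using kb R s w by (intro mult_right_mono) auto
    finally show ?thesis unfolding \<theta>'k by (simp add: abs_mult abs_divide)
  qed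
  have t3: "\<bar>B W \<bullet> D\<bar> \<le> R * R * s * n"
  proof -
    have h: "\<bar>W \<bullet> z\<bar> / s \<le> norm W" using Cauchy_Schwarz_ineq2[of W z] s by (simp add: s_def field_simps)
    have "norm (B W) \<le> norm W + \<bar>c\<bar> * (\<bar>W \<bullet> z\<bar> / s)"
      unfolding B_def using s by (intro order_trans[OF norm_triangle_ineq]) (simp add: abs_mult abs_divide s_def power2_eq_square field_simps)
    also have "\<dots> \<le> (1 + \<bar>c\<bar>) * norm W" using mult_left_mono[OF h, of "\<bar>c\<bar>"] unfolding distrib_right by linarith
    finally have "norm (B W) \<le> (1 + \<bar>c\<bar>) * norm W" .
    also have "\<dots> \<le> R * (s * n)" using R Wn by (intro mult_mono) auto
    finally have "norm (B W) * norm D \<le> (R * (s * n)) * R" using R s n0 by (intro mult_mono) auto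
    then show ?thesis using Cauchy_Schwarz_ineq2[of "B W" D] by (simp add: algebra_simps)
  qed
  have t4: "\<bar>l * (P \<bullet> z) * (z \<bullet> D)\<bar> \<le> \<bar>l\<bar> * R * R * s\<^sup>2"
  proof -
    have "\<bar>z \<bullet> D\<bar> \<le> s * R"
      unfolding s_def by (rule order_trans[OF Cauchy_Schwarz_ineq2 mult_left_mono[OF R(3) norm_ge_zero]])
    then have "\<bar>P \<bullet> z\<bar> * \<bar>z \<bullet> D\<bar> \<le> (R * s) * (s * R)" using Pzb R s by (intro mult_mono) auto
    then have "\<bar>l\<bar> * (\<bar>P \<bullet> z\<bar> * \<bar>z \<bullet> D\<bar>) \<le> \<bar>l\<bar> * ((R * s) * (s * R))" by (intro mult_left_mono) auto
    then show ?thesis by (simp add: abs_mult power2_eq_square algebra_simps)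
  qed
  define f where "f = \<bar>\<phi>\<bar>"
  have f: "0 \<le> f" "f \<le> R" "\<phi>\<^sup>2 = f\<^sup>2" by (auto simp: f_def R)
  define X where "X = s\<^sup>2 * (1 + l\<^sup>2)"
  have X: "0 \<le> X" "l\<^sup>2 * s\<^sup>2 \<le> X" "s\<^sup>2 \<le> X" "2 * \<bar>l\<bar> * s\<^sup>2 \<le> X"
  proof -
    show "0 \<le> X" "l\<^sup>2 * s\<^sup>2 \<le> X" "s\<^sup>2 \<le> X" unfolding X_def by (auto simp: algebra_simps)
    have "0 \<le> (\<bar>l\<bar> - 1)\<^sup>2" by simp
    then have "2 * \<bar>l\<bar> \<le> 1 + l\<^sup>2" by (simp add: power2_diff)
    then show "2 * \<bar>l\<bar> * s\<^sup>2 \<le> X" unfolding X_def using mult_right_mono[of "2 * \<bar>l\<bar>" "1 + l\<^sup>2" "s\<^sup>2"] by (simp add: mult.commute)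
  qed
  have b2: "0 < \<beta>\<^sup>2" using \<beta> by simp
  have ff: "f\<^sup>2 \<le> R\<^sup>2" using f by (simp add: power_mono)
  have R4: "R\<^sup>2 * R\<^sup>2 = R ^ 4" "1 \<le> R ^ 4" "R ^ 3 \<le> R ^ 4" using R(1)
    by (simp_all add: power_add[symmetric] one_le_power power_increasing)
  have y1: "f\<^sup>2 * (\<theta> * (2 * (\<bar>l\<bar> * R * s * n))) \<le> \<beta>\<^sup>2 / 2 * (f\<^sup>2 * \<theta> * n\<^sup>2) + 2 * R ^ 4 / \<beta>\<^sup>2 * X * \<theta>"
  proof -
    have "n * (2 * (\<bar>l\<bar> * R * s)) \<le> \<beta>\<^sup>2 / 2 * n\<^sup>2 + (2 * (\<bar>l\<bar> * R * s))\<^sup>2 / (4 * (\<beta>\<^sup>2 / 2))" using b2 by (intro young) simp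
    also have "(2 * (\<bar>l\<bar> * R * s))\<^sup>2 / (4 * (\<beta>\<^sup>2 / 2)) = 2 * R\<^sup>2 / \<beta>\<^sup>2 * (l\<^sup>2 * s\<^sup>2)" by (simp add: power_mult_distrib field_simps)
    also have "\<dots> \<le> 2 * R\<^sup>2 / \<beta>\<^sup>2 * X" using X by (intro mult_left_mono) auto
    finally have "(f\<^sup>2 * \<theta>) * (n * (2 * (\<bar>l\<bar> * R * s))) \<le> (f\<^sup>2 * \<theta>) * (\<beta>\<^sup>2 / 2 * n\<^sup>2 + 2 * R\<^sup>2 / \<beta>\<^sup>2 * X)"
      using \<theta> by (intro mult_left_mono) auto
    moreover have "f\<^sup>2 * (\<theta> * (2 * R\<^sup>2 / \<beta>\<^sup>2 * X)) \<le> R\<^sup>2 * (\<theta> * (2 * R\<^sup>2 / \<beta>\<^sup>2 * X))"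
      using ff \<theta> X by (intro mult_right_mono) auto
    moreover have "R\<^sup>2 * (\<theta> * (2 * R\<^sup>2 / \<beta>\<^sup>2 * X)) = 2 * R ^ 4 / \<beta>\<^sup>2 * X * \<theta>" unfolding R4(1)[symmetric] by (simp add: algebra_simps)
    ultimately show ?thesis by (simp add: algebra_simps)
  qed
  have y2: "f\<^sup>2 * (e * (\<bar>l\<bar> * R * s * w)) \<le> f\<^sup>2 * (2 * \<beta> * e * w\<^sup>2) + R ^ 4 / \<beta>\<^sup>2 * X * e"
  proof -
    have "w * (\<bar>l\<bar> * R * s) \<le> 2 * \<beta> * w\<^sup>2 + (\<bar>l\<bar> * R * s)\<^sup>2 / (4 * (2 * \<beta>))" using \<beta> by (intro young) simp
    also have "(\<bar>l\<bar> * R * s)\<^sup>2 / (4 * (2 * \<beta>)) \<le> R\<^sup>2 / \<beta>\<^sup>2 * X"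
    proof -
      have "(\<bar>l\<bar> * R * s)\<^sup>2 / (4 * (2 * \<beta>)) = (R\<^sup>2 * (l\<^sup>2 * s\<^sup>2)) / (8 * \<beta>)" by (simp add: power_mult_distrib algebra_simps)
      also have "\<dots> \<le> (R\<^sup>2 * X) / \<beta>\<^sup>2"
      proof (rule frac_le)
        show "\<beta>\<^sup>2 \<le> 8 * \<beta>" using \<beta> by (simp add: power2_eq_square)
      qed (use X b2 in \<open>auto intro: mult_left_mono\<close>)
      finally show ?thesis by simp
    qed
    finally have "(f\<^sup>2 * e) * (w * (\<bar>l\<bar> * R * s)) \<le> (f\<^sup>2 * e) * (2 * \<beta> * w\<^sup>2 + R\<^sup>2 / \<beta>\<^sup>2 * X)"
      using \<theta> by (intro mult_left_mono) auto
    moreover have "f\<^sup>2 * (e * (R\<^sup>2 / \<beta>\<^sup>2 * X)) \<le> R\<^sup>2 * (e * (R\<^sup>2 / \<beta>\<^sup>2 * X))"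
      using ff \<theta> X by (intro mult_right_mono) auto
    moreover have "R\<^sup>2 * (e * (R\<^sup>2 / \<beta>\<^sup>2 * X)) = R ^ 4 / \<beta>\<^sup>2 * X * e" unfolding R4(1)[symmetric] by (simp add: algebra_simps)
    ultimately show ?thesis by (simp add: algebra_simps)
  qed
  have y3: "2 * f * \<theta> * (R * R * s * n) \<le> \<beta>\<^sup>2 / 2 * (f\<^sup>2 * \<theta> * n\<^sup>2) + 2 * R ^ 4 / \<beta>\<^sup>2 * X * \<theta>"
  proof -
    have "(f * n) * (2 * R\<^sup>2 * s) \<le> \<beta>\<^sup>2 / 2 * (f * n)\<^sup>2 + (2 * R\<^sup>2 * s)\<^sup>2 / (4 * (\<beta>\<^sup>2 / 2))" using b2 by (intro young) simp
    also have "(2 * R\<^sup>2 * s)\<^sup>2 / (4 * (\<beta>\<^sup>2 / 2)) = 2 * R ^ 4 / \<beta>\<^sup>2 * s\<^sup>2" by (simp add: power_mult_distrib field_simps)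
    also have "\<dots> \<le> 2 * R ^ 4 / \<beta>\<^sup>2 * X" using X by (intro mult_left_mono) auto
    finally have "\<theta> * ((f * n) * (2 * R\<^sup>2 * s)) \<le> \<theta> * (\<beta>\<^sup>2 / 2 * (f * n)\<^sup>2 + 2 * R ^ 4 / \<beta>\<^sup>2 * X)"
      using \<theta> by (intro mult_left_mono) auto
    then show ?thesis by (simp add: power_mult_distrib power2_eq_square algebra_simps)
  qed
  have y4: "2 * f * \<theta> * (\<bar>l\<bar> * R * R * s\<^sup>2) \<le> R ^ 4 / \<beta>\<^sup>2 * X * \<theta>"
  proof -
    have "f * (R * R) * (2 * \<bar>l\<bar> * s\<^sup>2) \<le> R * (R * R) * X" using f R X by (intro mult_mono) auto
    also have "\<dots> \<le> R ^ 4 / \<beta>\<^sup>2 * X"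
    proof (rule mult_right_mono[OF _ X(1)])
      have "\<beta>\<^sup>2 \<le> 1" using \<beta> by (simp add: power_le_one)
      then have "R ^ 4 \<le> R ^ 4 / \<beta>\<^sup>2" using b2 R4(2) by (simp add: field_simps mult_left_le_one_le)
      then show "R * (R * R) \<le> R ^ 4 / \<beta>\<^sup>2" using R4(3) by (simp add: power3_eq_cube)
    qed
    finally have "\<theta> * (f * (R * R) * (2 * \<bar>l\<bar> * s\<^sup>2)) \<le> \<theta> * (R ^ 4 / \<beta>\<^sup>2 * X)" using \<theta> by (intro mult_left_mono)
    then show ?thesis by (simp add: algebra_simps)
  qed
  have w2: "\<theta> * (\<bar>l\<bar> * R * s * w) \<le> \<theta> * (\<bar>l\<bar> * R * s * n)" using w s R \<theta> by (intro mult_left_mono) auto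
  have lower1: "f\<^sup>2 * (\<theta> * SQ + 2 * \<theta>' * (B W \<bullet> W) + l * \<theta> * (z \<bullet> NP) + 2 * \<theta>' * l * (P \<bullet> z) * (z \<bullet> W))
     \<ge> f\<^sup>2 * (2 * \<beta>\<^sup>2 * \<theta> * n\<^sup>2 + 2 * \<beta> * e * w\<^sup>2 - \<theta> * (2 * (\<bar>l\<bar> * R * s * n)) - e * (\<bar>l\<bar> * R * s * w))"
  proof (rule mult_left_mono)
    have "(e + \<theta>) * (\<bar>l\<bar> * R * s * w) \<le> e * (\<bar>l\<bar> * R * s * w) + \<theta> * (\<bar>l\<bar> * R * s * n)"
      using w2 by (simp add: algebra_simps)
    moreover have "\<theta> * (2 * (\<bar>l\<bar> * R * s * n)) = \<theta> * (\<bar>l\<bar> * R * s * n) + \<theta> * (\<bar>l\<bar> * R * s * n)" by simp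
    ultimately show "2 * \<beta>\<^sup>2 * \<theta> * n\<^sup>2 + 2 * \<beta> * e * w\<^sup>2 - \<theta> * (2 * (\<bar>l\<bar> * R * s * n)) - e * (\<bar>l\<bar> * R * s * w)
      \<le> \<theta> * SQ + 2 * \<theta>' * (B W \<bullet> W) + l * \<theta> * (z \<bullet> NP) + 2 * \<theta>' * l * (P \<bullet> z) * (z \<bullet> W)"
      using main t1 t2 unfolding abs_le_iff by linarith
  qed simp
  have lower2: "- (2 * f * \<theta> * (R * R * s * n)) - 2 * f * \<theta> * (\<bar>l\<bar> * R * R * s\<^sup>2)
     \<le> 2 * \<phi> * \<theta> * (B W \<bullet> D + l * (P \<bullet> z) * (z \<bullet> D))"
  proof -
    have "\<bar>B W \<bullet> D + l * (P \<bullet> z) * (z \<bullet> D)\<bar> \<le> R * R * s * n + \<bar>l\<bar> * R * R * s\<^sup>2" using t3 t4 by linarith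
    then have "(2 * f * \<theta>) * \<bar>B W \<bullet> D + l * (P \<bullet> z) * (z \<bullet> D)\<bar> \<le> (2 * f * \<theta>) * (R * R * s * n + \<bar>l\<bar> * R * R * s\<^sup>2)"
      using f \<theta> by (intro mult_left_mono) auto
    moreover have "\<bar>2 * \<phi> * \<theta> * (B W \<bullet> D + l * (P \<bullet> z) * (z \<bullet> D))\<bar> = (2 * f * \<theta>) * \<bar>B W \<bullet> D + l * (P \<bullet> z) * (z \<bullet> D)\<bar>"
      using \<theta> by (simp add: f_def abs_mult)
    ultimately show ?thesis unfolding distrib_left by linarith
  qed
  \<comment> \<open>The budget: \<open>y1\<close> and \<open>y3\<close> each use half of one of the
    two copies of \<beta>^2 f^2 \<theta> n^2, so one copy survives. The remainders are 2 + 2 + 1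
    multiples of \<theta> and one multiple of e, all covered by the constant 5.\<close>
  have "5 * R ^ 4 / \<beta>\<^sup>2 * s\<^sup>2 * (1 + l\<^sup>2) * (\<theta> + e) =
     2 * R ^ 4 / \<beta>\<^sup>2 * X * \<theta> + 2 * R ^ 4 / \<beta>\<^sup>2 * X * \<theta> + R ^ 4 / \<beta>\<^sup>2 * X * \<theta> + R ^ 4 / \<beta>\<^sup>2 * X * e + 4 * (R ^ 4 / \<beta>\<^sup>2 * X * e)"
    unfolding X_def by (simp add: algebra_simps add_divide_distrib)
  moreover have "0 \<le> R ^ 4 / \<beta>\<^sup>2 * X * e" using X \<theta> by simp
  moreover have "f\<^sup>2 * (2 * \<beta>\<^sup>2 * \<theta> * n\<^sup>2 + 2 * \<beta> * e * w\<^sup>2 - \<theta> * (2 * (\<bar>l\<bar> * R * s * n)) - e * (\<bar>l\<bar> * R * s * w))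
    = \<beta>\<^sup>2 * (f\<^sup>2 * \<theta> * n\<^sup>2) + \<beta>\<^sup>2 / 2 * (f\<^sup>2 * \<theta> * n\<^sup>2) + \<beta>\<^sup>2 / 2 * (f\<^sup>2 * \<theta> * n\<^sup>2)
      + f\<^sup>2 * (2 * \<beta> * e * w\<^sup>2) - f\<^sup>2 * (\<theta> * (2 * (\<bar>l\<bar> * R * s * n))) - f\<^sup>2 * (e * (\<bar>l\<bar> * R * s * w))"
    by (simp add: algebra_simps)
  ultimately have "\<beta>\<^sup>2 * (f\<^sup>2 * \<theta> * n\<^sup>2) - 5 * R ^ 4 / \<beta>\<^sup>2 * s\<^sup>2 * (1 + l\<^sup>2) * (\<theta> + e)
    \<le> f\<^sup>2 * (\<theta> * SQ + 2 * \<theta>' * (B W \<bullet> W) + l * \<theta> * (z \<bullet> NP) + 2 * \<theta>' * l * (P \<bullet> z) * (z \<bullet> W))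
      + 2 * \<phi> * \<theta> * (B W \<bullet> D + l * (P \<bullet> z) * (z \<bullet> D))"
    using y1 y2 y3 y4 lower1 lower2 by linarith
  from this[unfolded f(3)[symmetric], folded total] show ?thesis
    unfolding n2[symmetric] s_def[symmetric] l_def[symmetric] by (simp add: mult.assoc)
qed

section \<open>Power estimates and the truncated weight\<close>

lemma powr_two_sided:
  assumes "0 < m" "m \<le> s" "s \<le> M" "\<bar>t\<bar> \<le> (T::real)"
  shows "exp (- (T * (\<bar>ln m\<bar> + \<bar>ln M\<bar>))) \<le> s powr t" "s powr t \<le> exp (T * (\<bar>ln m\<bar> + \<bar>ln M\<bar>))"
proof -
  have "ln m \<le> ln s" "ln s \<le> ln M" using assms by auto
  then have "\<bar>ln s\<bar> \<le> \<bar>ln m\<bar> + \<bar>ln M\<bar>" by linarith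
  then have "\<bar>t\<bar> * \<bar>ln s\<bar> \<le> T * (\<bar>ln m\<bar> + \<bar>ln M\<bar>)" using assms(4) by (intro mult_mono) auto
  then have "\<bar>t * ln s\<bar> \<le> T * (\<bar>ln m\<bar> + \<bar>ln M\<bar>)" by (simp add: abs_mult)
  then show "exp (- (T * (\<bar>ln m\<bar> + \<bar>ln M\<bar>))) \<le> s powr t" "s powr t \<le> exp (T * (\<bar>ln m\<bar> + \<bar>ln M\<bar>))"
    using assms by (auto simp: powr_def abs_le_iff)
qed

text \<open>Reduces a variable exponent to its lower bound: the surplus t - b lies in [0, T], so it
  costs at most a fixed constant as long as s stays below M.\<close>

lemma powr_le_mult_powr:
  fixes s t b T M :: real
  assumes "0 < s" "s \<le> M" "1 \<le> M" "b \<le> t" "t \<le> b + T" "0 \<le> T"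
  shows "s powr t \<le> M powr T * s powr b"
proof -
  have "s powr (t - b) \<le> M powr (t - b)" using assms by (intro powr_mono2) auto
  also have "\<dots> \<le> M powr T" using assms by (intro powr_mono) auto
  finally have "s powr (t - b) * s powr b \<le> M powr T * s powr b" by (intro mult_right_mono) auto
  then show ?thesis by (simp flip: powr_add)
qed

text \<open>Since \<epsilon>/s \<le> 1 and b \<le> 2, the square of \<epsilon>/s is at most its
  power b. A quadratic cutoff thus converts the weight s^b into the small factor
  \<epsilon>^b.\<close>

lemma sq_mult_powr_le:
  fixes \<epsilon> s b :: real
  assumes "0 < \<epsilon>" "\<epsilon> \<le> s" "0 \<le> b" "b \<le> 2"
  shows "(\<epsilon> / s)\<^sup>2 * s powr b \<le> \<epsilon> powr b"
proof -
  have r: "0 < \<epsilon> / s" "\<epsilon> / s \<le> 1" using assms by auto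
  have "(\<epsilon> / s)\<^sup>2 = (\<epsilon> / s) powr 2" using r(1) by simp
  also have "\<dots> \<le> (\<epsilon> / s) powr b" using r assms(4) by (intro powr_mono') auto
  also have "\<dots> = \<epsilon> powr b / s powr b" using assms by (simp add: powr_divide)
  finally show ?thesis using assms by (simp add: field_simps)
qed

lemma small_powr:
  fixes b c e :: real
  assumes "0 < b" "0 \<le> c" "0 < e"
  obtains \<epsilon> where "0 < \<epsilon>" "\<epsilon> \<le> 1" "c * \<epsilon> powr b \<le> e"
proof -
  define t where "t = e / (c + 1)"
  have t: "0 < t" "c * t \<le> e" using assms by (auto simp: t_def field_simps)
  define \<epsilon> where "\<epsilon> = min 1 (t powr (1 / b))"
  have \<epsilon>: "0 < \<epsilon>" "\<epsilon> \<le> 1" using t by (auto simp: \<epsilon>_def)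
  have "\<epsilon> powr b \<le> (t powr (1 / b)) powr b" using \<epsilon> assms by (intro powr_mono2) (auto simp: \<epsilon>_def)
  also have "\<dots> = t" using t assms by (simp add: powr_powr)
  finally have "c * \<epsilon> powr b \<le> c * t" using assms by (intro mult_left_mono)
  then show ?thesis using that[OF \<epsilon>] t by linarith
qed

text \<open>Near zero |ln s| \<le> s^(-b)/b, so the squared logarithm consumes 2b of the exponent 3b
  and a positive power remains. Above 1 everything is bounded in terms of M.\<close>

lemma powr_ln_bound:
  fixes b M T :: real
  assumes b: "0 < b" and M: "1 \<le> M" and T: "0 \<le> T"
  obtains C where "0 < C" "\<And>s t. 0 < s \<Longrightarrow> s \<le> M \<Longrightarrow> 3 * b \<le> t \<Longrightarrow> t \<le> 3 * b + T \<Longrightarrow> s powr t * (1 + (ln s)\<^sup>2) \<le> C"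
proof -
  define C where "C = M powr T * M powr (3 * b) + M powr T * (M powr b * (1 / b\<^sup>2) + M powr (3 * b) * M\<^sup>2)"
  have "s powr t * (1 + (ln s)\<^sup>2) \<le> C" if s: "0 < s" "s \<le> M" "3 * b \<le> t" "t \<le> 3 * b + T" for s t
  proof -
    have 1: "s powr t \<le> M powr T * s powr (3 * b)" using s M T by (intro powr_le_mult_powr) auto
    have 2: "s powr (3 * b) \<le> M powr (3 * b)" using s b by (intro powr_mono2) auto
    have 3: "s powr (3 * b) * (ln s)\<^sup>2 \<le> M powr b * (1 / b\<^sup>2) + M powr (3 * b) * M\<^sup>2"
    proof (cases "s \<le> 1")
      case True
      have "ln (1 / s) \<le> ((1 / s) powr b) / b" using True s b by (intro ln_powr_bound) auto
      then have "\<bar>ln s\<bar> \<le> s powr (- b) / b"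
        using True s by (simp add: ln_div powr_divide powr_minus field_simps)
      then have "(ln s)\<^sup>2 \<le> (s powr (- b) / b)\<^sup>2" by (metis abs_ge_zero power2_abs power_mono)
      also have "\<dots> = s powr (- 2 * b) * (1 / b\<^sup>2)" by (simp add: power_divide power2_eq_square powr_add[symmetric])
      finally have "s powr (3 * b) * (ln s)\<^sup>2 \<le> s powr (3 * b) * (s powr (- 2 * b) * (1 / b\<^sup>2))" by (intro mult_left_mono) auto
      also have "\<dots> = s powr b * (1 / b\<^sup>2)" by (simp add: mult.assoc[symmetric] powr_add[symmetric])
      also have "\<dots> \<le> M powr b * (1 / b\<^sup>2)" using s b by (intro mult_right_mono powr_mono2) auto
      finally show ?thesis by (simp add: add_increasing2)
    next
      case False
      then have "0 \<le> ln s" "ln s \<le> M" using s ln_le_minus_one[of s] by auto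
      then have "(ln s)\<^sup>2 \<le> M\<^sup>2" by (intro power_mono)
      then have "s powr (3 * b) * (ln s)\<^sup>2 \<le> M powr (3 * b) * M\<^sup>2" using 2 by (intro mult_mono) auto
      then show ?thesis by (simp add: add_increasing)
    qed
    have "s powr t * (1 + (ln s)\<^sup>2) \<le> M powr T * s powr (3 * b) * (1 + (ln s)\<^sup>2)" using 1 by (intro mult_right_mono) auto
    also have "\<dots> = M powr T * s powr (3 * b) + M powr T * (s powr (3 * b) * (ln s)\<^sup>2)" by (simp add: algebra_simps)
    also have "\<dots> \<le> C" unfolding C_def using 2 3 by (intro add_mono mult_left_mono) auto
    finally show ?thesis .
  qed
  moreover have "C > 0" unfolding C_def using M b by (intro add_pos_nonneg mult_pos_pos) auto
  ultimately show ?thesis using that by blast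
qed

text \<open>With \<open>v = s\<^sup>2\<close> and \<open>g = max 0 (1 - \<epsilon>\<^sup>2 / v)\<close> this is \<open>g\<^sup>2 * s powr (- a)\<close>.\<close>
definition trunc_weight :: "real \<Rightarrow> real \<Rightarrow> real \<Rightarrow> real" where
  "trunc_weight a \<epsilon> v = (max 0 (v - \<epsilon>\<^sup>2))\<^sup>2 * v powr (- 2 - a / 2)"

definition trunc_weight' :: "real \<Rightarrow> real \<Rightarrow> real \<Rightarrow> real" where
  "trunc_weight' a \<epsilon> v = 2 * max 0 (v - \<epsilon>\<^sup>2) * v powr (- 2 - a / 2)
     + (max 0 (v - \<epsilon>\<^sup>2))\<^sup>2 * ((- 2 - a / 2) * v powr (- 3 - a / 2))"

lemma trunc_weight_zero: "v \<le> \<epsilon>\<^sup>2 \<Longrightarrow> trunc_weight a \<epsilon> v = 0" "v \<le> \<epsilon>\<^sup>2 \<Longrightarrow> trunc_weight' a \<epsilon> v = 0"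
  by (simp_all add: trunc_weight_def trunc_weight'_def)

lemma trunc_weight_deriv:
  assumes "0 < \<epsilon>" shows "(trunc_weight a \<epsilon> has_real_derivative trunc_weight' a \<epsilon> v) (at v)"
proof (cases "v < \<epsilon>\<^sup>2")
  case True
  have "((\<lambda>v. 0) has_real_derivative trunc_weight' a \<epsilon> v) (at v)" using True by (simp add: trunc_weight_zero)
  then show ?thesis
    by (rule has_field_derivative_transform_within_open[of _ _ _ "{..<\<epsilon>\<^sup>2}"]) (use True in \<open>simp_all add: trunc_weight_zero\<close>)
next
  case False
  then have v: "0 < v" using assms by (smt (verit) zero_less_power)
  have 1: "((\<lambda>v. (max 0 (v - \<epsilon>\<^sup>2))\<^sup>2) has_real_derivative 2 * max 0 (v - \<epsilon>\<^sup>2)) (at v)"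
  proof -
    have "((\<lambda>v. v - \<epsilon>\<^sup>2) has_real_derivative 1) (at v)" by (auto intro!: derivative_eq_intros)
    from DERIV_chain2[OF DERIV_max0_sq this] show ?thesis by simp
  qed
  have 2: "((\<lambda>v. v powr (- 2 - a / 2)) has_real_derivative (- 2 - a / 2) * v powr (- 3 - a / 2)) (at v)"
    using has_real_derivative_powr[OF v, of "- 2 - a / 2"] by (simp add: algebra_simps)
  show ?thesis unfolding trunc_weight_def[abs_def] trunc_weight'_def
    using DERIV_mult'[OF 1 2] by (simp add: algebra_simps)
qed

lemma trunc_weight'_continuous:
  assumes "0 < \<epsilon>" shows "continuous_on UNIV (trunc_weight' a \<epsilon>)"
proof -
  have "continuous_on {0<..} (trunc_weight' a \<epsilon>)" unfolding trunc_weight'_def[abs_def]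
    by (intro continuous_intros) auto
  moreover have "continuous_on {..<\<epsilon>\<^sup>2} (trunc_weight' a \<epsilon>)"
    by (rule continuous_on_eq[of _ "\<lambda>_. 0"]) (auto simp: trunc_weight_zero)
  ultimately have "continuous_on ({0<..} \<union> {..<\<epsilon>\<^sup>2}) (trunc_weight' a \<epsilon>)"
    by (intro continuous_on_open_Un) auto
  moreover have "{0<..} \<union> {..<\<epsilon>\<^sup>2} = UNIV" using assms by (auto simp: not_less) (smt (verit) zero_less_power)
  ultimately show ?thesis by simp
qed

text \<open>With \<theta> = g^2 s^(-a) as a function of s, the quantity 2 \<theta>' s^2 is s times
  its derivative in s, because \<theta>' is taken in v = s^2. As s times the derivative of g is 2 (1
  - g), this gives the nonnegative \<open>e\<close> of \<open>plap_form_coercive\<close>, bounded by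
  s^(-a) because 4 g (1 - g) \<le> 1.\<close>

lemma trunc_weight_formula:
  assumes s: "0 < \<epsilon>" "\<epsilon> \<le> s" and g: "g = 1 - (\<epsilon> / s)\<^sup>2"
  shows "trunc_weight a \<epsilon> (s\<^sup>2) = g\<^sup>2 * s powr (- a)"
    "2 * trunc_weight' a \<epsilon> (s\<^sup>2) * s\<^sup>2 = 4 * g * (1 - g) * s powr (- a) - a * trunc_weight a \<epsilon> (s\<^sup>2)"
    "0 \<le> g" "g \<le> 1"
proof -
  have s0: "0 < s" using s by simp
  have m: "max 0 (s\<^sup>2 - \<epsilon>\<^sup>2) = g * s\<^sup>2" using s s0 unfolding g by (simp add: max_def power_divide field_simps power_mono)
  have pw: "(s\<^sup>2) powr t = s powr (2 * t)" for t using s0 by (simp add: powr_powr flip: powr_numeral)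
  have s4: "s powr 4 = s\<^sup>2 * s\<^sup>2" using s0 by (simp add: power_add[symmetric])
  have s2: "s powr 2 = s\<^sup>2" using s0 by simp
  have p2: "(s\<^sup>2) powr (- 2 - a / 2) * (s\<^sup>2 * s\<^sup>2) = s powr (- a)"
    unfolding pw s4[symmetric] powr_add[symmetric] by (simp add: algebra_simps)
  have p3: "(s\<^sup>2) powr (- 3 - a / 2) * s\<^sup>2 = (s\<^sup>2) powr (- 2 - a / 2)"
  proof -
    have "(s\<^sup>2) powr (- 3 - a / 2) * s\<^sup>2 = s powr (2 * (- 3 - a / 2)) * s powr 2" by (simp only: pw s2)
    also have "\<dots> = s powr (2 * (- 2 - a / 2))" by (simp add: powr_add[symmetric] algebra_simps del: powr_numeral)
    finally show ?thesis by (simp only: pw)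
  qed
  have "trunc_weight a \<epsilon> (s\<^sup>2) = g\<^sup>2 * ((s\<^sup>2) powr (- 2 - a / 2) * (s\<^sup>2 * s\<^sup>2))"
    unfolding trunc_weight_def m by (simp add: power2_eq_square algebra_simps)
  then show 1: "trunc_weight a \<epsilon> (s\<^sup>2) = g\<^sup>2 * s powr (- a)" unfolding p2 .
  have "2 * trunc_weight' a \<epsilon> (s\<^sup>2) * s\<^sup>2 = 4 * g * ((s\<^sup>2) powr (- 2 - a / 2) * (s\<^sup>2 * s\<^sup>2))
     + g\<^sup>2 * (- 4 - a) * (((s\<^sup>2) powr (- 3 - a / 2) * s\<^sup>2) * (s\<^sup>2 * s\<^sup>2))"
    unfolding trunc_weight'_def m by (simp add: power2_eq_square algebra_simps)
  also have "\<dots> = 4 * g * s powr (- a) + g\<^sup>2 * (- 4 - a) * s powr (- a)" unfolding p3 p2 ..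
  finally show "2 * trunc_weight' a \<epsilon> (s\<^sup>2) * s\<^sup>2 = 4 * g * (1 - g) * s powr (- a) - a * trunc_weight a \<epsilon> (s\<^sup>2)"
    unfolding 1 by (simp add: power2_eq_square algebra_simps)
  show "g \<le> 1" unfolding g by simp
  have "\<epsilon> / s \<le> 1" "0 \<le> \<epsilon> / s" using s s0 by auto
  then have "(\<epsilon> / s)\<^sup>2 \<le> 1" by (simp add: power_le_one)
  then show "0 \<le> g" unfolding g by simp
qed

text \<open>Subtracting the equation tested with \<open>\<psi>\<close> from the one tested with a translate of \<open>\<psi>\<close>.\<close>
lemma shifted_equation:
  fixes F :: "'a::euclidean_space \<Rightarrow> 'a"
  assumes W: "open W" and S: "compact S" "S \<subseteq> W" and F: "continuous_on UNIV F"
    and H: "weakly_div_free W F"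
  obtains d where "0 < d" "\<And>y \<psi> D\<psi>. norm y < d \<Longrightarrow> C1c UNIV \<psi> D\<psi> \<Longrightarrow> \<forall>x. x \<notin> S \<longrightarrow> \<psi> x = 0 \<Longrightarrow>
     (\<integral>x. (F (x + y) - F x) \<bullet> D\<psi> x \<partial>lborel) = 0"
proof -
  obtain r L where L: "0 < r" "compact L" "L \<subseteq> W" "\<And>x y. x \<in> S \<Longrightarrow> dist x y \<le> r \<Longrightarrow> y \<in> L"
    using compact_neighbourhood[OF S(1) W S(2)] by metis
  show ?thesis
  proof (rule that[OF L(1)])
    fix y :: 'a and \<psi> D\<psi> assume y: "norm y < r" and \<psi>: "C1c UNIV \<psi> D\<psi>" and "\<forall>x. x \<notin> S \<longrightarrow> \<psi> x = 0"
    then have z: "\<And>x. x \<notin> S \<Longrightarrow> \<psi> x = 0" by blast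
    have "C1c W \<psi> D\<psi>" using \<psi> S z unfolding C1c_def csupp_def by blast
    then have 1: "(\<integral>x. F x \<bullet> D\<psi> x \<partial>lborel) = 0" by (rule weakly_div_freeD[OF H])
    have t: "C1c UNIV (\<lambda>x. \<psi> (x + - y)) (\<lambda>x. D\<psi> (x + - y))" by (rule C1c_translate[OF \<psi>])
    moreover have "\<psi> (x + - y) = 0" if "x \<notin> L" for x
      using L(4)[of "x + - y" x] that y z[of "x + - y"] by (auto simp: dist_norm)
    ultimately have "C1c W (\<lambda>x. \<psi> (x + - y)) (\<lambda>x. D\<psi> (x + - y))" using L unfolding C1c_def csupp_def by blast
    then have "(\<integral>x. F x \<bullet> D\<psi> (x + - y) \<partial>lborel) = 0" by (rule weakly_div_freeD[OF H])
    moreover have FD: "Cc UNIV (\<lambda>x. F x \<bullet> D\<psi> (x + - y))" using F C1c_Cc(2)[OF t] by (rule Cc_inner_left)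
    ultimately have 2: "(\<integral>x. F (x + y) \<bullet> D\<psi> x \<partial>lborel) = 0" using Cc_integral_translate[OF FD, of y] by simp
    have "integrable lborel (\<lambda>x. F x \<bullet> D\<psi> x)" by (rule Cc_integrable[OF Cc_inner_left[OF F C1c_Cc(2)[OF \<psi>]]])
    moreover have "integrable lborel (\<lambda>x. F (x + y) \<bullet> D\<psi> x)"
      by (rule Cc_integrable[OF Cc_inner_left[OF continuous_on_compose2[OF F] C1c_Cc(2)[OF \<psi>]]]) (auto intro!: continuous_intros)
    ultimately show "(\<integral>x. (F (x + y) - F x) \<bullet> D\<psi> x \<partial>lborel) = 0" using 1 2 by (simp add: inner_diff_left)
  qed
qed

subsection \<open>Difference quotients of a solution\<close>

text \<open>Here \<open>u\<close> and \<open>p\<close> are the given functions cut off outside a neighbourhood of the support of a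
  test function, so that all estimates hold on the whole space.\<close>
locale plap_setting =
  fixes u :: "'a::euclidean_space \<Rightarrow> real" and G :: "'a \<Rightarrow> 'a" and p :: "'a \<Rightarrow> real" and Dp :: "'a \<Rightarrow> 'a"
    and V :: "'a set" and \<beta> T B :: real
  assumes u: "C1c UNIV u G"
    and p: "\<And>x. GDERIV p x :> Dp x" "continuous_on UNIV Dp"
    and pb: "\<And>x. 1 + 2 * \<beta> \<le> p x" "\<And>x. p x \<le> 2 + T" "\<And>x. norm (Dp x) \<le> B"
    and \<beta>: "0 < \<beta>" "\<beta> \<le> 1 / 2" and T: "0 \<le> T" and V: "open V"
begin

definition flux :: "'a \<Rightarrow> 'a" where
  "flux x = norm (G x) powr (p x - 2) *\<^sub>R G x"

text \<open>Stands in for the gradient of \<open>u\<close>: it is uniformly close to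
  \<open>G\<close> but differentiable, and the gradient of its i-th component is
  \<open>hess h i\<close>.\<close>

definition quot :: "real \<Rightarrow> 'a \<Rightarrow> 'a" where
  "quot h x = (\<Sum>i\<in>Basis. ((u (x + h *\<^sub>R i) - u x) / h) *\<^sub>R i)"

definition hess :: "real \<Rightarrow> 'a \<Rightarrow> 'a \<Rightarrow> 'a" where
  "hess h i x = (1 / h) *\<^sub>R (G (x + h *\<^sub>R i) - G x)"

text \<open>Half the gradient of the squared norm of \<open>quot h\<close>.\<close>

definition hess_quot :: "real \<Rightarrow> 'a \<Rightarrow> 'a" where
  "hess_quot h x = (\<Sum>i\<in>Basis. (quot h x \<bullet> i) *\<^sub>R hess h i x)"

definition hess_sq :: "real \<Rightarrow> 'a \<Rightarrow> real" where
  "hess_sq h x = (\<Sum>i\<in>Basis. (norm (hess h i x))\<^sup>2)"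

text \<open>The gradient of \<phi>^2 \<theta>(|q|^2) q_i, with \<open>D\<close>,
  \<open>\<theta>\<close> and \<open>\<theta>'\<close> as plain values so that pointwise estimates
  need no functions; see \<open>test_C1c\<close>.\<close>

definition test_grad :: "real \<Rightarrow> 'a \<Rightarrow> 'a \<Rightarrow> real \<Rightarrow> 'a \<Rightarrow> real \<Rightarrow> real \<Rightarrow> 'a" where
  "test_grad h i x \<phi> D \<theta> \<theta>' = (2 * \<phi> * \<theta> * (quot h x \<bullet> i)) *\<^sub>R D
     + \<phi>\<^sup>2 *\<^sub>R (\<theta> *\<^sub>R hess h i x + (2 * \<theta>' * (quot h x \<bullet> i)) *\<^sub>R hess_quot h x)"

definition flux_quot :: "real \<Rightarrow> 'a \<Rightarrow> 'a \<Rightarrow> 'a" where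
  "flux_quot h i x = (1 / h) *\<^sub>R (flux (x + h *\<^sub>R i) - flux x)"

lemma p_cont: "continuous_on UNIV p"
  using GDERIV_continuous_on p(1) by blast

lemma G_cont: "continuous_on UNIV G" and u_cont: "continuous_on UNIV u"
  using C1c_Cc[OF u] CcD by auto

lemma norm_flux: "norm (flux x) = norm (G x) powr (p x - 1)"
proof (cases "G x = 0")
  case False
  have "norm (flux x) = norm (G x) * norm (G x) powr (p x - 2)" by (simp add: flux_def)
  then show ?thesis by (simp add: powr_mult_base)
qed (simp add: flux_def)

text \<open>Where \<open>G\<close> vanishes the factor |G|^(p-2) may be singular, but the norm of
  the flux is |G|^(p-1) with p - 1 \<ge> 2\<beta> > 0, which tends to zero.\<close>

lemma flux_cont: "continuous_on UNIV flux"
  unfolding continuous_on_eq_continuous_at[OF open_UNIV]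
proof
  fix x
  have Gx: "isCont G x" and px: "isCont p x" using G_cont p_cont continuous_on_eq_continuous_at[OF open_UNIV] by blast+
  show "isCont flux x"
  proof (cases "G x = 0")
    case True
    have "continuous_on UNIV (\<lambda>x. norm (G x) powr (p x - 1))"
      using pb(1) \<beta> by (intro continuous_on_powr' continuous_intros G_cont p_cont) (auto intro: less_le_trans[of _ "1 + 2 * \<beta>"])
    then have "isCont (\<lambda>x. norm (flux x)) x" unfolding norm_flux using continuous_on_eq_continuous_at[OF open_UNIV] by blast
    moreover have fx: "flux x = 0" using True by (simp add: flux_def)
    ultimately have "((\<lambda>x. norm (flux x)) \<longlongrightarrow> 0) (at x)" by (simp add: isCont_def)
    then show ?thesis by (simp add: isCont_def fx tendsto_norm_zero_iff)
  next
    case False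
    then show ?thesis unfolding flux_def[abs_def] using Gx px by (intro continuous_intros) auto
  qed
qed

lemma quot_inner: "i \<in> Basis \<Longrightarrow> quot h x \<bullet> i = (u (x + h *\<^sub>R i) - u x) / h"
  by (simp add: quot_def inner_sum_left inner_Basis if_distrib sum.delta' cong: if_cong)

lemma hess_cont: "continuous_on UNIV (hess h i)"
  unfolding hess_def[abs_def]
  by (intro continuous_intros G_cont continuous_on_compose2[OF G_cont]) auto

lemma quot_cont: "continuous_on UNIV (quot h)"
  unfolding quot_def[abs_def] divide_inverse
  by (intro continuous_intros u_cont continuous_on_compose2[OF u_cont]) auto

lemma hess_quot_cont: "continuous_on UNIV (hess_quot h)"
  unfolding hess_quot_def[abs_def] by (intro continuous_intros quot_cont hess_cont)

lemma hess_sq_cont: "continuous_on UNIV (hess_sq h)"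
  unfolding hess_sq_def[abs_def] by (intro continuous_intros hess_cont)

lemma hess_sq_nonneg: "0 \<le> hess_sq h x"
  unfolding hess_sq_def by (intro sum_nonneg) auto

lemma norm_hess_le: "i \<in> Basis \<Longrightarrow> norm (hess h i x) \<le> sqrt (hess_sq h x)"
  unfolding hess_sq_def by (intro real_le_rsqrt) (rule member_le_sum[where f = "\<lambda>i. (norm (hess h i x))\<^sup>2"], auto)

lemma norm_hess_quot_le: "norm (hess_quot h x) \<le> norm (quot h x) * sqrt (hess_sq h x)"
  unfolding hess_quot_def hess_sq_def by (rule norm_basis_combination_le)

lemma quot_GDERIV:
  assumes "i \<in> Basis" shows "GDERIV (\<lambda>x. quot h x \<bullet> i) x :> hess h i x"
proof -
  have "GDERIV (\<lambda>x. (1 / h) * (u (x + h *\<^sub>R i) - u x)) x :> (1 / h) *\<^sub>R (G (x + h *\<^sub>R i) - G x)"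
    using GDERIV_mult[OF GDERIV_const GDERIV_diff[OF C1c_GDERIV[OF C1c_translate[OF u]] C1c_GDERIV[OF u]], of "1 / h"] by simp
  then show ?thesis unfolding hess_def quot_inner[OF assms] by simp
qed

lemma quot_sq_GDERIV: "GDERIV (\<lambda>x. (norm (quot h x))\<^sup>2) x :> 2 *\<^sub>R hess_quot h x"
proof -
  have "(norm (quot h x))\<^sup>2 = (\<Sum>i\<in>Basis. (quot h x \<bullet> i) * (quot h x \<bullet> i))" for x
    unfolding power2_norm_eq_inner by (subst euclidean_inner) simp
  moreover have "GDERIV (\<lambda>x. \<Sum>i\<in>Basis. (quot h x \<bullet> i) * (quot h x \<bullet> i)) x :>
     (\<Sum>i\<in>Basis. (quot h x \<bullet> i) *\<^sub>R hess h i x + (quot h x \<bullet> i) *\<^sub>R hess h i x)"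
    by (intro GDERIV_sum GDERIV_mult quot_GDERIV)
  ultimately show ?thesis by (simp add: hess_quot_def scaleR_2 sum.distrib)
qed

lemma weight_GDERIV:
  assumes "\<And>v. (\<theta> has_real_derivative \<theta>' v) (at v)"
  shows "GDERIV (\<lambda>x. \<theta> ((norm (quot h x))\<^sup>2)) x :> (2 * \<theta>' ((norm (quot h x))\<^sup>2)) *\<^sub>R hess_quot h x"
  using GDERIV_DERIV_compose[OF quot_sq_GDERIV assms, of h x] by (simp add: mult.commute)

lemma test_C1c:
  assumes \<phi>: "C1c U \<phi> D" and \<theta>: "\<And>v. (\<theta> has_real_derivative \<theta>' v) (at v)" "continuous_on UNIV \<theta>'" and i: "i \<in> Basis"
  shows "C1c U (\<lambda>x. (\<phi> x)\<^sup>2 * \<theta> ((norm (quot h x))\<^sup>2) * (quot h x \<bullet> i))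
     (\<lambda>x. test_grad h i x (\<phi> x) (D x) (\<theta> ((norm (quot h x))\<^sup>2)) (\<theta>' ((norm (quot h x))\<^sup>2)))"
proof -
  have tc: "continuous_on UNIV \<theta>" using \<theta>(1) by (meson DERIV_continuous_on)
  have c: "continuous_on UNIV (\<lambda>x. \<theta> ((norm (quot h x))\<^sup>2))" "continuous_on UNIV (\<lambda>x. \<theta>' ((norm (quot h x))\<^sup>2))"
    by (intro continuous_on_compose2[OF tc] continuous_on_compose2[OF \<theta>(2)] continuous_intros quot_cont; simp)+
  have ch: "continuous_on UNIV (\<lambda>x. (2 * \<theta>' ((norm (quot h x))\<^sup>2)) *\<^sub>R hess_quot h x)"
    by (intro continuous_intros c hess_quot_cont)
  have D: "\<And>x. GDERIV \<phi> x :> D x" "continuous_on UNIV D" using \<phi> unfolding C1c_def by auto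
  have "C1c U (\<lambda>x. \<phi> x * \<phi> x * \<theta> ((norm (quot h x))\<^sup>2) * (quot h x \<bullet> i))
    (\<lambda>x. (\<phi> x * \<phi> x * \<theta> ((norm (quot h x))\<^sup>2)) *\<^sub>R hess h i x + (quot h x \<bullet> i) *\<^sub>R
      ((\<phi> x * \<phi> x) *\<^sub>R ((2 * \<theta>' ((norm (quot h x))\<^sup>2)) *\<^sub>R hess_quot h x) + \<theta> ((norm (quot h x))\<^sup>2) *\<^sub>R (\<phi> x *\<^sub>R D x + \<phi> x *\<^sub>R D x)))"
    by (intro C1c_mult \<phi> D ch quot_GDERIV i hess_cont weight_GDERIV \<theta>)
  moreover have "(\<lambda>x. (\<phi> x * \<phi> x * \<theta> ((norm (quot h x))\<^sup>2)) *\<^sub>R hess h i x + (quot h x \<bullet> i) *\<^sub>R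
      ((\<phi> x * \<phi> x) *\<^sub>R ((2 * \<theta>' ((norm (quot h x))\<^sup>2)) *\<^sub>R hess_quot h x) + \<theta> ((norm (quot h x))\<^sup>2) *\<^sub>R (\<phi> x *\<^sub>R D x + \<phi> x *\<^sub>R D x)))
    = (\<lambda>x. test_grad h i x (\<phi> x) (D x) (\<theta> ((norm (quot h x))\<^sup>2)) (\<theta>' ((norm (quot h x))\<^sup>2)))"
    unfolding test_grad_def by (intro ext) (simp add: algebra_simps power2_eq_square scaleR_2[symmetric])
  ultimately show ?thesis by (simp add: power2_eq_square)
qed

lemma quot_near:
  assumes "0 < e" obtains d where "0 < d" "\<And>h x. 0 < h \<Longrightarrow> h < d \<Longrightarrow> norm (quot h x - G x) \<le> e"
proof -
  have e': "0 < e / DIM('a)" using assms by simp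
  obtain d where d: "0 < d" "\<And>x b h. b \<in> Basis \<Longrightarrow> 0 < h \<Longrightarrow> h < d \<Longrightarrow> \<bar>(u (x + h *\<^sub>R b) - u x) / h - G x \<bullet> b\<bar> \<le> e / DIM('a)"
    using C1c_difference_quotient[OF u e'] by metis
  show ?thesis
  proof (rule that[OF d(1)])
    fix h x assume h: "0 < h" "h < d"
    have "norm (quot h x - G x) \<le> (\<Sum>b\<in>Basis. \<bar>(quot h x - G x) \<bullet> b\<bar>)" by (rule norm_le_l1)
    also have "\<dots> \<le> (\<Sum>b\<in>(Basis::'a set). e / DIM('a))"
      using d(2)[OF _ h] by (intro sum_mono) (simp add: inner_diff_left quot_inner)
    finally show "norm (quot h x - G x) \<le> e" by simp
  qed
qed

text \<open>The base point of the linearisation is \<open>quot h x\<close>, not \<open>G x\<close>,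
  so that the coefficients of the linearised flux contain the same vector as the test function;
  \<open>plap_form_coercive\<close> depends on this match.\<close>

lemma flux_linearization:
  assumes K: "compact K" and m: "0 < m" and e: "0 < e"
  obtains d where "0 < d" "\<And>h x i. 0 < h \<Longrightarrow> h < d \<Longrightarrow> x \<in> K \<Longrightarrow> i \<in> Basis \<Longrightarrow> m \<le> norm (quot h x) \<Longrightarrow> norm (quot h x) \<le> M \<Longrightarrow>
    norm (flux_quot h i x - norm (quot h x) powr (p x - 2) *\<^sub>R plap_linear (p x - 2) (Dp x) (quot h x) i (hess h i x))
      \<le> e * (1 + norm (hess h i x))"
proof -
  obtain d where d: "0 < d" "\<And>x z x1 z1 x2 z2. x \<in> K \<Longrightarrow> m \<le> norm z \<Longrightarrow> norm z \<le> M \<Longrightarrow>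
     norm (x1 - x) < d \<Longrightarrow> norm (z1 - z) < d \<Longrightarrow> norm (x2 - x) < d \<Longrightarrow> norm (z2 - z) < d \<Longrightarrow>
     norm (norm z2 powr (p x2 - 2) *\<^sub>R z2 - norm z1 powr (p x1 - 2) *\<^sub>R z1
        - norm z powr (p x - 2) *\<^sub>R plap_linear (p x - 2) (Dp x) z (x2 - x1) (z2 - z1))
     \<le> e * (norm (x2 - x1) + norm (z2 - z1))"
    by (rule plap_flux_linearization[OF p K m e, of M]) (rule that; assumption)
  have d2: "0 < d / 2" using d(1) by simp
  obtain d1 where d1: "0 < d1" "\<And>h x. 0 < h \<Longrightarrow> h < d1 \<Longrightarrow> norm (quot h x - G x) \<le> d / 4"
    using quot_near[of "d / 4"] d(1) by auto
  obtain d3 where d3: "d3 > 0" "\<And>x y. dist x y < d3 \<Longrightarrow> dist (G x) (G y) < d / 2"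
    using Cc_uniformly_continuous[OF C1c_Cc(2)[OF u]] d2 unfolding uniformly_continuous_on_def by (metis UNIV_I)
  show ?thesis
  proof (rule that[of "min (min d d1) d3"])
    fix h :: real and x i :: 'a
    assume h: "0 < h" "h < min (min d d1) d3" and x: "x \<in> K" and i: "i \<in> Basis" and qm: "m \<le> norm (quot h x)" "norm (quot h x) \<le> M"
    have ni: "norm (h *\<^sub>R i) = h" using h i by simp
    have g1: "norm (G x - quot h x) \<le> d / 4" using d1(2)[of h x] h by (simp add: norm_minus_commute)
    have g2: "norm (G (x + h *\<^sub>R i) - G x) < d / 2" using d3(2)[of "x + h *\<^sub>R i" x] ni h by (simp add: dist_norm)
    have "norm (G (x + h *\<^sub>R i) - quot h x) \<le> norm (G (x + h *\<^sub>R i) - G x) + norm (G x - quot h x)"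
      using norm_triangle_ineq[of "G (x + h *\<^sub>R i) - G x" "G x - quot h x"] by simp
    then have g3: "norm (G (x + h *\<^sub>R i) - quot h x) < d" using g1 g2 d(1) by linarith
    have hN: "G (x + h *\<^sub>R i) - G x = h *\<^sub>R hess h i x" using h by (simp add: hess_def)
    have hom: "plap_linear c P z (h *\<^sub>R \<xi>) (h *\<^sub>R w) = h *\<^sub>R plap_linear c P z \<xi> w" for c P z \<xi> w
      unfolding plap_linear_def by (simp add: algebra_simps add_divide_distrib)
    have *: "norm (flux (x + h *\<^sub>R i) - flux x
        - norm (quot h x) powr (p x - 2) *\<^sub>R plap_linear (p x - 2) (Dp x) (quot h x) ((x + h *\<^sub>R i) - x) (G (x + h *\<^sub>R i) - G x))
      \<le> e * (norm ((x + h *\<^sub>R i) - x) + norm (G (x + h *\<^sub>R i) - G x))"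
      unfolding flux_def by (rule d(2)[OF x qm]) (use d(1) g1 g3 ni h in auto)
    define v where "v = flux (x + h *\<^sub>R i) - flux x
        - h *\<^sub>R (norm (quot h x) powr (p x - 2) *\<^sub>R plap_linear (p x - 2) (Dp x) (quot h x) i (hess h i x))"
    have "norm v \<le> e * (h + h * norm (hess h i x))"
      using * unfolding v_def hN add_diff_cancel_left' hom using h i by (simp add: scaleR_left_commute mult.commute)
    then have v: "norm v \<le> h * (e * (1 + norm (hess h i x)))" by (simp add: algebra_simps)
    have "flux_quot h i x - norm (quot h x) powr (p x - 2) *\<^sub>R plap_linear (p x - 2) (Dp x) (quot h x) i (hess h i x)
      = (1 / h) *\<^sub>R v"
      using h unfolding flux_quot_def v_def by (simp add: scaleR_diff_right)
    then show "norm (flux_quot h i x - norm (quot h x) powr (p x - 2) *\<^sub>R plap_linear (p x - 2) (Dp x) (quot h x) i (hess h i x))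
      \<le> e * (1 + norm (hess h i x))"
      using v h by (simp add: pos_divide_le_eq mult.commute)
  qed (use d(1) d1(1) d3(1) in simp)
qed

lemma flux_quot_cont: "continuous_on UNIV (flux_quot h i)"
  unfolding flux_quot_def[abs_def]
  by (intro continuous_intros flux_cont continuous_on_compose2[OF flux_cont]) auto

text \<open>Coercivity of the linearised form, minus the linearisation error paired with the test
  gradient. That error is quadratic in the second differences and has to be absorbed
  elsewhere.\<close>

lemma pointwise_lower:
  assumes q: "quot h x \<noteq> 0" and a: "0 \<le> a" "a \<le> 1 - \<beta>" and \<theta>: "0 \<le> \<theta>" "0 \<le> e"
    and \<theta>': "2 * \<theta>' * (norm (quot h x))\<^sup>2 = e - a * \<theta>"
    and R: "1 \<le> R" "\<bar>\<phi>\<bar> \<le> R" "norm D \<le> R" "B \<le> R" "2 + T \<le> R"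
    and lin: "\<And>i. i \<in> Basis \<Longrightarrow>
      norm (flux_quot h i x - norm (quot h x) powr (p x - 2) *\<^sub>R plap_linear (p x - 2) (Dp x) (quot h x) i (hess h i x))
      \<le> \<delta> * (1 + norm (hess h i x))"
  shows "norm (quot h x) powr (p x - 2) * (\<beta>\<^sup>2 * \<phi>\<^sup>2 * \<theta> * hess_sq h x
       - 5 * R ^ 4 / \<beta>\<^sup>2 * (norm (quot h x))\<^sup>2 * (1 + (ln (norm (quot h x)))\<^sup>2) * (\<theta> + e))
     - (\<Sum>i\<in>Basis. \<delta> * (1 + norm (hess h i x)) * norm (test_grad h i x \<phi> D \<theta> \<theta>'))
     \<le> (\<Sum>i\<in>Basis. flux_quot h i x \<bullet> test_grad h i x \<phi> D \<theta> \<theta>')"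
proof -
  let ?s = "norm (quot h x)" and ?L = "\<lambda>i. plap_linear (p x - 2) (Dp x) (quot h x) i (hess h i x)"
    and ?t = "\<lambda>i. test_grad h i x \<phi> D \<theta> \<theta>'"
  have c: "2 * \<beta> - 1 \<le> p x - 2" "1 + \<bar>p x - 2\<bar> \<le> R" using pb(1,2)[of x] \<beta> T R(5) by auto
  have P: "norm (Dp x) \<le> R" using pb(3)[of x] R(4) by linarith
  have "\<beta>\<^sup>2 * \<phi>\<^sup>2 * \<theta> * hess_sq h x - 5 * R ^ 4 / \<beta>\<^sup>2 * ?s\<^sup>2 * (1 + (ln ?s)\<^sup>2) * (\<theta> + e) \<le> (\<Sum>i\<in>Basis. ?L i \<bullet> ?t i)"
    unfolding hess_sq_def test_grad_def hess_quot_def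
    by (rule plap_form_coercive[OF \<beta> c(1) q a \<theta> \<theta>' R(1-3) P c(2)])
  then have "?s powr (p x - 2) * (\<beta>\<^sup>2 * \<phi>\<^sup>2 * \<theta> * hess_sq h x - 5 * R ^ 4 / \<beta>\<^sup>2 * ?s\<^sup>2 * (1 + (ln ?s)\<^sup>2) * (\<theta> + e))
    \<le> ?s powr (p x - 2) * (\<Sum>i\<in>Basis. ?L i \<bullet> ?t i)" by (intro mult_left_mono) auto
  also have "\<dots> = (\<Sum>i\<in>Basis. (?s powr (p x - 2) *\<^sub>R ?L i) \<bullet> ?t i)" by (simp add: sum_distrib_left)
  also have "\<dots> \<le> (\<Sum>i\<in>Basis. flux_quot h i x \<bullet> ?t i + \<delta> * (1 + norm (hess h i x)) * norm (?t i))"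
  proof (rule sum_mono)
    fix i :: 'a assume i: "i \<in> Basis"
    have "\<bar>(flux_quot h i x - ?s powr (p x - 2) *\<^sub>R ?L i) \<bullet> ?t i\<bar> \<le> \<delta> * (1 + norm (hess h i x)) * norm (?t i)"
      by (rule order_trans[OF Cauchy_Schwarz_ineq2 mult_right_mono[OF lin[OF i] norm_ge_zero]])
    then show "(?s powr (p x - 2) *\<^sub>R ?L i) \<bullet> ?t i \<le> flux_quot h i x \<bullet> ?t i + \<delta> * (1 + norm (hess h i x)) * norm (?t i)"
      unfolding inner_diff_left abs_le_iff by linarith
  qed
  finally show ?thesis by (simp add: sum.distrib)
qed

lemma norm_test_grad_le:
  assumes "i \<in> Basis"
  shows "norm (test_grad h i x \<phi> D \<theta> \<theta>') \<le> 2 * \<bar>\<phi>\<bar> * \<bar>\<theta>\<bar> * norm (quot h x) * norm D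
    + \<phi>\<^sup>2 * (\<bar>\<theta>\<bar> * norm (hess h i x) + \<bar>2 * \<theta>' * (norm (quot h x))\<^sup>2\<bar> * sqrt (hess_sq h x))"
proof -
  let ?q = "quot h x"
  have qi: "\<bar>?q \<bullet> i\<bar> \<le> norm ?q" by (rule Basis_le_norm[OF assms])
  have "\<bar>2 * \<theta>' * (?q \<bullet> i)\<bar> * norm (hess_quot h x) \<le> (\<bar>2 * \<theta>'\<bar> * norm ?q) * (norm ?q * sqrt (hess_sq h x))"
    using qi norm_hess_quot_le[of h x] by (intro mult_mono) (auto simp: abs_mult intro!: mult_left_mono)
  then have 1: "norm ((2 * \<theta>' * (?q \<bullet> i)) *\<^sub>R hess_quot h x) \<le> \<bar>2 * \<theta>' * (norm ?q)\<^sup>2\<bar> * sqrt (hess_sq h x)"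
    by (simp add: abs_mult power2_eq_square mult_ac)
  have 2: "norm ((2 * \<phi> * \<theta> * (?q \<bullet> i)) *\<^sub>R D) \<le> 2 * \<bar>\<phi>\<bar> * \<bar>\<theta>\<bar> * norm ?q * norm D"
    using qi by (auto simp: abs_mult intro!: mult_right_mono mult_left_mono)
  have "norm (\<phi>\<^sup>2 *\<^sub>R (\<theta> *\<^sub>R hess h i x + (2 * \<theta>' * (?q \<bullet> i)) *\<^sub>R hess_quot h x))
    \<le> \<phi>\<^sup>2 * (\<bar>\<theta>\<bar> * norm (hess h i x) + \<bar>2 * \<theta>' * (norm ?q)\<^sup>2\<bar> * sqrt (hess_sq h x))"
    using norm_triangle_ineq[of "\<theta> *\<^sub>R hess h i x" "(2 * \<theta>' * (?q \<bullet> i)) *\<^sub>R hess_quot h x"] 1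
    unfolding norm_scaleR[of "\<phi>\<^sup>2"] by (intro mult_mono) auto
  then show ?thesis unfolding test_grad_def using 2 by (intro norm_triangle_le add_mono)
qed

lemma nonzero_set_open: "open (V \<inter> {x. G x \<noteq> 0})"
  using V by (intro open_Int open_Collect_neq continuous_intros G_cont)

lemma flux_quot_equation:
  assumes H: "weakly_div_free (V \<inter> {x. G x \<noteq> 0}) flux"
    and S: "compact S" "S \<subseteq> V \<inter> {x. G x \<noteq> 0}"
  obtains d where "0 < d" "\<And>h i \<psi> D\<psi>. 0 < h \<Longrightarrow> h < d \<Longrightarrow> i \<in> Basis \<Longrightarrow> C1c UNIV \<psi> D\<psi> \<Longrightarrow> \<forall>x. x \<notin> S \<longrightarrow> \<psi> x = 0 \<Longrightarrow>
     (\<integral>x. flux_quot h i x \<bullet> D\<psi> x \<partial>lborel) = 0"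
proof -
  obtain d where d: "0 < d" "\<And>y \<psi> D\<psi>. norm y < d \<Longrightarrow> C1c UNIV \<psi> D\<psi> \<Longrightarrow> \<forall>x. x \<notin> S \<longrightarrow> \<psi> x = 0 \<Longrightarrow>
     (\<integral>x. (flux (x + y) - flux x) \<bullet> D\<psi> x \<partial>lborel) = 0"
    by (rule shifted_equation[OF nonzero_set_open S flux_cont H]) (rule that; assumption)
  show ?thesis
  proof (rule that[OF d(1)])
    fix h :: real and i :: 'a and \<psi> D\<psi>
    assume *: "0 < h" "h < d" "i \<in> Basis" "C1c UNIV \<psi> D\<psi>" "\<forall>x. x \<notin> S \<longrightarrow> \<psi> x = 0"
    have "(\<integral>x. (flux (x + h *\<^sub>R i) - flux x) \<bullet> D\<psi> x \<partial>lborel) = 0"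
      by (rule d(2)) (use * in auto)
    then show "(\<integral>x. flux_quot h i x \<bullet> D\<psi> x \<partial>lborel) = 0" by (simp add: flux_quot_def)
  qed
qed

text \<open>The support condition is imposed for each h separately because the set where the weight
  vanishes moves with h, whereas \<open>S\<close>, and with it \<open>d\<close>, is fixed.\<close>

lemma tested_equation:
  assumes H: "weakly_div_free (V \<inter> {x. G x \<noteq> 0}) flux"
    and S: "compact S" "S \<subseteq> V \<inter> {x. G x \<noteq> 0}"
    and \<phi>: "C1c UNIV \<phi> D" and \<theta>: "\<And>v. (\<theta> has_real_derivative \<theta>' v) (at v)" "continuous_on UNIV \<theta>'"
  obtains d where "0 < d" "\<And>h. 0 < h \<Longrightarrow> h < d \<Longrightarrow> \<forall>x. x \<notin> S \<longrightarrow> \<phi> x = 0 \<or> \<theta> ((norm (quot h x))\<^sup>2) = 0 \<Longrightarrow>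
    (\<integral>x. (\<Sum>i\<in>Basis. flux_quot h i x \<bullet> test_grad h i x (\<phi> x) (D x) (\<theta> ((norm (quot h x))\<^sup>2)) (\<theta>' ((norm (quot h x))\<^sup>2))) \<partial>lborel) = 0
    \<and> Cc UNIV (\<lambda>x. \<Sum>i\<in>Basis. flux_quot h i x \<bullet> test_grad h i x (\<phi> x) (D x) (\<theta> ((norm (quot h x))\<^sup>2)) (\<theta>' ((norm (quot h x))\<^sup>2)))"
proof -
  obtain d where d: "0 < d" "\<And>h i \<psi> D\<psi>. 0 < h \<Longrightarrow> h < d \<Longrightarrow> i \<in> Basis \<Longrightarrow> C1c UNIV \<psi> D\<psi> \<Longrightarrow> \<forall>x. x \<notin> S \<longrightarrow> \<psi> x = 0 \<Longrightarrow>
     (\<integral>x. flux_quot h i x \<bullet> D\<psi> x \<partial>lborel) = 0"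
    by (rule flux_quot_equation[OF H S]) (rule that; assumption)
  show ?thesis
  proof (rule that[OF d(1)])
    fix h :: real assume h: "0 < h" "h < d" and z: "\<forall>x. x \<notin> S \<longrightarrow> \<phi> x = 0 \<or> \<theta> ((norm (quot h x))\<^sup>2) = 0"
    let ?t = "\<lambda>i x. test_grad h i x (\<phi> x) (D x) (\<theta> ((norm (quot h x))\<^sup>2)) (\<theta>' ((norm (quot h x))\<^sup>2))"
    note tC = test_C1c[OF \<phi> \<theta>]
    have c: "Cc UNIV (\<lambda>x. flux_quot h i x \<bullet> ?t i x)" if "i \<in> Basis" for i
      by (rule Cc_inner_left[OF flux_quot_cont C1c_Cc(2)[OF tC[OF that]]])
    have "(\<integral>x. (\<Sum>i\<in>Basis. flux_quot h i x \<bullet> ?t i x) \<partial>lborel) = (\<Sum>i\<in>Basis. (\<integral>x. flux_quot h i x \<bullet> ?t i x \<partial>lborel))"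
      by (rule Bochner_Integration.integral_sum) (rule Cc_integrable[OF c])
    also have "\<dots> = 0"
    proof (rule sum.neutral, rule ballI)
      fix i :: 'a assume i: "i \<in> Basis"
      show "(\<integral>x. flux_quot h i x \<bullet> ?t i x \<partial>lborel) = 0"
        by (rule d(2)[OF h i tC[OF i]]) (use z in auto)
    qed
    finally show "(\<integral>x. (\<Sum>i\<in>Basis. flux_quot h i x \<bullet> ?t i x) \<partial>lborel) = 0 \<and> Cc UNIV (\<lambda>x. \<Sum>i\<in>Basis. flux_quot h i x \<bullet> ?t i x)"
      using c by (auto intro: Cc_sum)
  qed
qed

section \<open>Integral bounds for the second differences and removal of the critical set\<close>

lemma test_grad_zero: "\<phi> = 0 \<Longrightarrow> test_grad h i x \<phi> D \<theta> \<theta>' = 0" "\<theta> = 0 \<Longrightarrow> \<theta>' = 0 \<Longrightarrow> test_grad h i x \<phi> D \<theta> \<theta>' = 0"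
  by (simp_all add: test_grad_def)

text \<open>Interior second order estimate away from the critical set, with the trivial weight
  \<theta> = 1. Its constant depends on the distance to that set, which is harmless: it only serves
  to make the linearisation error negligible in \<open>flux_estimate\<close>.\<close>

lemma hess_local_bound:
  assumes H: "weakly_div_free (V \<inter> {x. G x \<noteq> 0}) flux"
    and \<eta>: "Cc (V \<inter> {x. G x \<noteq> 0}) \<eta>"
  obtains C d where "0 \<le> C" "0 < d" "\<And>h. 0 < h \<Longrightarrow> h < d \<Longrightarrow> (\<integral>x. \<bar>\<eta> x\<bar> * hess_sq h x \<partial>lborel) \<le> C"
proof -
  let ?W = "V \<inter> {x. G x \<noteq> 0}"
  note W = nonzero_set_open
  obtain K where K: "compact K" "K \<subseteq> ?W" "\<And>x. x \<notin> K \<Longrightarrow> \<eta> x = 0" using \<eta> unfolding Cc_def csupp_def by blast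
  obtain z V1 where z: "test_fun ?W z" "K \<subseteq> V1" "\<And>x. x \<in> V1 \<Longrightarrow> z x = 1" "\<And>x. 0 \<le> z x" "\<And>x. z x \<le> 1"
    by (rule smooth_cutoff[OF K(1) W K(2)]) (rule that; assumption)
  note zC = test_fun_C1c[OF z(1)]
  obtain L where L: "compact L" "L \<subseteq> ?W" "\<And>x. x \<notin> L \<Longrightarrow> z x = 0"
    using C1c_Cc(1)[OF zC] unfolding Cc_def csupp_def by blast
  obtain z2 :: "'a \<Rightarrow> real" where z2: "Cc ?W z2" "\<And>x. 0 \<le> z2 x" "\<And>x. x \<in> L \<Longrightarrow> z2 x = 1"
    using smooth_cutoff_Cc[OF L(1) W L(2)] by blast
  obtain m where m: "0 < m" "\<And>x. x \<in> L \<Longrightarrow> m \<le> norm (G x)"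
    using compact_bounded_below[OF L(1) G_cont] L(2) by blast
  obtain MG where MG: "0 < MG" "\<And>x. norm (G x) \<le> MG" using Cc_bounded[OF C1c_Cc(2)[OF u]] by metis
  obtain Bz where Bz: "0 < Bz" "\<And>x. norm (grad z x) \<le> Bz" using Cc_bounded[OF C1c_Cc(2)[OF zC]] by metis
  define R where "R = 2 + T + Bz + \<bar>B\<bar>"
  have R: "1 \<le> R" "norm (grad z x) \<le> R" "B \<le> R" "2 + T \<le> R" for x
    using T Bz(1) Bz(2)[of x] by (auto simp: R_def)
  define M where "M = MG + m"
  define \<Lambda> where "\<Lambda> = \<bar>ln (m / 2)\<bar> + \<bar>ln M\<bar>"
  define c0 where "c0 = exp (- ((1 + T) * \<Lambda>))"
  define c1 where "c1 = exp ((1 + T) * \<Lambda>)"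
  define C2 where "C2 = c1 * (5 * R ^ 4 / \<beta>\<^sup>2 * (M\<^sup>2 * (1 + \<Lambda>\<^sup>2)))"
  define R1 where "R1 = 2 * M * R"
  define k where "k = c0 * \<beta>\<^sup>2"
  \<comment> \<open>Chosen so that the quadratic part of the error, with factor 2 + R1, takes
    exactly half of the coercive term k.\<close>
  define \<delta> where "\<delta> = k / (2 * (2 + R1))"
  have M: "0 < M" using MG m by (simp add: M_def)
  have R1: "0 \<le> R1" using M R by (simp add: R1_def)
  have k: "0 < k" using \<beta> by (simp add: k_def c0_def)
  have \<delta>: "0 < \<delta>" "\<delta> * (2 + R1) = k / 2" using k R1 by (auto simp: \<delta>_def field_simps)
  have C2: "0 \<le> C2" using R M by (simp add: C2_def c1_def)
  define C3 where "C3 = C2 + DIM('a) * \<delta> * (1 + 2 * R1)"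
  have C3: "0 \<le> C3" using C2 \<delta>(1) R1 by (simp add: C3_def)
  obtain d1 where d1: "0 < d1" "\<And>h x. 0 < h \<Longrightarrow> h < d1 \<Longrightarrow> norm (quot h x - G x) \<le> m / 2"
    using quot_near[of "m / 2"] m(1) by auto
  have m2: "0 < m / 2" using m(1) by simp
  obtain d2 where d2: "0 < d2" "\<And>h x i. 0 < h \<Longrightarrow> h < d2 \<Longrightarrow> x \<in> L \<Longrightarrow> i \<in> Basis \<Longrightarrow> m / 2 \<le> norm (quot h x) \<Longrightarrow> norm (quot h x) \<le> M \<Longrightarrow>
    norm (flux_quot h i x - norm (quot h x) powr (p x - 2) *\<^sub>R plap_linear (p x - 2) (Dp x) (quot h x) i (hess h i x))
      \<le> \<delta> * (1 + norm (hess h i x))"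
    by (rule flux_linearization[OF L(1) m2 \<delta>(1), of M]) (rule that; assumption)
  have one: "((\<lambda>_::real. 1::real) has_real_derivative 0) (at v)" for v by simp
  have onec: "continuous_on UNIV (\<lambda>_::real. 0::real)" by simp
  obtain d3 where d3: "0 < d3" "\<And>h. 0 < h \<Longrightarrow> h < d3 \<Longrightarrow> \<forall>x. x \<notin> L \<longrightarrow> z x = 0 \<or> (1::real) = 0 \<Longrightarrow>
    (\<integral>x. (\<Sum>i\<in>Basis. flux_quot h i x \<bullet> test_grad h i x (z x) (grad z x) 1 0) \<partial>lborel) = 0
    \<and> Cc UNIV (\<lambda>x. \<Sum>i\<in>Basis. flux_quot h i x \<bullet> test_grad h i x (z x) (grad z x) 1 0)"
    by (rule tested_equation[OF H L(1,2) C1c_mono[OF zC subset_UNIV] one onec]) (rule that; assumption)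
  obtain B\<eta> where B\<eta>: "0 < B\<eta>" "\<And>x. \<bar>\<eta> x\<bar> \<le> B\<eta> * (z x)\<^sup>2"
  proof (rule Cc_dominated[OF \<eta>, of "\<lambda>x. (z x)\<^sup>2"])
    show "(z x)\<^sup>2 = 1" if "\<eta> x \<noteq> 0" for x using that K(3) z(2,3) by fastforce
  qed auto
  show ?thesis
  proof (rule that[of "B\<eta> * (2 / k * (C3 * integral\<^sup>L lborel z2))" "min (min d1 d2) d3"])
    have "0 \<le> integral\<^sup>L lborel z2" using z2(2) by simp
    then show "0 \<le> B\<eta> * (2 / k * (C3 * integral\<^sup>L lborel z2))" using B\<eta>(1) k C3 by simp
    show "0 < min (min d1 d2) d3" using d1 d2 d3 by simp
    fix h :: real assume h: "0 < h" "h < min (min d1 d2) d3"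
    let ?E = "\<lambda>x. \<Sum>i\<in>Basis. flux_quot h i x \<bullet> test_grad h i x (z x) (grad z x) 1 0"
    have E: "integral\<^sup>L lborel ?E = 0" "Cc UNIV ?E" using d3(2)[of h] h L(3) by auto
    have pw: "k / 2 * ((z x)\<^sup>2 * hess_sq h x) \<le> ?E x + C3 * z2 x" for x
    proof (cases "z x = 0")
      case True
      then show ?thesis using C3 z2(2)[of x] by (simp add: test_grad_zero)
    next
      case False
      then have x: "x \<in> L" using L(3) by blast
      have qG: "norm (quot h x - G x) \<le> m / 2" using d1(2) h by auto
      have s: "m / 2 \<le> norm (quot h x)" "norm (quot h x) \<le> M"
        using norm_triangle_ineq2[of "G x" "quot h x"] norm_triangle_ineq2[of "quot h x" "G x"] qG m(2)[OF x] MG(2)[of x] m(1)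
        by (auto simp: M_def norm_minus_commute)
      have q0: "quot h x \<noteq> 0" using s(1) m(1) by auto
      \<comment> \<open>The instance a = 0, e = 0, \<theta> = 1, \<theta>' = 0 of
        \<open>pointwise_lower\<close>.\<close>
      have a1: "(0::real) \<le> 0" "0 \<le> 1 - \<beta>" "0 \<le> (1::real)" "2 * 0 * (norm (quot h x))\<^sup>2 = 0 - 0 * (1::real)" using \<beta> by auto
      have zR: "\<bar>z x\<bar> \<le> R" using z(4,5)[of x] R(1) by simp
      have low: "norm (quot h x) powr (p x - 2) * (\<beta>\<^sup>2 * (z x)\<^sup>2 * 1 * hess_sq h x
         - 5 * R ^ 4 / \<beta>\<^sup>2 * (norm (quot h x))\<^sup>2 * (1 + (ln (norm (quot h x)))\<^sup>2) * (1 + 0))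
         - (\<Sum>i\<in>Basis. \<delta> * (1 + norm (hess h i x)) * norm (test_grad h i x (z x) (grad z x) 1 0)) \<le> ?E x"
        by (rule pointwise_lower[OF q0 a1(1,2,3,1,4) R(1) zR R(2,3,4)])
          (use d2(2)[OF _ _ x _ s] h in auto)
      have pT: "\<bar>p x - 2\<bar> \<le> 1 + T" using pb(1,2)[of x] \<beta> T by auto
      have pw1: "c0 \<le> norm (quot h x) powr (p x - 2)" "norm (quot h x) powr (p x - 2) \<le> c1"
        unfolding c0_def c1_def \<Lambda>_def using powr_two_sided[OF m2 s pT] by auto
      have "k * ((z x)\<^sup>2 * hess_sq h x) \<le> norm (quot h x) powr (p x - 2) * (\<beta>\<^sup>2 * (z x)\<^sup>2 * 1 * hess_sq h x)"
        using mult_right_mono[OF pw1(1), of "\<beta>\<^sup>2 * (z x)\<^sup>2 * hess_sq h x"] hess_sq_nonneg[of h x]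
        by (simp add: k_def mult.assoc)
      moreover have "norm (quot h x) powr (p x - 2) * (5 * R ^ 4 / \<beta>\<^sup>2 * (norm (quot h x))\<^sup>2 * (1 + (ln (norm (quot h x)))\<^sup>2) * (1 + 0)) \<le> C2"
      proof -
        have s0: "0 < norm (quot h x)" using q0 by simp
        have "ln (m / 2) \<le> ln (norm (quot h x))" "ln (norm (quot h x)) \<le> ln M"
          by (rule iffD2[OF ln_le_cancel_iff[OF m2 s0] s(1)], rule iffD2[OF ln_le_cancel_iff[OF s0 M] s(2)])
        then have "\<bar>ln (norm (quot h x))\<bar> \<le> \<Lambda>" unfolding \<Lambda>_def by linarith
        then have "(ln (norm (quot h x)))\<^sup>2 \<le> \<Lambda>\<^sup>2" by (metis abs_ge_zero power2_abs power_mono)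
        moreover have "(norm (quot h x))\<^sup>2 \<le> M\<^sup>2" using s(2) by (intro power_mono) auto
        ultimately have "(norm (quot h x))\<^sup>2 * (1 + (ln (norm (quot h x)))\<^sup>2) \<le> M\<^sup>2 * (1 + \<Lambda>\<^sup>2)" by (intro mult_mono) auto
        then have f1: "5 * R ^ 4 / \<beta>\<^sup>2 * ((norm (quot h x))\<^sup>2 * (1 + (ln (norm (quot h x)))\<^sup>2)) \<le> 5 * R ^ 4 / \<beta>\<^sup>2 * (M\<^sup>2 * (1 + \<Lambda>\<^sup>2))"
          using R(1) by (intro mult_left_mono) auto
        have "norm (quot h x) powr (p x - 2) * (5 * R ^ 4 / \<beta>\<^sup>2 * ((norm (quot h x))\<^sup>2 * (1 + (ln (norm (quot h x)))\<^sup>2))) \<le> C2"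
          unfolding C2_def by (rule mult_mono[OF pw1(2) f1]) (use R(1) in \<open>simp_all add: c1_def\<close>)
        then show ?thesis by (simp add: mult.assoc)
      qed
      moreover have "(\<Sum>i\<in>Basis. \<delta> * (1 + norm (hess h i x)) * norm (test_grad h i x (z x) (grad z x) 1 0))
        \<le> k / 2 * ((z x)\<^sup>2 * hess_sq h x) + DIM('a) * \<delta> * (1 + 2 * R1)"
      proof -
        have "\<delta> * (1 + norm (hess h i x)) * norm (test_grad h i x (z x) (grad z x) 1 0)
            \<le> \<delta> * ((2 + R1) * ((z x)\<^sup>2 * (norm (hess h i x))\<^sup>2) + (1 + 2 * R1))" if i: "i \<in> Basis" for i
        proof -
          define y where "y = norm (hess h i x)"
          define r where "r = z x * y"
          have r: "0 \<le> y" "0 \<le> r" "r \<le> 1 + r\<^sup>2" using z(4)[of x] zero_le_power2[of "r - 1"]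
            by (auto simp: y_def r_def power2_diff) (smt (verit) mult_nonneg_nonneg zero_le_power2)
          have "norm (test_grad h i x (z x) (grad z x) 1 0) \<le> 2 * z x * norm (quot h x) * norm (grad z x) + (z x)\<^sup>2 * y"
            using norm_test_grad_le[OF i, where h = h and x = x and \<phi> = "z x" and D = "grad z x" and \<theta> = 1 and \<theta>' = 0] z(4)[of x] by (simp add: y_def)
          also have "2 * z x * norm (quot h x) * norm (grad z x) \<le> z x * R1"
          proof -
            have "norm (quot h x) * norm (grad z x) \<le> M * R" by (rule mult_mono[OF s(2) R(2) less_imp_le[OF M] norm_ge_zero])
            then have "2 * z x * (norm (quot h x) * norm (grad z x)) \<le> 2 * z x * (M * R)" using z(4)[of x] by (intro mult_left_mono) auto
            then show ?thesis by (simp add: R1_def algebra_simps)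
          qed
          finally have "norm (test_grad h i x (z x) (grad z x) 1 0) \<le> z x * R1 + (z x)\<^sup>2 * y" by simp
          then have "(1 + y) * norm (test_grad h i x (z x) (grad z x) 1 0) \<le> (1 + y) * (z x * R1 + (z x)\<^sup>2 * y)"
            using r(1) by (intro mult_left_mono) auto
          \<comment> \<open>Every factor y is paired with a factor z of the cutoff, so the error is
            bounded by r^2 = z^2 y^2 plus a constant and can be absorbed into the left side.\<close>
          also have "\<dots> = z x * R1 + r * R1 + z x * r + r\<^sup>2" by (simp add: r_def power2_eq_square algebra_simps)
          also have "\<dots> \<le> R1 + (1 + r\<^sup>2) * R1 + (1 + r\<^sup>2) + r\<^sup>2"
          proof (intro add_mono)
            show "z x * R1 \<le> R1" using R1 z(4,5)[of x] by (simp add: mult_left_le_one_le)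
            show "r * R1 \<le> (1 + r\<^sup>2) * R1" using r R1 by (intro mult_right_mono)
            show "z x * r \<le> 1 + r\<^sup>2" using mult_left_le_one_le[of r "z x"] r z(4,5)[of x] by linarith
          qed simp
          also have "\<dots> = (2 + R1) * r\<^sup>2 + (1 + 2 * R1)" by (simp add: algebra_simps)
          finally have "(1 + y) * norm (test_grad h i x (z x) (grad z x) 1 0) \<le> (2 + R1) * r\<^sup>2 + (1 + 2 * R1)" .
          then have "\<delta> * ((1 + y) * norm (test_grad h i x (z x) (grad z x) 1 0)) \<le> \<delta> * ((2 + R1) * r\<^sup>2 + (1 + 2 * R1))"
            using \<delta>(1) by (intro mult_left_mono) auto
          then show ?thesis by (simp add: y_def[symmetric] r_def power_mult_distrib mult.assoc)
        qed
        then have "(\<Sum>i\<in>Basis. \<delta> * (1 + norm (hess h i x)) * norm (test_grad h i x (z x) (grad z x) 1 0))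
          \<le> (\<Sum>i\<in>Basis. \<delta> * ((2 + R1) * ((z x)\<^sup>2 * (norm (hess h i x))\<^sup>2) + (1 + 2 * R1)))" by (rule sum_mono)
        also have "\<dots> = (\<Sum>i\<in>Basis. (\<delta> * (2 + R1)) * ((z x)\<^sup>2 * (norm (hess h i x))\<^sup>2) + \<delta> * (1 + 2 * R1))"
          by (intro sum.cong refl) (simp add: algebra_simps)
        also have "\<dots> = (\<delta> * (2 + R1)) * ((z x)\<^sup>2 * hess_sq h x) + DIM('a) * \<delta> * (1 + 2 * R1)"
          unfolding hess_sq_def sum.distrib sum_distrib_left[symmetric] by (simp add: algebra_simps)
        finally show ?thesis unfolding \<delta>(2) .
      qed
      ultimately show ?thesis using low z2(3)[OF x] unfolding C3_def right_diff_distrib by simp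
    qed
    have zh: "Cc ?W (\<lambda>x. (z x)\<^sup>2 * hess_sq h x)" unfolding power2_eq_square
      using C1c_Cc(1)[OF zC] by (intro Cc_mult_right[OF _ hess_sq_cont] Cc_mult_right CcD(1))
    have "(\<integral>x. k / 2 * ((z x)\<^sup>2 * hess_sq h x) \<partial>lborel) \<le> (\<integral>x. ?E x + C3 * z2 x \<partial>lborel)"
      by (rule Cc_integral_mono[OF Cc_mult_left[OF continuous_on_const zh]
           Cc_add[OF E(2) Cc_mono[OF Cc_mult_left[OF continuous_on_const z2(1)] subset_UNIV]] pw])
    also have "\<dots> = C3 * integral\<^sup>L lborel z2"
      using Cc_integrable[OF E(2)] Cc_integrable[OF z2(1)] E(1) by simp
    finally have "(\<integral>x. (z x)\<^sup>2 * hess_sq h x \<partial>lborel) \<le> 2 / k * (C3 * integral\<^sup>L lborel z2)"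
      using k by (simp add: field_simps)
    then have "B\<eta> * (\<integral>x. (z x)\<^sup>2 * hess_sq h x \<partial>lborel) \<le> B\<eta> * (2 / k * (C3 * integral\<^sup>L lborel z2))"
      using B\<eta>(1) by (intro mult_left_mono) auto
    moreover have "(\<integral>x. \<bar>\<eta> x\<bar> * hess_sq h x \<partial>lborel) \<le> (\<integral>x. B\<eta> * ((z x)\<^sup>2 * hess_sq h x) \<partial>lborel)"
    proof (rule Cc_integral_mono[OF Cc_mult_right[OF Cc_abs[OF \<eta>] hess_sq_cont] Cc_mult_left[OF continuous_on_const zh]])
      show "\<bar>\<eta> x\<bar> * hess_sq h x \<le> B\<eta> * ((z x)\<^sup>2 * hess_sq h x)" for x
        using mult_right_mono[OF B\<eta>(2)[of x] hess_sq_nonneg[of h x]] by (simp add: mult.assoc)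
    qed
    ultimately show "(\<integral>x. \<bar>\<eta> x\<bar> * hess_sq h x \<partial>lborel) \<le> B\<eta> * (2 / k * (C3 * integral\<^sup>L lborel z2))" by simp
  qed
qed

text \<open>The equation is tested with \<open>\<phi> \<chi>(|q|\<^sup>2)\<close>, where \<open>\<chi> = trunc_weight 0 \<epsilon>\<close> cuts off the critical set.
  The resulting error \<open>\<phi> flux \<bullet> D\<chi>\<close> is split by Young's inequality with parameter \<open>\<kappa>\<close>; the quadratic part is
  controlled, uniformly in \<open>\<epsilon>\<close>, by the form tested with the weight \<open>trunc_weight (1 - \<beta>) \<epsilon>\<close>.\<close>
lemma flux_estimate:
  assumes H: "weakly_div_free (V \<inter> {x. G x \<noteq> 0}) flux" and \<phi>: "C1c V \<phi> D\<phi>"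
  obtains A1 A2 A3 where "0 \<le> A1" "0 \<le> A2" "0 \<le> A3"
    "\<And>\<epsilon> \<kappa>. 0 < \<epsilon> \<Longrightarrow> \<epsilon> \<le> 1 \<Longrightarrow> 0 < \<kappa> \<Longrightarrow>
      \<bar>\<integral>x. flux x \<bullet> D\<phi> x \<partial>lborel\<bar> \<le> A1 * \<epsilon> powr \<beta> + \<kappa> * A2 + A3 / \<kappa> * \<epsilon> powr \<beta>"
proof -
  let ?W = "V \<inter> {x. G x \<noteq> 0}"
  note W = nonzero_set_open
  note \<phi>c = C1c_Cc[OF \<phi>]
  obtain K where K: "compact K" "K \<subseteq> V" "\<And>x. x \<notin> K \<Longrightarrow> \<phi> x = 0" using \<phi>c(1) unfolding Cc_def csupp_def by blast
  have KD: "D\<phi> x = 0" if "x \<notin> K" for x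
    by (rule GDERIV_zero_outside[OF C1c_GDERIV[OF \<phi>] compact_imp_closed[OF K(1)] K(3) that])
  obtain z0 :: "'a \<Rightarrow> real" where z0: "Cc V z0" "\<And>x. 0 \<le> z0 x" "\<And>x. x \<in> K \<Longrightarrow> z0 x = 1"
    using smooth_cutoff_Cc[OF K(1) V K(2)] by blast
  define Z0 where "Z0 = integral\<^sup>L lborel z0"
  have Z0: "0 \<le> Z0" using z0(2) by (simp add: Z0_def)
  obtain MG where MG: "0 < MG" "\<And>x. norm (G x) \<le> MG" using Cc_bounded[OF C1c_Cc(2)[OF u]] by metis
  obtain B1 where B1: "0 < B1" "\<And>x. norm (\<phi> x) \<le> B1" using Cc_bounded[OF \<phi>c(1)] by metis
  obtain B2 where B2: "0 < B2" "\<And>x. norm (D\<phi> x) \<le> B2" using Cc_bounded[OF \<phi>c(2)] by metis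
  define R where "R = 2 + T + B1 + B2 + \<bar>B\<bar>"
  have R: "1 \<le> R" "\<bar>\<phi> x\<bar> \<le> R" "norm (D\<phi> x) \<le> R" "B \<le> R" "2 + T \<le> R" for x
    using T B1(1) B1(2)[of x] B2(1) B2(2)[of x] by (auto simp: R_def)
  define M where "M = MG + 1"
  have M: "1 \<le> M" using MG(1) by (simp add: M_def)
  \<comment> \<open>With p \<ge> 1 + 2\<beta> this gives p - 2 + a \<ge> \<beta>, needed for
    smallness in \<epsilon>, p - a \<ge> 3\<beta>, needed by \<open>powr_ln_bound\<close>, and 1 - a
    = \<beta>, needed for coercivity.\<close>
  define a where "a = 1 - \<beta>"
  have a: "0 \<le> a" "a \<le> 1 - \<beta>" "a \<le> 1" using \<beta> by (auto simp: a_def)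
  have T1: "0 \<le> 1 + T" using T by simp
  obtain Cl where Cl: "0 < Cl" "\<And>s t. 0 < s \<Longrightarrow> s \<le> M \<Longrightarrow> 3 * \<beta> \<le> t \<Longrightarrow> t \<le> 3 * \<beta> + (1 + T) \<Longrightarrow> s powr t * (1 + (ln s)\<^sup>2) \<le> Cl"
    by (rule powr_ln_bound[OF \<beta>(1) M T1]) (rule that; assumption)
  define C1 where "C1 = 5 * R ^ 4 / \<beta>\<^sup>2 * (2 * Cl)"
  have C1: "0 \<le> C1" using R(1) Cl(1) by (simp add: C1_def)
  define c2 where "c2 = 2 powr (1 + T)"
  have c2: "0 < c2" by (simp add: c2_def)
  define MT where "MT = M powr (1 + T)"
  have MT: "1 \<le> MT" unfolding MT_def using M T1 by (simp add: ge_one_powr_ge_zero)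
  define A where "A = 2 * c2 * MT * R"
  have A: "0 \<le> A" "c2 * R \<le> A" using c2 MT R(1) by (auto simp: A_def)
  show ?thesis
  proof (rule that[of "A * Z0" "(C1 * Z0 + 1) / \<beta>\<^sup>2" "4 * c2\<^sup>2 * MT * Z0"])
    show "0 \<le> A * Z0" "0 \<le> (C1 * Z0 + 1) / \<beta>\<^sup>2" "0 \<le> 4 * c2\<^sup>2 * MT * Z0" using A Z0 C1 MT by auto
    fix \<epsilon> \<kappa> :: real assume \<epsilon>: "0 < \<epsilon>" "\<epsilon> \<le> 1" and \<kappa>: "0 < \<kappa>"
    have \<epsilon>2: "0 < \<epsilon> / 2" using \<epsilon>(1) by simp
    let ?\<theta> = "trunc_weight a \<epsilon>" and ?\<theta>' = "trunc_weight' a \<epsilon>" and ?c = "trunc_weight 0 \<epsilon>" and ?c' = "trunc_weight' 0 \<epsilon>"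
    \<comment> \<open>If |q| > \<epsilon> and |q - G| \<le> \<epsilon>/2, then |G| \<ge>
      \<epsilon>/2. So \<open>S\<close> contains the supports of the truncated test functions for
      all small h and stays away from the critical set.\<close>
    define S where "S = K \<inter> {x. \<epsilon> / 2 \<le> norm (G x)}"
    have "closed {x. \<epsilon> / 2 \<le> norm (G x)}" by (intro closed_Collect_le continuous_intros G_cont)
    then have S: "compact S" "S \<subseteq> ?W" using K(1,2) \<epsilon>(1) unfolding S_def by auto
    obtain z1 :: "'a \<Rightarrow> real" where z1: "Cc ?W z1" "\<And>x. 0 \<le> z1 x" "\<And>x. x \<in> S \<Longrightarrow> z1 x = 1"
      using smooth_cutoff_Cc[OF S(1) W S(2)] by blast
    obtain C' d1 where d1: "0 \<le> C'" "0 < d1" "\<And>h. 0 < h \<Longrightarrow> h < d1 \<Longrightarrow> (\<integral>x. \<bar>z1 x\<bar> * hess_sq h x \<partial>lborel) \<le> C'"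
      by (rule hess_local_bound[OF H z1(1)]) (rule that; assumption)
    define Z1 where "Z1 = integral\<^sup>L lborel z1"
    have Z1: "0 \<le> Z1" using z1(2) by (simp add: Z1_def)
    define ea where "ea = \<epsilon> powr (- a)"
    have ea: "0 < ea" using \<epsilon> by (simp add: ea_def)
    define Ce where "Ce = ea * R\<^sup>2 * (2 * M + 3)"
    have Ce: "0 < Ce" using ea R(1) M by (simp add: Ce_def)
    define n where "n = real DIM('a)"
    have n: "1 \<le> n" by (simp add: n_def)
    \<comment> \<open>Chosen after \<epsilon> and after the local bound \<open>C'\<close>: the total
      linearisation error then integrates to at most 1, whatever the size of \<open>C'\<close>. This
      1 is the summand in the constant A2.\<close>
    define \<delta> where "\<delta> = 1 / (2 * n * Ce * (Z1 + C' + 1))"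
    have \<delta>: "0 < \<delta>" using n Ce Z1 d1(1) by (simp add: \<delta>_def)
    define E1 where "E1 = 2 * n * \<delta> * Ce"
    have E1: "0 < E1" "E1 * (Z1 + C') \<le> 1"
    proof -
      show "0 < E1" using n \<delta> Ce by (simp add: E1_def)
      have "E1 * (Z1 + C' + 1) = 1" using n Ce Z1 d1(1) by (simp add: E1_def \<delta>_def add_nonneg_pos)
      then show "E1 * (Z1 + C') \<le> 1" using \<open>0 < E1\<close> by (simp add: distrib_left)
    qed
    obtain d2 where d2: "0 < d2" "\<And>h x i. 0 < h \<Longrightarrow> h < d2 \<Longrightarrow> x \<in> K \<Longrightarrow> i \<in> Basis \<Longrightarrow> \<epsilon> \<le> norm (quot h x) \<Longrightarrow> norm (quot h x) \<le> M \<Longrightarrow>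
      norm (flux_quot h i x - norm (quot h x) powr (p x - 2) *\<^sub>R plap_linear (p x - 2) (Dp x) (quot h x) i (hess h i x))
        \<le> \<delta> * (1 + norm (hess h i x))"
      by (rule flux_linearization[OF K(1) \<epsilon>(1) \<delta>, of M]) (rule that; assumption)
    obtain d3 where d3: "0 < d3" "\<And>h x. 0 < h \<Longrightarrow> h < d3 \<Longrightarrow> norm (quot h x - G x) \<le> \<epsilon> / 2"
      using quot_near[OF \<epsilon>2] by metis
    have \<phi>U: "C1c UNIV \<phi> D\<phi>" by (rule C1c_mono[OF \<phi> subset_UNIV])
    obtain d4 where d4: "0 < d4" "\<And>h. 0 < h \<Longrightarrow> h < d4 \<Longrightarrow> \<forall>x. x \<notin> S \<longrightarrow> \<phi> x = 0 \<or> ?\<theta> ((norm (quot h x))\<^sup>2) = 0 \<Longrightarrow>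
      (\<integral>x. (\<Sum>i\<in>Basis. flux_quot h i x \<bullet> test_grad h i x (\<phi> x) (D\<phi> x) (?\<theta> ((norm (quot h x))\<^sup>2)) (?\<theta>' ((norm (quot h x))\<^sup>2))) \<partial>lborel) = 0
      \<and> Cc UNIV (\<lambda>x. \<Sum>i\<in>Basis. flux_quot h i x \<bullet> test_grad h i x (\<phi> x) (D\<phi> x) (?\<theta> ((norm (quot h x))\<^sup>2)) (?\<theta>' ((norm (quot h x))\<^sup>2)))"
      by (rule tested_equation[OF H S \<phi>U trunc_weight_deriv[OF \<epsilon>(1), of a] trunc_weight'_continuous[OF \<epsilon>(1), of a]]) (rule that; assumption)
    \<comment> \<open>One sufficiently small step is enough. The integral to be estimated does not
      involve h, so no limit in h is taken.\<close>
    define h where "h = min (min d1 d2) (min d3 d4) / 2"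
    have h: "0 < h" "h < d1" "h < d2" "h < d3" "h < d4"
      using d1(2) d2(1) d3(1) d4(1) unfolding h_def by (auto simp: min_def)
    let ?q = "quot h" and ?s = "\<lambda>x. norm (quot h x)" and ?v = "\<lambda>x. (norm (quot h x))\<^sup>2" and ?n2 = "hess_sq h"
    let ?t = "\<lambda>i x. test_grad h i x (\<phi> x) (D\<phi> x) (?\<theta> (?v x)) (?\<theta>' (?v x))"
    let ?E = "\<lambda>x. \<Sum>i\<in>Basis. flux_quot h i x \<bullet> ?t i x"
    have qG: "norm (?q x - G x) \<le> \<epsilon> / 2" for x using d3(2)[OF h(1,4)] .
    have sM: "?s x \<le> M" for x
      using norm_triangle_ineq2[of "?q x" "G x"] qG[of x] MG(2)[of x] \<epsilon> by (simp add: M_def)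
    have Gs: "norm (G x) \<le> ?s x + \<epsilon> / 2" for x
      using norm_triangle_ineq2[of "G x" "?q x"] qG[of x] by (simp add: norm_minus_commute)
    have inS: "x \<in> S" if "\<phi> x \<noteq> 0" "\<epsilon> < ?s x" for x
    proof -
      have "\<epsilon> / 2 \<le> norm (G x)" using norm_triangle_ineq2[of "?q x" "G x"] qG[of x] that(2) by linarith
      then show ?thesis using K(3) that(1) unfolding S_def by blast
    qed
    have small: "?v x \<le> \<epsilon>\<^sup>2" if "?s x \<le> \<epsilon>" for x using that by (intro power_mono) auto
    have offS: "\<forall>x. x \<notin> S \<longrightarrow> \<phi> x = 0 \<or> trunc_weight b \<epsilon> (?v x) = 0" for b
      using inS small trunc_weight_zero(1) by (meson not_le)
    have Eq: "integral\<^sup>L lborel ?E = 0" "Cc UNIV ?E" using d4(2)[OF h(1,5) offS] by auto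
    have fluxb: "norm (flux x) \<le> c2 * ?s x powr (p x - 1)" if "\<epsilon> \<le> ?s x" for x
    proof -
      have p1: "0 \<le> p x - 1" "p x - 1 \<le> 1 + T" using pb(1,2)[of x] \<beta> by auto
      have "norm (flux x) \<le> (2 * ?s x) powr (p x - 1)"
        unfolding norm_flux using Gs[of x] that p1 \<epsilon> by (intro powr_mono2) auto
      also have "\<dots> = 2 powr (p x - 1) * ?s x powr (p x - 1)" by (simp add: powr_mult)
      also have "\<dots> \<le> c2 * ?s x powr (p x - 1)" unfolding c2_def using p1 by (intro mult_right_mono powr_mono) auto
      finally show ?thesis .
    qed
    have c: "GDERIV (\<lambda>x. ?c (?v x)) x :> (2 * ?c' (?v x)) *\<^sub>R hess_quot h x" for x
      by (rule weight_GDERIV[OF trunc_weight_deriv[OF \<epsilon>(1)]])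
    have c'c: "continuous_on UNIV (\<lambda>x. (2 * ?c' (?v x)) *\<^sub>R hess_quot h x)"
      by (intro continuous_intros hess_quot_cont continuous_on_compose2[OF trunc_weight'_continuous[OF \<epsilon>(1)]] quot_cont) auto
    have cc: "continuous_on UNIV (\<lambda>x. ?c (?v x))" by (rule GDERIV_continuous_on[OF c])
    have tC: "C1c V (\<lambda>x. \<phi> x * ?c (?v x)) (\<lambda>x. \<phi> x *\<^sub>R ((2 * ?c' (?v x)) *\<^sub>R hess_quot h x) + ?c (?v x) *\<^sub>R D\<phi> x)"
      by (rule C1c_mult[OF \<phi> c c'c])
    have "C1c ?W (\<lambda>x. \<phi> x * ?c (?v x)) (\<lambda>x. \<phi> x *\<^sub>R ((2 * ?c' (?v x)) *\<^sub>R hess_quot h x) + ?c (?v x) *\<^sub>R D\<phi> x)"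
    proof -
      have "\<phi> x * ?c (?v x) = 0" if "x \<notin> S" for x using offS[of 0] that by auto
      then have "csupp ?W (\<lambda>x. \<phi> x * ?c (?v x))" unfolding csupp_def using S by blast
      then show ?thesis using tC unfolding C1c_def by blast
    qed
    from weakly_div_freeD[OF H this]
    have 0: "(\<integral>x. flux x \<bullet> (\<phi> x *\<^sub>R ((2 * ?c' (?v x)) *\<^sub>R hess_quot h x) + ?c (?v x) *\<^sub>R D\<phi> x) \<partial>lborel) = 0" .
    \<comment> \<open>\<open>P\<close> is what the cutoff removes from the integrand,
      \<open>Q\<close> the product of the flux with the derivative of the cutoff.\<close>
    define P where "P x = (1 - ?c (?v x)) * (flux x \<bullet> D\<phi> x)" for x
    define Q where "Q x = \<phi> x * ((2 * ?c' (?v x)) * (flux x \<bullet> hess_quot h x))" for x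
    have PC: "Cc V P" unfolding P_def[abs_def]
      by (rule Cc_mult_left[OF continuous_on_diff[OF continuous_on_const cc] Cc_inner_left[OF flux_cont \<phi>c(2)]])
    have QC: "Cc V Q"
    proof -
      have "continuous_on UNIV (\<lambda>x. flux x \<bullet> ((2 * ?c' (?v x)) *\<^sub>R hess_quot h x))"
        by (rule continuous_on_inner[OF flux_cont c'c])
      from Cc_mult_right[OF \<phi>c(1) this] show ?thesis unfolding Q_def[abs_def] by simp
    qed
    have split: "flux x \<bullet> D\<phi> x = P x - Q x + flux x \<bullet> (\<phi> x *\<^sub>R ((2 * ?c' (?v x)) *\<^sub>R hess_quot h x) + ?c (?v x) *\<^sub>R D\<phi> x)" for x
      unfolding P_def Q_def by (simp add: inner_add_right algebra_simps)
    have "integrable lborel (\<lambda>x. flux x \<bullet> (\<phi> x *\<^sub>R ((2 * ?c' (?v x)) *\<^sub>R hess_quot h x) + ?c (?v x) *\<^sub>R D\<phi> x))"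
      by (rule Cc_integrable[OF Cc_inner_left[OF flux_cont C1c_Cc(2)[OF tC]]])
    then have I: "(\<integral>x. flux x \<bullet> D\<phi> x \<partial>lborel) = integral\<^sup>L lborel P - integral\<^sup>L lborel Q"
      unfolding split using 0 Cc_integrable[OF PC] Cc_integrable[OF QC] by simp
    have pt: "\<beta> \<le> p x - 1" "p x - 1 \<le> \<beta> + (1 + T)" "\<beta> \<le> p x - 2 + a" "p x - 2 + a \<le> \<beta> + (1 + T)"
      "3 * \<beta> \<le> p x - a" "p x - a \<le> 3 * \<beta> + (1 + T)" for x
      using pb(1,2)[of x] \<beta> T by (auto simp: a_def)
    have sq: "(\<epsilon> / s)\<^sup>2 * s powr t \<le> MT * \<epsilon> powr \<beta>" if "\<epsilon> \<le> s" "s \<le> M" "\<beta> \<le> t" "t \<le> \<beta> + (1 + T)" for s t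
    proof -
      have s0: "0 < s" using that(1) \<epsilon> by simp
      have "s powr t \<le> MT * s powr \<beta>" unfolding MT_def by (rule powr_le_mult_powr[OF s0 that(2) M that(3,4) T1])
      then have "(\<epsilon> / s)\<^sup>2 * s powr t \<le> (\<epsilon> / s)\<^sup>2 * (MT * s powr \<beta>)" by (intro mult_left_mono) auto
      also have "\<dots> = MT * ((\<epsilon> / s)\<^sup>2 * s powr \<beta>)" by simp
      also have "\<dots> \<le> MT * \<epsilon> powr \<beta>"
        using sq_mult_powr_le[OF \<epsilon>(1) that(1), of \<beta>] \<beta> MT by (intro mult_left_mono) auto
      finally show ?thesis .
    qed
    \<comment> \<open>Where |q| \<le> \<epsilon> the flux itself is of order \<epsilon>^(p-1).
      Elsewhere 1 - g^2 \<le> 2 (\<epsilon>/s)^2, and \<open>sq\<close> turns this quadratic decay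
      into \<epsilon>^\<beta>.\<close>
    have Pb: "\<bar>P x\<bar> \<le> (A * \<epsilon> powr \<beta>) * z0 x" for x
    proof (cases "x \<in> K")
      case False
      then show ?thesis using KD[OF False] A(1) z0(2)[of x] by (simp add: P_def)
    next
      case x: True
      have FD: "\<bar>flux x \<bullet> D\<phi> x\<bar> \<le> norm (flux x) * R"
        using Cauchy_Schwarz_ineq2[of "flux x" "D\<phi> x"] mult_left_mono[OF R(3)[of x] norm_ge_zero[of "flux x"]] by linarith
      have "\<bar>P x\<bar> \<le> A * \<epsilon> powr \<beta>"
      proof (cases "?s x \<le> \<epsilon>")
        case True
        have p1: "0 \<le> p x - 1" "p x - 1 \<le> 1 + T" using pb(1,2)[of x] \<beta> by auto
        have "norm (flux x) \<le> (2 * \<epsilon>) powr (p x - 1)"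
          unfolding norm_flux using Gs[of x] True p1 \<epsilon>(1) by (intro powr_mono2) auto
        also have "\<dots> = 2 powr (p x - 1) * \<epsilon> powr (p x - 1)" using \<epsilon> by (simp add: powr_mult)
        also have "\<dots> \<le> c2 * \<epsilon> powr \<beta>" unfolding c2_def
          using p1 pt(1)[of x] \<epsilon> by (intro mult_mono powr_mono powr_mono') auto
        finally have "norm (flux x) * R \<le> c2 * \<epsilon> powr \<beta> * R" using R(1) by (intro mult_right_mono) auto
        also have "\<dots> \<le> A * \<epsilon> powr \<beta>" using mult_right_mono[OF A(2), of "\<epsilon> powr \<beta>"] by (simp add: mult_ac)
        finally show ?thesis using FD trunc_weight_zero(1)[OF small[OF True]] by (simp add: P_def)
      next
        case False
        then have s: "\<epsilon> \<le> ?s x" "0 < ?s x" using \<epsilon> by auto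
        define g where "g = 1 - (\<epsilon> / ?s x)\<^sup>2"
        note tw = trunc_weight_formula[OF \<epsilon>(1) s(1) g_def]
        have c1: "?c (?v x) = g\<^sup>2" using tw(1)[of 0] s(2) by simp
        have "1 - g\<^sup>2 = (1 - g) * (1 + g)" by (simp add: power2_eq_square algebra_simps)
        also have "\<dots> \<le> (1 - g) * 2" using tw(3,4) by (intro mult_left_mono) auto
        finally have g2: "1 - g\<^sup>2 \<le> 2 * (\<epsilon> / ?s x)\<^sup>2" by (simp add: g_def)
        have g0: "0 \<le> 1 - g\<^sup>2" using tw(3,4) by (simp add: power_le_one)
        have "\<bar>P x\<bar> = (1 - g\<^sup>2) * \<bar>flux x \<bullet> D\<phi> x\<bar>" unfolding P_def c1 using g0 by (simp add: abs_mult)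
        also have "\<dots> \<le> (2 * (\<epsilon> / ?s x)\<^sup>2) * (c2 * ?s x powr (p x - 1) * R)"
        proof (rule mult_mono[OF g2])
          show "\<bar>flux x \<bullet> D\<phi> x\<bar> \<le> c2 * ?s x powr (p x - 1) * R"
            using FD mult_right_mono[OF fluxb[OF s(1)], of R] R(1) by linarith
        qed auto
        also have "\<dots> = 2 * c2 * R * ((\<epsilon> / ?s x)\<^sup>2 * ?s x powr (p x - 1))" by simp
        also have "\<dots> \<le> 2 * c2 * R * (MT * \<epsilon> powr \<beta>)"
          using sq[OF s(1) sM pt(1,2)] c2 R(1) by (intro mult_left_mono) auto
        finally show ?thesis by (simp add: A_def mult_ac)
      qed
      then show ?thesis using z0(3)[OF x] by simp
    qed
    define A3 where "A3 = 4 * c2\<^sup>2 * MT"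
    have A3: "0 \<le> A3" using MT by (simp add: A3_def)
    \<comment> \<open>Differentiating the cutoff g^2 leaves one factor g; in Young's inequality its
      square is exactly the g^2 in the weight \<theta> = g^2 s^(-a). The other term carries
      s^(p-2+a) times (\<epsilon>/s)^4.\<close>
    have Qb: "\<bar>Q x\<bar> \<le> \<kappa> / \<beta>\<^sup>2 * (?E x + C1 * z0 x + E1 * (z1 x * (1 + ?n2 x))) + A3 / \<kappa> * \<epsilon> powr \<beta> * z0 x" for x
    proof (cases "\<phi> x \<noteq> 0 \<and> \<epsilon> < ?s x")
      case False
      then have "?E x = 0 \<and> Q x = 0"
      proof (cases "\<phi> x = 0")
        case True then show ?thesis by (simp add: test_grad_zero Q_def)
      next
        case F: False
        then have "?v x \<le> \<epsilon>\<^sup>2" using False small by auto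
        then show ?thesis by (simp add: test_grad_zero(2) trunc_weight_zero Q_def)
      qed
      then show ?thesis using \<kappa> C1 z0(2)[of x] E1(1) z1(2)[of x] hess_sq_nonneg[of h x] A3
        by (auto intro!: add_nonneg_nonneg mult_nonneg_nonneg)
    next
      case True
      then have xS: "x \<in> S" and s: "\<epsilon> \<le> ?s x" "0 < ?s x" and \<phi>0: "\<phi> x \<noteq> 0" using inS \<epsilon> by auto
      then have xK: "x \<in> K" by (simp add: S_def)
      define s where "s = ?s x"
      have s': "\<epsilon> \<le> s" "0 < s" "s \<le> M" using s sM by (auto simp: s_def)
      define g where "g = 1 - (\<epsilon> / s)\<^sup>2"
      define e where "e = 4 * g * (1 - g) * s powr (- a)"
      define N where "N = sqrt (?n2 x)"
      have N: "0 \<le> N" "N\<^sup>2 = ?n2 x" using hess_sq_nonneg[of h x] by (auto simp: N_def)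
      note tw = trunc_weight_formula[OF \<epsilon>(1) s'(1) g_def]
      have \<theta>: "?\<theta> (s\<^sup>2) = g\<^sup>2 * s powr (- a)" by (rule tw(1))
      have g01: "0 \<le> g" "g \<le> 1" using tw(3,4) by auto
      have gg: "4 * g * (1 - g) \<le> 1"
        using zero_le_power2[of "2 * g - 1"] by (simp add: power2_eq_square algebra_simps)
      have sa: "0 < s powr (- a)" "s powr (- a) \<le> ea"
        using s' a \<epsilon> by (auto simp: ea_def intro: powr_mono2')
      have \<theta>01: "0 \<le> ?\<theta> (s\<^sup>2)" "?\<theta> (s\<^sup>2) \<le> s powr (- a)"
        unfolding \<theta> using g01 by (auto simp: power_le_one intro!: mult_left_le_one_le)
      have e01: "0 \<le> e" "e \<le> s powr (- a)" unfolding e_def using g01 gg by (auto intro!: mult_left_le_one_le)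
      have k: "2 * ?\<theta>' (s\<^sup>2) * s\<^sup>2 = e - a * ?\<theta> (s\<^sup>2)" unfolding e_def by (rule tw(2))
      have q0: "?q x \<noteq> 0" using s by auto
      have low: "s powr (p x - 2) * (\<beta>\<^sup>2 * (\<phi> x)\<^sup>2 * ?\<theta> (s\<^sup>2) * ?n2 x - 5 * R ^ 4 / \<beta>\<^sup>2 * s\<^sup>2 * (1 + (ln s)\<^sup>2) * (?\<theta> (s\<^sup>2) + e))
        - (\<Sum>i\<in>Basis. \<delta> * (1 + norm (hess h i x)) * norm (test_grad h i x (\<phi> x) (D\<phi> x) (?\<theta> (s\<^sup>2)) (?\<theta>' (s\<^sup>2)))) \<le> ?E x"
        unfolding s_def
        by (rule pointwise_lower[OF q0 a(1,2) \<theta>01(1)[unfolded s_def] e01(1) k[unfolded s_def] R(1) R(2) R(3) R(4) R(5)])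
          (rule d2(2)[OF h(1,3) xK _ s(1) sM])
      \<comment> \<open>The exponents add up to (p - 2) + 2 - a = p - a \<ge> 3\<beta>, so even with
        the squared logarithm the term is bounded independently of \<epsilon>.\<close>
      have t1: "s powr (p x - 2) * (5 * R ^ 4 / \<beta>\<^sup>2 * s\<^sup>2 * (1 + (ln s)\<^sup>2) * (?\<theta> (s\<^sup>2) + e)) \<le> C1"
      proof -
        have "?\<theta> (s\<^sup>2) + e \<le> 2 * s powr (- a)" using \<theta>01 e01 by simp
        then have "(s powr (p x - 2) * s\<^sup>2 * (1 + (ln s)\<^sup>2)) * (?\<theta> (s\<^sup>2) + e) \<le> (s powr (p x - 2) * s\<^sup>2 * (1 + (ln s)\<^sup>2)) * (2 * s powr (- a))"
          by (intro mult_left_mono) auto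
        also have "\<dots> = 2 * ((s powr (p x - 2) * s powr 2 * s powr (- a)) * (1 + (ln s)\<^sup>2))" using s'(2) by simp
        also have "s powr (p x - 2) * s powr 2 * s powr (- a) = s powr (p x - a)" by (simp only: powr_add[symmetric]) simp
        also have "2 * (s powr (p x - a) * (1 + (ln s)\<^sup>2)) \<le> 2 * Cl" using Cl(2)[OF s'(2,3) pt(5,6)] by simp
        finally have "5 * R ^ 4 / \<beta>\<^sup>2 * ((s powr (p x - 2) * s\<^sup>2 * (1 + (ln s)\<^sup>2)) * (?\<theta> (s\<^sup>2) + e)) \<le> C1"
          unfolding C1_def using R(1) by (intro mult_left_mono) auto
        then show ?thesis by (simp add: mult_ac)
      qed
      have t2: "(\<Sum>i\<in>Basis. \<delta> * (1 + norm (hess h i x)) * norm (test_grad h i x (\<phi> x) (D\<phi> x) (?\<theta> (s\<^sup>2)) (?\<theta>' (s\<^sup>2)))) \<le> E1 * (1 + ?n2 x)"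
      proof -
        have "\<delta> * (1 + norm (hess h i x)) * norm (test_grad h i x (\<phi> x) (D\<phi> x) (?\<theta> (s\<^sup>2)) (?\<theta>' (s\<^sup>2))) \<le> \<delta> * (Ce * (2 * (1 + ?n2 x)))" if i: "i \<in> Basis" for i
        proof -
          have hN: "norm (hess h i x) \<le> N" unfolding N_def by (rule norm_hess_le[OF i])
          have \<theta>ea: "\<bar>?\<theta> (s\<^sup>2)\<bar> \<le> ea" using \<theta>01 sa by simp
          have kk: "\<bar>2 * ?\<theta>' (s\<^sup>2) * s\<^sup>2\<bar> \<le> 2 * ea"
          proof -
            have "a * ?\<theta> (s\<^sup>2) \<le> ?\<theta> (s\<^sup>2)" "0 \<le> a * ?\<theta> (s\<^sup>2)" using a \<theta>01 by (auto intro!: mult_left_le_one_le)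
            then show ?thesis unfolding k using \<theta>01 e01 sa by (auto simp: abs_le_iff)
          qed
          have b1: "2 * \<bar>\<phi> x\<bar> * \<bar>?\<theta> (s\<^sup>2)\<bar> * s * norm (D\<phi> x) \<le> 2 * R * ea * M * R"
            using R(1,2,3) \<theta>ea s' ea M by (intro mult_mono) (auto intro: order_trans[OF abs_ge_zero R(2)])
          have b2: "(\<phi> x)\<^sup>2 * (\<bar>?\<theta> (s\<^sup>2)\<bar> * norm (hess h i x) + \<bar>2 * ?\<theta>' (s\<^sup>2) * s\<^sup>2\<bar> * N) \<le> R\<^sup>2 * (ea * N + 2 * ea * N)"
          proof (rule mult_mono)
            show "(\<phi> x)\<^sup>2 \<le> R\<^sup>2" using R(2)[of x] by (metis abs_ge_zero power2_abs power_mono)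
            show "\<bar>?\<theta> (s\<^sup>2)\<bar> * norm (hess h i x) + \<bar>2 * ?\<theta>' (s\<^sup>2) * s\<^sup>2\<bar> * N \<le> ea * N + 2 * ea * N"
              using \<theta>ea hN kk N(1) ea by (intro add_mono mult_mono) auto
          qed (use N(1) in auto)
          have "norm (test_grad h i x (\<phi> x) (D\<phi> x) (?\<theta> (s\<^sup>2)) (?\<theta>' (s\<^sup>2))) \<le> 2 * R * ea * M * R + R\<^sup>2 * (ea * N + 2 * ea * N)"
            using norm_test_grad_le[OF i, where h = h and x = x and \<phi> = "\<phi> x" and D = "D\<phi> x" and \<theta> = "?\<theta> (s\<^sup>2)" and \<theta>' = "?\<theta>' (s\<^sup>2)"] b1 b2
            unfolding s_def[symmetric] N_def[symmetric] by linarith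
          also have "\<dots> = ea * R\<^sup>2 * (2 * M + 3 * N)" by (simp add: power2_eq_square algebra_simps)
          also have "\<dots> \<le> ea * R\<^sup>2 * ((2 * M + 3) * (1 + N))"
            using ea R(1) N(1) M by (intro mult_left_mono) (auto simp: algebra_simps)
          finally have tg: "norm (test_grad h i x (\<phi> x) (D\<phi> x) (?\<theta> (s\<^sup>2)) (?\<theta>' (s\<^sup>2))) \<le> Ce * (1 + N)" by (simp add: Ce_def mult_ac)
          have "(1 + norm (hess h i x)) * norm (test_grad h i x (\<phi> x) (D\<phi> x) (?\<theta> (s\<^sup>2)) (?\<theta>' (s\<^sup>2))) \<le> (1 + N) * (Ce * (1 + N))"
            using hN tg N(1) by (intro mult_mono) auto
          also have "\<dots> = Ce * (1 + N)\<^sup>2" by (simp add: power2_eq_square)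
          also have "(1 + N)\<^sup>2 \<le> 2 * (1 + ?n2 x)" using zero_le_power2[of "N - 1"] unfolding N(2)[symmetric] by (simp add: power2_eq_square algebra_simps)
          finally have "(1 + norm (hess h i x)) * norm (test_grad h i x (\<phi> x) (D\<phi> x) (?\<theta> (s\<^sup>2)) (?\<theta>' (s\<^sup>2))) \<le> Ce * (2 * (1 + ?n2 x))" using Ce by simp
          then show ?thesis using \<delta> unfolding mult.assoc by (intro mult_left_mono) auto
        qed
        then have "(\<Sum>i\<in>Basis. \<delta> * (1 + norm (hess h i x)) * norm (test_grad h i x (\<phi> x) (D\<phi> x) (?\<theta> (s\<^sup>2)) (?\<theta>' (s\<^sup>2)))) \<le> (\<Sum>i\<in>(Basis::'a set). \<delta> * (Ce * (2 * (1 + ?n2 x))))"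
          by (rule sum_mono)
        also have "\<dots> = E1 * (1 + ?n2 x)" by (simp add: E1_def n_def mult_ac)
        finally show ?thesis .
      qed
      define X where "X = s powr (p x - 2) * ((\<phi> x)\<^sup>2 * ?\<theta> (s\<^sup>2) * ?n2 x)"
      have "\<beta>\<^sup>2 * X \<le> ?E x + C1 + E1 * (1 + ?n2 x)"
        using low t1 t2 unfolding X_def right_diff_distrib by (simp add: mult_ac)
      then have X: "X \<le> 1 / \<beta>\<^sup>2 * (?E x + C1 + E1 * (1 + ?n2 x))" using \<beta>(1) by (simp add: field_simps)
      have c0: "2 * ?c' (s\<^sup>2) * s\<^sup>2 = 4 * g * (1 - g)" using tw(2)[of 0] s'(2) by simp
      have c1: "\<bar>2 * ?c' (s\<^sup>2)\<bar> = 4 * g * (\<epsilon> / s)\<^sup>2 / s\<^sup>2"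
      proof -
        have "2 * ?c' (s\<^sup>2) = 4 * g * (\<epsilon> / s)\<^sup>2 / s\<^sup>2" using c0 s'(2) by (simp add: g_def field_simps)
        then show ?thesis using g01 by simp
      qed
      have "\<bar>flux x \<bullet> hess_quot h x\<bar> \<le> norm (flux x) * norm (hess_quot h x)" by (rule Cauchy_Schwarz_ineq2)
      also have "\<dots> \<le> (c2 * s powr (p x - 1)) * (s * N)"
        using fluxb[OF s(1)] norm_hess_quot_le[of h x] c2 unfolding s_def N_def by (intro mult_mono) auto
      finally have fh: "\<bar>flux x \<bullet> hess_quot h x\<bar> \<le> (c2 * s powr (p x - 1)) * (s * N)" .
      have "\<bar>Q x\<bar> = \<bar>\<phi> x\<bar> * (\<bar>2 * ?c' (s\<^sup>2)\<bar> * \<bar>flux x \<bullet> hess_quot h x\<bar>)" unfolding Q_def s_def by (simp add: abs_mult)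
      also have "\<dots> \<le> \<bar>\<phi> x\<bar> * ((4 * g * (\<epsilon> / s)\<^sup>2 / s\<^sup>2) * ((c2 * s powr (p x - 1)) * (s * N)))"
        unfolding c1 using fh g01 by (intro mult_left_mono) auto
      also have "\<dots> = s powr (p x - 2) * ((\<bar>\<phi> x\<bar> * g * N) * (4 * c2 * (\<epsilon> / s)\<^sup>2))"
      proof -
        have "s powr (p x - 1) = s powr (p x - 2) * s"
          using powr_add[of s "p x - 2" 1] s'(2) by simp
        then show ?thesis using s'(2) by (simp add: power2_eq_square)
      qed
      also have "\<dots> \<le> s powr (p x - 2) * ((\<kappa> * s powr (- a)) * (\<bar>\<phi> x\<bar> * g * N)\<^sup>2 + (4 * c2 * (\<epsilon> / s)\<^sup>2)\<^sup>2 / (4 * (\<kappa> * s powr (- a))))"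
        using \<kappa> sa by (intro mult_left_mono young) auto
      \<comment> \<open>The constant \<open>A3\<close> already contains \<open>MT\<close>; dividing
        by it here lets the bound \<open>sq\<close> leave exactly \<epsilon>^\<beta>.\<close>
      also have "\<dots> = \<kappa> * X + A3 / \<kappa> * ((\<epsilon> / s)\<^sup>2 * (\<epsilon> / s)\<^sup>2 * s powr (p x - 2 + a) / MT)"
      proof -
        have "s powr (p x - 2) * ((\<kappa> * s powr (- a)) * (\<bar>\<phi> x\<bar> * g * N)\<^sup>2) = \<kappa> * X"
          unfolding X_def \<theta> N(2)[symmetric] by (simp add: power_mult_distrib mult_ac)
        moreover have "s powr (p x - 2) * ((4 * c2 * (\<epsilon> / s)\<^sup>2)\<^sup>2 / (4 * (\<kappa> * s powr (- a)))) =
          A3 / \<kappa> * ((\<epsilon> / s)\<^sup>2 * (\<epsilon> / s)\<^sup>2 * s powr (p x - 2 + a) / MT)"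
        proof -
          have m: "s powr (- a) = inverse (s powr a)" by (simp add: powr_minus)
          show ?thesis unfolding m powr_add A3_def using MT \<kappa> s'(2) by (simp add: power2_eq_square field_simps)
        qed
        ultimately show ?thesis by (simp add: distrib_left)
      qed
      also have "\<dots> \<le> \<kappa> * X + A3 / \<kappa> * (\<epsilon> powr \<beta>)"
      proof -
        have "(\<epsilon> / s)\<^sup>2 \<le> 1" using s' \<epsilon> by (simp add: power_le_one)
        then have "(\<epsilon> / s)\<^sup>2 * ((\<epsilon> / s)\<^sup>2 * s powr (p x - 2 + a)) \<le> (\<epsilon> / s)\<^sup>2 * s powr (p x - 2 + a)"
          by (intro mult_left_le_one_le) auto
        also have "\<dots> \<le> MT * \<epsilon> powr \<beta>" by (rule sq[OF s'(1,3) pt(3,4)])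
        finally have f: "(\<epsilon> / s)\<^sup>2 * (\<epsilon> / s)\<^sup>2 * s powr (p x - 2 + a) \<le> \<epsilon> powr \<beta> * MT"
          by (simp only: mult.assoc mult.commute[of _ MT])
        have "0 < MT" using MT by simp
        from iffD2[OF pos_divide_le_eq[OF this] f]
        have "(\<epsilon> / s)\<^sup>2 * (\<epsilon> / s)\<^sup>2 * s powr (p x - 2 + a) / MT \<le> \<epsilon> powr \<beta>" .
        then have "A3 / \<kappa> * ((\<epsilon> / s)\<^sup>2 * (\<epsilon> / s)\<^sup>2 * s powr (p x - 2 + a) / MT) \<le> A3 / \<kappa> * \<epsilon> powr \<beta>"
          using A3 \<kappa> by (intro mult_left_mono) auto
        then show ?thesis by simp
      qed
      also have "\<kappa> * X \<le> \<kappa> * (1 / \<beta>\<^sup>2 * (?E x + C1 + E1 * (1 + ?n2 x)))" using X \<kappa> by (intro mult_left_mono) auto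
      finally show ?thesis using z0(3)[OF xK] z1(3)[OF xS] by simp
    qed
    have n2C: "Cc ?W (\<lambda>x. z1 x * ?n2 x)" by (rule Cc_mult_right[OF z1(1) hess_sq_cont])
    have "\<bar>integral\<^sup>L lborel P\<bar> \<le> (\<integral>x. (A * \<epsilon> powr \<beta>) * z0 x \<partial>lborel)"
      by (rule Cc_integral_abs_mono[OF PC Cc_mult_left[OF continuous_on_const z0(1)] Pb])
    then have IP: "\<bar>integral\<^sup>L lborel P\<bar> \<le> A * \<epsilon> powr \<beta> * Z0" by (simp add: Z0_def)
    have zn: "Cc ?W (\<lambda>x. z1 x * (1 + ?n2 x))"
      by (rule Cc_mult_right[OF z1(1) continuous_on_add[OF continuous_on_const hess_sq_cont]])
    have zni: "(\<integral>x. z1 x * (1 + ?n2 x) \<partial>lborel) \<le> Z1 + C'"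
    proof -
      have "(\<integral>x. z1 x * (1 + ?n2 x) \<partial>lborel) = Z1 + (\<integral>x. z1 x * ?n2 x \<partial>lborel)"
        using Cc_integrable[OF z1(1)] Cc_integrable[OF n2C] by (simp add: distrib_left Z1_def)
      moreover have "(\<integral>x. z1 x * ?n2 x \<partial>lborel) \<le> C'" using d1(3)[OF h(1,2)] z1(2) by simp
      ultimately show ?thesis by simp
    qed
    let ?RHS = "\<lambda>x. \<kappa> / \<beta>\<^sup>2 * (?E x + C1 * z0 x + E1 * (z1 x * (1 + ?n2 x))) + A3 / \<kappa> * \<epsilon> powr \<beta> * z0 x"
    have "Cc UNIV ?RHS"
      by (intro Cc_add Cc_mult_left[OF continuous_on_const] Eq(2) Cc_mono[OF z0(1) subset_UNIV] Cc_mono[OF zn subset_UNIV])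
    then have "\<bar>integral\<^sup>L lborel Q\<bar> \<le> integral\<^sup>L lborel ?RHS" by (rule Cc_integral_abs_mono[OF QC _ Qb])
    \<comment> \<open>The leading 0 is the integral of the tested equation. It removes the only term
      of the bound that has no estimate of its own.\<close>
    also have "\<dots> = \<kappa> / \<beta>\<^sup>2 * (0 + C1 * Z0 + E1 * (\<integral>x. z1 x * (1 + ?n2 x) \<partial>lborel)) + A3 / \<kappa> * \<epsilon> powr \<beta> * Z0"
    proof -
      have i: "integrable lborel ?E" "integrable lborel (\<lambda>x. C1 * z0 x)" "integrable lborel (\<lambda>x. E1 * (z1 x * (1 + ?n2 x)))"
        "integrable lborel (\<lambda>x. A3 / \<kappa> * \<epsilon> powr \<beta> * z0 x)"
        using Cc_integrable[OF Eq(2)] Cc_integrable[OF z0(1)] Cc_integrable[OF zn] by auto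
      have "integral\<^sup>L lborel ?RHS = \<kappa> / \<beta>\<^sup>2 * (integral\<^sup>L lborel ?E + (\<integral>x. C1 * z0 x \<partial>lborel) + (\<integral>x. E1 * (z1 x * (1 + ?n2 x)) \<partial>lborel))
        + (\<integral>x. A3 / \<kappa> * \<epsilon> powr \<beta> * z0 x \<partial>lborel)"
        by (subst Bochner_Integration.integral_add, (intro integrable_mult_right Bochner_Integration.integrable_add i)+,
            subst integral_mult_right_zero, subst Bochner_Integration.integral_add, (intro Bochner_Integration.integrable_add i)+,
            subst Bochner_Integration.integral_add, (intro i)+, rule refl)
      then show ?thesis unfolding Eq(1) integral_mult_right_zero Z0_def .
    qed
    also have "\<dots> \<le> \<kappa> / \<beta>\<^sup>2 * (0 + C1 * Z0 + 1) + A3 / \<kappa> * \<epsilon> powr \<beta> * Z0"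
    proof -
      have "E1 * (\<integral>x. z1 x * (1 + ?n2 x) \<partial>lborel) \<le> 1"
        using mult_left_mono[OF zni, of E1] E1 by linarith
      then have "\<kappa> / \<beta>\<^sup>2 * (0 + C1 * Z0 + E1 * (\<integral>x. z1 x * (1 + ?n2 x) \<partial>lborel)) \<le> \<kappa> / \<beta>\<^sup>2 * (0 + C1 * Z0 + 1)"
        using \<kappa> by (intro mult_left_mono) auto
      then show ?thesis by simp
    qed
    finally have "\<bar>integral\<^sup>L lborel Q\<bar> \<le> \<kappa> / \<beta>\<^sup>2 * (C1 * Z0 + 1) + A3 / \<kappa> * \<epsilon> powr \<beta> * Z0" by simp
    then have "\<bar>\<integral>x. flux x \<bullet> D\<phi> x \<partial>lborel\<bar> \<le> A * \<epsilon> powr \<beta> * Z0 + (\<kappa> / \<beta>\<^sup>2 * (C1 * Z0 + 1) + A3 / \<kappa> * \<epsilon> powr \<beta> * Z0)"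
      unfolding I using IP by linarith
    also have "\<dots> = A * Z0 * \<epsilon> powr \<beta> + \<kappa> * ((C1 * Z0 + 1) / \<beta>\<^sup>2) + 4 * c2\<^sup>2 * MT * Z0 / \<kappa> * \<epsilon> powr \<beta>"
      by (simp add: A3_def mult_ac)
    finally show "\<bar>\<integral>x. flux x \<bullet> D\<phi> x \<partial>lborel\<bar> \<le> A * Z0 * \<epsilon> powr \<beta> + \<kappa> * ((C1 * Z0 + 1) / \<beta>\<^sup>2) + 4 * c2\<^sup>2 * MT * Z0 / \<kappa> * \<epsilon> powr \<beta>" .
  qed
qed

text \<open>First \<kappa> makes the term \<kappa> A2 small, then \<epsilon> is taken small against
  A3/\<kappa>. The estimate holds because none of the constants depends on either parameter.\<close>

lemma flux_weakly_div_free: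
  assumes H: "weakly_div_free (V \<inter> {x. G x \<noteq> 0}) flux"
  shows "weakly_div_free V flux"
  unfolding weakly_div_free_def
proof (intro allI impI)
  fix \<phi> D\<phi> assume \<phi>: "C1c V \<phi> D\<phi>"
  let ?I = "\<bar>\<integral>x. flux x \<bullet> D\<phi> x \<partial>lborel\<bar>"
  obtain A1 A2 A3 where A: "0 \<le> A1" "0 \<le> A2" "0 \<le> A3"
    "\<And>\<epsilon> \<kappa>. 0 < \<epsilon> \<Longrightarrow> \<epsilon> \<le> 1 \<Longrightarrow> 0 < \<kappa> \<Longrightarrow> ?I \<le> A1 * \<epsilon> powr \<beta> + \<kappa> * A2 + A3 / \<kappa> * \<epsilon> powr \<beta>"
    by (rule flux_estimate[OF H \<phi>]) (rule that; assumption)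
  have "?I \<le> 0"
  proof (rule field_le_epsilon)
    fix e :: real assume e: "0 < e"
    define \<kappa> where "\<kappa> = e / (2 * (A2 + 1))"
    have \<kappa>: "0 < \<kappa>" "\<kappa> * A2 \<le> e / 2" using e A(2) by (auto simp: \<kappa>_def field_simps)
    have nn: "0 \<le> A1 + A3 / \<kappa>" using A \<kappa> by simp
    have e2: "0 < e / 2" using e by simp
    obtain \<epsilon> where \<epsilon>: "0 < \<epsilon>" "\<epsilon> \<le> 1" "(A1 + A3 / \<kappa>) * \<epsilon> powr \<beta> \<le> e / 2"
      by (rule small_powr[OF \<beta>(1) nn e2]) (rule that; assumption)
    have "?I \<le> A1 * \<epsilon> powr \<beta> + \<kappa> * A2 + A3 / \<kappa> * \<epsilon> powr \<beta>" by (rule A(4)[OF \<epsilon>(1,2) \<kappa>(1)])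
    also have "\<dots> = (A1 + A3 / \<kappa>) * \<epsilon> powr \<beta> + \<kappa> * A2" by (simp add: algebra_simps)
    also have "\<dots> \<le> 0 + e" using \<epsilon>(3) \<kappa>(2) by linarith
    finally show "?I \<le> 0 + e" .
  qed
  then show "(\<integral>x. flux x \<bullet> D\<phi> x \<partial>lborel) = 0" by simp
qed

end

subsection \<open>The fundamental lemma and the theorem\<close>

text \<open>Connects the set integrals over \<open>lebesgue\<close> in the statement with the whole
  space integrals over \<open>lborel\<close> used in the estimates.\<close>

lemma Cc_set_lebesgue_integral:
  fixes f :: "'a::euclidean_space \<Rightarrow> real"
  assumes "Cc U f" shows "(LINT x:U|lebesgue. f x) = integral\<^sup>L lborel f"
proof -
  have eq: "indicator U x *\<^sub>R f x = f x" for x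
    using assms unfolding Cc_def csupp_def by (cases "x \<in> U") auto
  have "(LINT x:U|lebesgue. f x) = integral\<^sup>L lebesgue f" unfolding set_lebesgue_integral_def eq ..
  also have "\<dots> = integral\<^sup>L lborel f"
    using CcD(1)[OF assms] by (intro integral_completion) (auto intro: borel_measurable_continuous_onI)
  finally show ?thesis .
qed

lemma set_integrable_compact_continuous:
  fixes f :: "'a::euclidean_space \<Rightarrow> real"
  assumes "compact K" "continuous_on K f" shows "set_integrable lebesgue K f"
proof -
  have "integrable lborel (\<lambda>x. indicator K x *\<^sub>R f x)" by (rule borel_integrable_compact[OF assms])
  then show ?thesis unfolding set_integrable_def by (subst integrable_completion) auto
qed

lemma integrable_mult_test:
  fixes f \<phi> :: "'a::euclidean_space \<Rightarrow> real"
  assumes f: "\<And>K. compact K \<Longrightarrow> K \<subseteq> U \<Longrightarrow> set_integrable lebesgue K f" and \<phi>: "Cc U \<phi>"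
  shows "set_integrable lebesgue U (\<lambda>x. f x * \<phi> x)"
proof -
  obtain K where K: "compact K" "K \<subseteq> U" "\<And>x. x \<notin> K \<Longrightarrow> \<phi> x = 0" using \<phi> unfolding Cc_def csupp_def by blast
  obtain C where C: "0 < C" "\<And>x. norm (\<phi> x) \<le> C" using Cc_bounded[OF \<phi>] by metis
  have i: "integrable lebesgue (\<lambda>x. indicator K x *\<^sub>R f x)" using f[OF K(1,2)] by (simp add: set_integrable_def)
  have m: "\<phi> \<in> borel_measurable lebesgue"
    using CcD(1)[OF \<phi>] by (intro measurable_completion) (simp add: borel_measurable_continuous_onI)
  have eq: "indicator U x *\<^sub>R (f x * \<phi> x) = (indicator K x *\<^sub>R f x) * \<phi> x" for x
    using K(2,3) by (cases "x \<in> K") (auto simp: indicator_def)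
  have "integrable lebesgue (\<lambda>x. (indicator K x *\<^sub>R f x) * \<phi> x)"
  proof (rule Bochner_Integration.integrable_bound[where f = "\<lambda>x. C * (indicator K x *\<^sub>R f x)"])
    show "(\<lambda>x. (indicator K x *\<^sub>R f x) * \<phi> x) \<in> borel_measurable lebesgue"
      using i m by (intro borel_measurable_times) auto
    show "AE x in lebesgue. norm ((indicator K x *\<^sub>R f x) * \<phi> x) \<le> norm (C * (indicator K x *\<^sub>R f x))"
    proof (rule AE_I2)
      fix x
      have "\<bar>indicator K x *\<^sub>R f x\<bar> * \<bar>\<phi> x\<bar> \<le> \<bar>indicator K x *\<^sub>R f x\<bar> * C" using C(2)[of x] by (intro mult_left_mono) auto
      then show "norm ((indicator K x *\<^sub>R f x) * \<phi> x) \<le> norm (C * (indicator K x *\<^sub>R f x))"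
        using C(1) unfolding real_norm_def abs_mult by (simp add: mult.commute)
    qed
  qed (use i in auto)
  then show ?thesis unfolding set_integrable_def eq .
qed

text \<open>Cutoffs equal to 1 on \<open>K\<close> and supported in shrinking neighbourhoods
  converge pointwise to the indicator of \<open>K\<close>. All live in one compact \<open>L\<close>,
  so |f| on \<open>L\<close> dominates.\<close>

lemma integral_compact_zero:
  fixes f :: "'a::euclidean_space \<Rightarrow> real"
  assumes U: "open U" and f: "\<And>K. compact K \<Longrightarrow> K \<subseteq> U \<Longrightarrow> set_integrable lebesgue K f"
    and H: "\<And>\<phi>. test_fun U \<phi> \<Longrightarrow> (LINT x:U|lebesgue. f x * \<phi> x) = 0"
    and K: "compact K" "K \<subseteq> U"
  shows "(LINT x:K|lebesgue. f x) = 0"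
proof -
  obtain r L where L: "0 < r" "compact L" "L \<subseteq> U" "\<And>x y. x \<in> K \<Longrightarrow> dist x y \<le> r \<Longrightarrow> y \<in> L"
    using compact_neighbourhood[OF K(1) U K(2)] by metis
  define N where "N n = (\<Union>x\<in>K. ball x (r / real (Suc n)))" for n
  have N: "open (N n)" "K \<subseteq> N n" "N n \<subseteq> L" for n
  proof -
    show "open (N n)" unfolding N_def by auto
    show "K \<subseteq> N n"
    proof
      fix x assume "x \<in> K"
      then show "x \<in> N n" unfolding N_def using L(1) by (intro UN_I[of x]) auto
    qed
    have "r / real (Suc n) \<le> r" using L(1) by (simp add: field_simps)
    then show "N n \<subseteq> L" unfolding N_def using L(4) by fastforce
  qed
  have "\<exists>z. test_fun (N n) z \<and> (\<forall>x\<in>K. z x = 1) \<and> (\<forall>x. 0 \<le> z x) \<and> (\<forall>x. z x \<le> 1)" for n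
  proof (rule smooth_cutoff[OF K(1) N(1,2)[of n]])
    fix z V assume "test_fun (N n) z" "K \<subseteq> V" "\<And>x. x \<in> V \<Longrightarrow> z x = 1" "\<And>x. 0 \<le> z x" "\<And>x. z x \<le> 1"
    then show ?thesis by blast
  qed
  from choice[OF allI[OF this]] obtain z where "\<forall>n. test_fun (N n) (z n) \<and> (\<forall>x\<in>K. z n x = 1) \<and> (\<forall>x. 0 \<le> z n x) \<and> (\<forall>x. z n x \<le> 1)" ..
  then have z: "\<And>n. test_fun (N n) (z n)" "\<And>n x. x \<in> K \<Longrightarrow> z n x = 1" "\<And>n x. 0 \<le> z n x" "\<And>n x. z n x \<le> 1" by simp_all
  have z0: "z n x = 0" if "x \<notin> N n" for n x
    using z(1)[of n] that closure_subset[of "{x. z n x \<noteq> 0}"] unfolding test_fun_def by blast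
  have zU: "test_fun U (z n)" for n using z(1)[of n] N(3)[of n] L(3) unfolding test_fun_def by blast
  have iL: "integrable lebesgue (\<lambda>x. indicator L x *\<^sub>R f x)" using f[OF L(2,3)] by (simp add: set_integrable_def)
  have iK: "integrable lebesgue (\<lambda>x. indicator K x *\<^sub>R f x)" using f[OF K] by (simp add: set_integrable_def)
  have "(\<lambda>n. \<integral>x. (indicator L x *\<^sub>R f x) * z n x \<partial>lebesgue) \<longlonglongrightarrow> (\<integral>x. indicator K x *\<^sub>R f x \<partial>lebesgue)"
  proof (rule integral_dominated_convergence[where w = "\<lambda>x. \<bar>indicator L x *\<^sub>R f x\<bar>"])
    show "(\<lambda>x. indicator K x *\<^sub>R f x) \<in> borel_measurable lebesgue" using iK by auto
    show "(\<lambda>x. (indicator L x *\<^sub>R f x) * z n x) \<in> borel_measurable lebesgue" for n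
    proof -
      have "z n \<in> borel_measurable lebesgue"
        using CcD(1)[OF C1c_Cc(1)[OF test_fun_C1c[OF zU[of n]]]]
        by (intro measurable_completion) (simp add: borel_measurable_continuous_onI)
      then show ?thesis using iL by (intro borel_measurable_times) auto
    qed
    show "integrable lebesgue (\<lambda>x. \<bar>indicator L x *\<^sub>R f x\<bar>)" using iL by auto
    show "AE x in lebesgue. (\<lambda>n. (indicator L x *\<^sub>R f x) * z n x) \<longlonglongrightarrow> indicator K x *\<^sub>R f x"
    proof (rule AE_I2)
      fix x
      show "(\<lambda>n. (indicator L x *\<^sub>R f x) * z n x) \<longlonglongrightarrow> indicator K x *\<^sub>R f x"
      proof (cases "x \<in> K")
        case True
        then have "x \<in> L" using L(4)[of x x] L(1) by simp
        then show ?thesis using True z(2) by simp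
      next
        case False
        have "\<forall>\<^sub>F n in sequentially. (indicator L x *\<^sub>R f x) * z n x = 0"
        proof (cases "K = {}")
          case True
          then show ?thesis using z0 by (simp add: N_def)
        next
          case ne: False
          have "0 < infdist x K" using False K(1) ne by (simp add: infdist_pos_not_in_closed compact_imp_closed)
          then obtain n0 where n0: "r / real (Suc n0) < infdist x K"
            using reals_Archimedean[of "infdist x K / r"] L(1) by (auto simp: field_simps)
          have "x \<notin> N n" if "n \<ge> n0" for n
          proof
            assume "x \<in> N n"
            then obtain y where y: "y \<in> K" "dist y x < r / real (Suc n)" unfolding N_def by auto
            have "infdist x K \<le> dist x y" using y(1) by (rule infdist_le)
            moreover have "r / real (Suc n) \<le> r / real (Suc n0)" using that L(1) by (intro divide_left_mono) auto
            ultimately show False using y(2) n0 by (simp add: dist_commute)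
          qed
          then show ?thesis using z0 by (intro eventually_sequentiallyI[of n0]) auto
        qed
        then show ?thesis using False by (simp add: tendsto_eventually)
      qed
    qed
    show "AE x in lebesgue. norm ((indicator L x *\<^sub>R f x) * z n x) \<le> \<bar>indicator L x *\<^sub>R f x\<bar>" for n
      using z(3,4)[of n] by (intro AE_I2) (simp add: abs_mult mult_right_le_one_le)
  qed
  moreover have "(\<integral>x. (indicator L x *\<^sub>R f x) * z n x \<partial>lebesgue) = 0" for n
  proof -
    have eq: "(indicator L x *\<^sub>R f x) * z n x = indicator U x *\<^sub>R (f x * z n x)" for x
      using z0[of x n] N(3)[of n] L(3) by (cases "x \<in> N n") (auto simp: indicator_def)
    show ?thesis unfolding eq using H[OF zU[of n]] unfolding set_lebesgue_integral_def .
  qed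
  ultimately have "(\<lambda>n. 0) \<longlonglongrightarrow> (\<integral>x. indicator K x *\<^sub>R f x \<partial>lebesgue)" by (simp only:)
  then have "(\<integral>x. indicator K x *\<^sub>R f x \<partial>lebesgue) = 0" by (simp only: LIMSEQ_const_iff)
  then show ?thesis by (simp add: set_lebesgue_integral_def)
qed

text \<open>A closed subset of \<open>K\<close> on which f > 0 is compact, so the integral of f over
  it is zero and the subset is null. By inner regularity the whole set where f > 0 is null.\<close>

lemma positive_part_null:
  fixes f :: "'a::euclidean_space \<Rightarrow> real"
  assumes K: "compact K" and f: "set_integrable lebesgue K f"
    and H: "\<And>T. compact T \<Longrightarrow> T \<subseteq> K \<Longrightarrow> (LINT x:T|lebesgue. f x) = 0"
  shows "AE x in lebesgue. x \<in> K \<longrightarrow> f x \<le> 0"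
proof -
  let ?g = "\<lambda>x. indicator K x *\<^sub>R f x"
  have i: "integrable lebesgue ?g" using f by (simp add: set_integrable_def)
  define A where "A = {x \<in> space lebesgue. 0 < ?g x}"
  have A: "A \<in> sets lebesgue" unfolding A_def using i by (intro borel_measurable_less borel_measurable_const) auto
  have AK: "x \<in> A \<longleftrightarrow> x \<in> K \<and> 0 < f x" for x unfolding A_def by (cases "x \<in> K") auto
  have null: "emeasure lebesgue T = 0" if T: "closed T" "T \<subseteq> A" for T
  proof -
    have TK: "T \<subseteq> K" using T(2) AK by blast
    then have cT: "compact T" using compact_Int_closed[OF K T(1)] by (simp add: Int_absorb1)
    have Tm: "T \<in> sets lebesgue" using T(1) by (simp add: borel_closed)
    have "(\<integral>x. indicator T x *\<^sub>R f x \<partial>lebesgue) = 0" using H[OF cT TK] by (simp add: set_lebesgue_integral_def)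
    moreover have "integrable lebesgue (\<lambda>x. indicator T x *\<^sub>R f x)"
      using set_integrable_subset[OF f Tm TK] by (simp add: set_integrable_def)
    moreover have "AE x in lebesgue. 0 \<le> indicator T x *\<^sub>R f x"
      using T(2) AK by (intro AE_I2) (auto simp: indicator_def less_imp_le)
    ultimately have "AE x in lebesgue. indicator T x *\<^sub>R f x = 0" using integral_nonneg_eq_0_iff_AE by blast
    then have "AE x in lebesgue. x \<notin> T"
      by eventually_elim (use T(2) AK in \<open>auto simp: indicator_def split: if_splits\<close>)
    then show ?thesis using Tm by (simp add: AE_iff_null_sets null_setsD1 flip: AE_iff_null_sets)
  qed
  have le: "emeasure lebesgue A \<le> 0 + ennreal e" if e: "0 < e" for e
  proof -
    obtain T where T: "closed T" "T \<subseteq> A" "A - T \<in> lmeasurable" "emeasure lebesgue (A - T) < ennreal e"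
      using sets_lebesgue_inner_closed[OF A e] by metis
    have Tm: "T \<in> sets lebesgue" using T(1) by (simp add: borel_closed)
    have "emeasure lebesgue A = emeasure lebesgue (T \<union> (A - T))" using T(2) by (simp add: Un_absorb1)
    also have "\<dots> \<le> emeasure lebesgue T + emeasure lebesgue (A - T)"
      using Tm T(3) by (intro emeasure_subadditive) auto
    finally show ?thesis using null[OF T(1,2)] T(4) by simp
  qed
  have "emeasure lebesgue A \<le> 0" by (rule ennreal_le_epsilon) (rule le)
  then have "A \<in> null_sets lebesgue" using A by (simp add: null_sets_def)
  then have "AE x in lebesgue. x \<notin> A" by (rule AE_not_in)
  then show ?thesis
  proof eventually_elim
    case (elim x)
    then show ?case unfolding AK by (meson not_le)
  qed
qed

text \<open>An open set is a countable union of closed boxes; on each of them the previous lemma is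
  applied to f and to -f.\<close>

lemma du_Bois_Reymond:
  fixes f :: "'a::euclidean_space \<Rightarrow> real"
  assumes U: "open U" and f: "\<And>K. compact K \<Longrightarrow> K \<subseteq> U \<Longrightarrow> set_integrable lebesgue K f"
    and H: "\<And>\<phi>. test_fun U \<phi> \<Longrightarrow> (LINT x:U|lebesgue. f x * \<phi> x) = 0"
  shows "AE x in lebesgue. x \<in> U \<longrightarrow> f x = 0"
proof -
  obtain D where D: "countable D" "D \<subseteq> Pow U" "\<And>X. X \<in> D \<Longrightarrow> \<exists>a b. X = cbox a b" "\<Union>D = U"
    using open_countable_Union_open_cbox[OF U] by metis
  have zero: "(LINT x:K|lebesgue. f x) = 0" if "compact K" "K \<subseteq> U" for K
    by (rule integral_compact_zero[OF U f H that])
  have AEX: "AE x in lebesgue. x \<in> X \<longrightarrow> f x = 0" if X: "X \<in> D" for X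
  proof -
    have K: "compact X" "X \<subseteq> U" using D(2,3) X compact_cbox by blast+
    have 1: "AE x in lebesgue. x \<in> X \<longrightarrow> f x \<le> 0"
      by (rule positive_part_null[OF K(1) f[OF K] zero]) (use K in auto)
    have "set_integrable lebesgue X (\<lambda>x. - f x)" using f[OF K] by (simp add: set_integrable_def)
    then have 2: "AE x in lebesgue. x \<in> X \<longrightarrow> - f x \<le> 0"
    proof (rule positive_part_null[OF K(1)])
      fix T assume T: "compact T" "T \<subseteq> X"
      then have "(LINT x:T|lebesgue. f x) = 0" using zero K by auto
      then show "(LINT x:T|lebesgue. - f x) = 0" by (simp add: set_lebesgue_integral_def)
    qed
    show ?thesis using 1 2 by eventually_elim auto
  qed
  have "AE x in lebesgue. \<forall>X\<in>D. x \<in> X \<longrightarrow> f x = 0"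
    by (subst AE_ball_countable[OF D(1)]) (rule ballI, rule AEX)
  then show ?thesis by eventually_elim (use D(4) in auto)
qed

section \<open>From smooth to C^1 test functions, localisation, and the theorem\<close>

lemma weakly_div_free_test_fun:
  fixes F :: "'a::euclidean_space \<Rightarrow> 'a"
  assumes U: "open U" and F: "continuous_on UNIV F"
    and H: "\<And>\<phi>. test_fun U \<phi> \<Longrightarrow> (\<integral>x. F x \<bullet> grad \<phi> x \<partial>lborel) = 0"
  shows "weakly_div_free U F"
  unfolding weakly_div_free_def
proof (intro allI impI)
  fix \<phi> D\<phi> assume \<phi>: "C1c U \<phi> D\<phi>"
  obtain L where L: "compact L" "L \<subseteq> U" "\<And>x. x \<notin> L \<Longrightarrow> \<phi> x = 0"
    "\<And>e. 0 < e \<Longrightarrow> \<exists>g. test_fun U g \<and> (\<forall>x. x \<notin> L \<longrightarrow> g x = 0) \<and> (\<forall>x. \<bar>g x - \<phi> x\<bar> \<le> e) \<and>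
       (\<forall>Df. C1c U \<phi> Df \<longrightarrow> (\<forall>x. norm (grad g x - Df x) \<le> e))"
    by (rule Cc_test_fun_approx[OF U C1c_Cc(1)[OF \<phi>]]) (rule that; assumption)
  obtain z :: "'a \<Rightarrow> real" where z: "Cc U z" "\<And>x. 0 \<le> z x" "\<And>x. x \<in> L \<Longrightarrow> z x = 1"
    using smooth_cutoff_Cc[OF L(1) U L(2)] by blast
  define C where "C = (\<integral>x. z x * norm (F x) \<partial>lborel)"
  have zF: "Cc U (\<lambda>x. z x * norm (F x))" by (intro Cc_mult_right z continuous_intros F)
  have C: "0 \<le> C" unfolding C_def using z(2) by (intro Bochner_Integration.integral_nonneg) auto
  let ?I = "\<bar>\<integral>x. F x \<bullet> D\<phi> x \<partial>lborel\<bar>"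
  have main: "?I \<le> e * C" if e: "0 < e" for e
  proof -
    obtain g where g: "test_fun U g" "\<And>x. x \<notin> L \<Longrightarrow> g x = 0" "\<And>x. norm (grad g x - D\<phi> x) \<le> e"
      using L(4)[OF e] \<phi> by blast
    note gC = test_fun_C1c[OF g(1)]
    have FD: "Cc U (\<lambda>x. F x \<bullet> D\<phi> x)" and Fg: "Cc U (\<lambda>x. F x \<bullet> grad g x)"
      using C1c_Cc(2)[OF \<phi>] C1c_Cc(2)[OF gC] F by (auto intro: Cc_inner_left)
    have "(\<integral>x. F x \<bullet> D\<phi> x \<partial>lborel) = (\<integral>x. F x \<bullet> D\<phi> x - F x \<bullet> grad g x \<partial>lborel)"
      using H[OF g(1)] Cc_integrable[OF FD] Cc_integrable[OF Fg] by simp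
    also have "\<bar>\<dots>\<bar> \<le> (\<integral>x. e * (z x * norm (F x)) \<partial>lborel)"
    proof (rule Cc_integral_abs_mono[OF Cc_diff[OF FD Fg] Cc_mult_left[OF continuous_on_const zF]])
      fix x
      show "\<bar>F x \<bullet> D\<phi> x - F x \<bullet> grad g x\<bar> \<le> e * (z x * norm (F x))"
      proof (cases "x \<in> L")
        case True
        have "\<bar>F x \<bullet> (D\<phi> x - grad g x)\<bar> \<le> norm (F x) * e"
          using g(3)[of x] by (intro order_trans[OF Cauchy_Schwarz_ineq2] mult_left_mono) (auto simp: norm_minus_commute)
        then show ?thesis using z(3)[OF True] by (simp add: inner_diff_right mult.commute)
      next
        case False
        have cl: "closed L" using L(1) by (rule compact_imp_closed)
        have "D\<phi> x = 0" by (rule GDERIV_zero_outside[OF C1c_GDERIV[OF \<phi>] cl L(3) False])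
        moreover have "grad g x = 0" by (rule GDERIV_zero_outside[OF C1c_GDERIV[OF gC] cl g(2) False])
        ultimately show ?thesis using e z(2)[of x] by simp
      qed
    qed
    finally show ?thesis by (simp add: C_def)
  qed
  have "?I \<le> 0"
  proof (rule field_le_epsilon)
    fix e :: real assume e: "0 < e"
    have "?I \<le> e / (C + 1) * C" using e C by (intro main) auto
    also have "\<dots> \<le> e" using e C by (simp add: field_simps)
    finally show "?I \<le> 0 + e" by simp
  qed
  then show "(\<integral>x. F x \<bullet> D\<phi> x \<partial>lborel) = 0" by simp
qed

text \<open>Multiplication by a cutoff that is 1 near \<open>K\<close>. Agreement on an open
  \<open>V\<close> makes the gradients agree there, and in the theorem it also preserves the zero
  set and the critical set within \<open>V\<close>.\<close>

lemma C1c_localize: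
  fixes u :: "'a::euclidean_space \<Rightarrow> real"
  assumes U: "open U" and u: "\<And>x. x \<in> U \<Longrightarrow> GDERIV u x :> G x" "continuous_on U G" and K: "compact K" "K \<subseteq> U"
  obtains v Dv V where "C1c U v Dv" "open V" "K \<subseteq> V" "V \<subseteq> U" "\<And>x. x \<in> V \<Longrightarrow> v x = u x" "\<And>x. x \<in> V \<Longrightarrow> Dv x = G x"
proof -
  obtain z V where z: "test_fun U z" "open V" "K \<subseteq> V" "V \<subseteq> U" "\<And>x. x \<in> V \<Longrightarrow> z x = 1"
    by (rule smooth_cutoff[OF K(1) U K(2)]) (rule that; assumption)
  note zC = test_fun_C1c[OF z(1)]
  define Dv where "Dv x = (if x \<in> U then z x *\<^sub>R G x + u x *\<^sub>R grad z x else 0)" for x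
  have uc: "continuous_on U u"
    using u(1) unfolding gderiv_def by (meson continuous_at_imp_continuous_on has_derivative_continuous)
  have zc: "continuous_on U z" "continuous_on U (grad z)" using CcD(1) C1c_Cc[OF zC] continuous_on_subset by blast+
  have zu: "C1c U (\<lambda>x. z x * u x) Dv"
  proof (rule C1c_on_open[OF U])
    show "GDERIV (\<lambda>x. z x * u x) x :> Dv x" if "x \<in> U" for x
      using GDERIV_mult[OF C1c_GDERIV[OF zC] u(1)[OF that]] that by (simp add: Dv_def)
    have "continuous_on U (\<lambda>x. z x *\<^sub>R G x + u x *\<^sub>R grad z x)" by (intro continuous_intros uc zc u(2))
    then show "continuous_on U Dv" by (rule continuous_on_eq) (simp add: Dv_def)
    show "csupp U (\<lambda>x. z x * u x)" by (rule csupp_subset[OF CcD(2)[OF C1c_Cc(1)[OF zC]]]) simp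
  qed (simp add: Dv_def)
  have DvG: "Dv x = G x" if x: "x \<in> V" for x
  proof -
    have "GDERIV (\<lambda>x. z x - 1) x :> grad z x" using GDERIV_diff[OF C1c_GDERIV[OF zC, of x] GDERIV_const[of 1]] by simp
    then have "grad z x = 0"
      by (rule GDERIV_zero_outside[where K = "- V"]) (use z(2,5) x in auto)
    then show ?thesis using x z(4,5) by (auto simp: Dv_def)
  qed
  show ?thesis by (rule that[OF zu z(2-4) _ DvG]) (simp_all add: z(5))
qed

lemma C1_weak_gradient_eq:
  fixes u :: "'a::euclidean_space \<Rightarrow> real"
  assumes U: "open U" and u: "\<And>x. x \<in> U \<Longrightarrow> GDERIV u x :> G x" "continuous_on U G"
    and \<phi>: "test_fun U \<phi>" and b: "b \<in> Basis"
  shows "(LINT x:U|lebesgue. u x * (grad \<phi> x \<bullet> b)) = - (LINT x:U|lebesgue. (G x \<bullet> b) * \<phi> x)"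
proof -
  note \<phi>C = test_fun_C1c[OF \<phi>]
  obtain K where K: "compact K" "K \<subseteq> U" "\<And>x. x \<notin> K \<Longrightarrow> \<phi> x = 0"
    using C1c_Cc(1)[OF \<phi>C] unfolding Cc_def csupp_def by blast
  have D0: "grad \<phi> x = 0" if "x \<notin> K" for x
    by (rule GDERIV_zero_outside[OF C1c_GDERIV[OF \<phi>C] compact_imp_closed[OF K(1)] K(3) that])
  obtain v Dv V where v: "C1c U v Dv" "open V" "K \<subseteq> V" "V \<subseteq> U" "\<And>x. x \<in> V \<Longrightarrow> v x = u x" "\<And>x. x \<in> V \<Longrightarrow> Dv x = G x"
    by (rule C1c_localize[OF U u K(1,2)]) (assumption, (rule that; assumption))
  have vc: "continuous_on UNIV v" "continuous_on UNIV Dv" using C1c_Cc[OF v(1)] CcD by auto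
  have e1: "(\<lambda>x. u x * (grad \<phi> x \<bullet> b)) = (\<lambda>x. (grad \<phi> x \<bullet> b) * v x)"
  proof
    show "u x * (grad \<phi> x \<bullet> b) = (grad \<phi> x \<bullet> b) * v x" for x using v(3,5) D0[of x] by (cases "x \<in> K") auto
  qed
  have e2: "(\<lambda>x. (G x \<bullet> b) * \<phi> x) = (\<lambda>x. \<phi> x * (Dv x \<bullet> b))"
  proof
    show "(G x \<bullet> b) * \<phi> x = \<phi> x * (Dv x \<bullet> b)" for x using v(3,6) K(3)[of x] by (cases "x \<in> K") auto
  qed
  have "Cc U (\<lambda>x. (grad \<phi> x \<bullet> b) * v x)" by (intro Cc_mult_right Cc_inner_right C1c_Cc(2)[OF \<phi>C] vc continuous_intros)
  moreover have "Cc U (\<lambda>x. \<phi> x * (Dv x \<bullet> b))" by (intro Cc_mult_right C1c_Cc(1)[OF \<phi>C] vc continuous_intros)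
  ultimately show ?thesis unfolding e1 e2
    using C1c_integral_by_parts[OF \<phi>C C1c_GDERIV[OF v(1)] vc(2) b] by (simp add: Cc_set_lebesgue_integral)
qed

theorem theorem7p1:
  fixes \<Omega> :: "'a::euclidean_space set"
    and p :: "'a \<Rightarrow> real"
    and u :: "'a \<Rightarrow> real"
  assumes "bounded \<Omega>" and "open \<Omega>"
    and "\<And>x. p x \<ge> 1"
    and "C1_on UNIV p"
    and "1 < Inf (p ` \<Omega>)"
    and "bdd_above (p ` \<Omega>)"
    and "C1_on \<Omega> u"
    and "p_harmonic_weak p (\<Omega> - {x. u x = 0}) u"
  shows "p_harmonic_weak p \<Omega> u"
proof -
  let ?U = "\<Omega> - {x. u x = 0}"
  note \<Omega> = assms(2)
  have uD: "GDERIV u x :> grad u x" if "x \<in> \<Omega>" for x using assms(7) that unfolding C1_on_def by (rule Ck_1_GDERIV)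
  have gc: "continuous_on \<Omega> (grad u)" using assms(7) unfolding C1_on_def by (rule Ck_1_continuous_grad)
  have uc: "continuous_on \<Omega> u"
    using uD unfolding gderiv_def by (meson continuous_at_imp_continuous_on has_derivative_continuous)
  have pD: "GDERIV p x :> grad p x" for x using assms(4) unfolding C1_on_def by (intro Ck_1_GDERIV) auto
  have pDc: "continuous_on UNIV (grad p)" using assms(4) unfolding C1_on_def by (rule Ck_1_continuous_grad)
  have pc: "continuous_on UNIV p" by (rule GDERIV_continuous_on[OF pD])
  have U: "open ?U"
  proof -
    have "open (\<Omega> \<inter> u -` (- {0}))" by (rule continuous_open_preimage[OF uc \<Omega>]) auto
    moreover have "?U = \<Omega> \<inter> u -` (- {0})" by auto
    ultimately show ?thesis by simp
  qed
  have Usub: "?U \<subseteq> \<Omega>" by blast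
  note uDU = uD[OF subsetD[OF Usub]] and gcU = continuous_on_subset[OF gc Usub]
  have pm: "p \<in> borel_measurable lebesgue" using pc by (intro measurable_completion) (simp add: borel_measurable_continuous_onI)

  obtain g where g: "sobolev_loc p ?U u g"
    and geq: "\<And>\<phi>. test_fun ?U \<phi> \<Longrightarrow> (LINT x:?U|lebesgue. norm (g x) powr (p x - 2) * (g x \<bullet> grad \<phi> x)) = 0"
    using assms(8) unfolding p_harmonic_weak_def by blast
  have gw: "weak_gradient ?U u g" using g unfolding sobolev_loc_def by blast
  have gm: "g \<in> borel_measurable lebesgue" using gw unfolding weak_gradient_def by blast
  have gn: "set_integrable lebesgue K (\<lambda>x. norm (g x))" if "compact K" "K \<subseteq> ?U" for K
    using gw that unfolding weak_gradient_def by blast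
  have gi: "set_integrable lebesgue K (\<lambda>x. g x \<bullet> b)" if "compact K" "K \<subseteq> ?U" "b \<in> Basis" for K b
  proof (rule set_integrable_bound[OF gn[OF that(1,2)]])
    show "set_borel_measurable lebesgue K (\<lambda>x. g x \<bullet> b)" unfolding set_borel_measurable_def
      using gm that(1) by (intro borel_measurable_scaleR borel_measurable_inner borel_measurable_indicator) (auto simp: borel_compact)
    show "AE x in lebesgue. x \<in> K \<longrightarrow> norm (g x \<bullet> b) \<le> norm (norm (g x))"
      using Basis_le_norm[OF that(3)] by (intro AE_I2) auto
  qed
  have gradi: "set_integrable lebesgue K (\<lambda>x. grad u x \<bullet> b)" if "compact K" "K \<subseteq> ?U" for K b
    using that gcU by (intro set_integrable_compact_continuous continuous_intros) (auto elim: continuous_on_subset)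
  \<comment> \<open>The hypothesis provides some weak gradient \<open>g\<close>, fixed only up to
    null sets. Both \<open>g\<close> and the classical gradient satisfy the same integration by
    parts formula, so du Bois-Reymond identifies them almost everywhere.\<close>
  have AEb: "AE x in lebesgue. x \<in> ?U \<longrightarrow> g x \<bullet> b - grad u x \<bullet> b = 0" if b: "b \<in> Basis" for b
  proof (rule du_Bois_Reymond[OF U])
    show "set_integrable lebesgue K (\<lambda>x. g x \<bullet> b - grad u x \<bullet> b)" if "compact K" "K \<subseteq> ?U" for K
      using gi[OF that b] gradi[OF that] by (rule set_integral_diff(1))
    fix \<phi> assume \<phi>: "test_fun ?U \<phi>"
    have c: "Cc ?U \<phi>" by (rule C1c_Cc(1)[OF test_fun_C1c[OF \<phi>]])
    have "(LINT x:?U|lebesgue. u x * (grad \<phi> x \<bullet> b)) = - (LINT x:?U|lebesgue. (g x \<bullet> b) * \<phi> x)"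
      using gw \<phi> b unfolding weak_gradient_def by blast
    moreover have "(LINT x:?U|lebesgue. u x * (grad \<phi> x \<bullet> b)) = - (LINT x:?U|lebesgue. (grad u x \<bullet> b) * \<phi> x)"
      by (rule C1_weak_gradient_eq[OF U uDU gcU \<phi> b])
    moreover have "set_integrable lebesgue ?U (\<lambda>x. (g x \<bullet> b) * \<phi> x)" "set_integrable lebesgue ?U (\<lambda>x. (grad u x \<bullet> b) * \<phi> x)"
      using gi[OF _ _ b] gradi by (intro integrable_mult_test c; simp)+
    ultimately show "(LINT x:?U|lebesgue. (g x \<bullet> b - grad u x \<bullet> b) * \<phi> x) = 0"
      unfolding left_diff_distrib by (simp add: set_integral_diff(2))
  qed
  have "AE x in lebesgue. \<forall>b\<in>Basis. x \<in> ?U \<longrightarrow> g x \<bullet> b - grad u x \<bullet> b = 0"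
    using AEb by (intro AE_finite_allI) auto
  then have AEg: "AE x in lebesgue. x \<in> ?U \<longrightarrow> g x = grad u x"
    by eventually_elim (auto intro: euclidean_eqI)

  \<comment> \<open>\<open>weak_gradient\<close> demands measurability on the whole space, hence the
    extension by zero outside \<Omega>.\<close>
  define g' where "g' x = (if x \<in> \<Omega> then grad u x else 0)" for x
  have g'm: "g' \<in> borel_measurable lebesgue"
  proof -
    have "(\<lambda>x. if x \<in> \<Omega> then grad u x else 0) \<in> borel_measurable borel"
      using \<Omega> gc by (intro borel_measurable_continuous_on_if) auto
    then show ?thesis unfolding g'_def[abs_def] by (intro measurable_completion) simp
  qed
  have eqU: "(LINT x:?U|lebesgue. norm (g' x) powr (p x - 2) * (g' x \<bullet> grad \<phi> x)) = 0" if \<phi>: "test_fun ?U \<phi>" for \<phi>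
  proof -
    have dm: "grad \<phi> \<in> borel_measurable lebesgue"
      using CcD(1)[OF C1c_Cc(2)[OF test_fun_C1c[OF \<phi>]]] by (intro measurable_completion) (simp add: borel_measurable_continuous_onI)
    have Um: "?U \<in> sets lebesgue" using U by (simp add: borel_open)
    have "(\<integral>x. indicator ?U x *\<^sub>R (norm (g' x) powr (p x - 2) * (g' x \<bullet> grad \<phi> x)) \<partial>lebesgue)
       = (\<integral>x. indicator ?U x *\<^sub>R (norm (g x) powr (p x - 2) * (g x \<bullet> grad \<phi> x)) \<partial>lebesgue)"
    proof (rule integral_cong_AE)
      show "(\<lambda>x. indicator ?U x *\<^sub>R (norm (g' x) powr (p x - 2) * (g' x \<bullet> grad \<phi> x))) \<in> borel_measurable lebesgue"
        using g'm pm dm Um by measurable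
      show "(\<lambda>x. indicator ?U x *\<^sub>R (norm (g x) powr (p x - 2) * (g x \<bullet> grad \<phi> x))) \<in> borel_measurable lebesgue"
        using gm pm dm Um by measurable
      show "AE x in lebesgue. indicator ?U x *\<^sub>R (norm (g' x) powr (p x - 2) * (g' x \<bullet> grad \<phi> x))
         = indicator ?U x *\<^sub>R (norm (g x) powr (p x - 2) * (g x \<bullet> grad \<phi> x))"
        using AEg by eventually_elim (auto simp: indicator_def g'_def)
    qed
    then show ?thesis using geq[OF \<phi>] by (simp add: set_lebesgue_integral_def)
  qed

  have weak: "weak_gradient \<Omega> u g'"
    unfolding weak_gradient_def
  proof (intro conjI allI impI ballI g'm)
    fix K assume K: "compact K \<and> K \<subseteq> \<Omega>"
    then show "set_integrable lebesgue K u"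
      using uc by (intro set_integrable_compact_continuous) (auto elim: continuous_on_subset)
    have "continuous_on K (grad u)" using K gc continuous_on_subset by blast
    then have "continuous_on K g'" by (rule continuous_on_eq) (use K in \<open>auto simp: g'_def\<close>)
    then show "set_integrable lebesgue K (\<lambda>x. norm (g' x))"
      using K by (intro set_integrable_compact_continuous continuous_intros) auto
  next
    fix \<phi> and b :: 'a assume \<phi>: "test_fun \<Omega> \<phi>" and b: "b \<in> Basis"
    show "(LINT x:\<Omega>|lebesgue. u x * (grad \<phi> x \<bullet> b)) = - (LINT x:\<Omega>|lebesgue. (g' x \<bullet> b) * \<phi> x)"
    proof (rule C1_weak_gradient_eq[OF \<Omega> _ _ \<phi> b])
      show "GDERIV u x :> g' x" if "x \<in> \<Omega>" for x using uD[OF that] that by (simp add: g'_def)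
      show "continuous_on \<Omega> g'" by (rule continuous_on_eq[OF gc]) (simp add: g'_def)
    qed
  qed
  \<comment> \<open>A positive exponent keeps the powers |u|^p and |g'|^p continuous where their
    bases vanish.\<close>
  have p0: "0 < p x" for x using assms(3)[of x] by linarith
  have sob: "sobolev_loc p \<Omega> u g'"
    unfolding sobolev_loc_def
  proof (intro conjI allI impI weak)
    fix K assume K: "compact K \<and> K \<subseteq> \<Omega>"
    have "continuous_on K (\<lambda>x. \<bar>u x\<bar> powr p x + norm (g' x) powr p x)"
    proof (intro continuous_on_add continuous_on_powr')
      show "continuous_on K p" using pc continuous_on_subset by blast
      then show "continuous_on K p" .
      show "continuous_on K (\<lambda>x. \<bar>u x\<bar>)" using K uc continuous_on_subset by (intro continuous_intros) blast
      have "continuous_on K (grad u)" using K gc continuous_on_subset by blast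
      then have "continuous_on K g'" by (rule continuous_on_eq) (use K in \<open>auto simp: g'_def\<close>)
      then show "continuous_on K (\<lambda>x. norm (g' x))" by (intro continuous_intros)
    qed (use p0 in auto)
    then show "set_integrable lebesgue K (\<lambda>x. \<bar>u x\<bar> powr p x + norm (g' x) powr p x)"
      using K by (intro set_integrable_compact_continuous) auto
  qed

  \<comment> \<open>Then 1 + 2\<beta> is the smaller of 2 and the infimum of p. The truncation at 2
    gives \<beta> \<le> 1/2 and makes the constant exponent 2 admissible.\<close>
  define \<beta> where "\<beta> = (min (Inf (p ` \<Omega>)) 2 - 1) / 2"
  define T where "T = max 0 (Sup (p ` \<Omega>) - 2)"
  have \<beta>: "0 < \<beta>" "\<beta> \<le> 1 / 2" using assms(5) by (auto simp: \<beta>_def min_def)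
  have T: "0 \<le> T" by (simp add: T_def)
  have bdd: "bdd_below (p ` \<Omega>)" using assms(3) by (intro bdd_belowI2[of _ 1]) auto
  have plow: "1 + 2 * \<beta> \<le> p x" if "x \<in> \<Omega>" for x
  proof -
    have "1 + 2 * \<beta> = min (Inf (p ` \<Omega>)) 2" unfolding \<beta>_def by argo
    also have "\<dots> \<le> Inf (p ` \<Omega>)" by simp
    also have "\<dots> \<le> p x" by (rule cINF_lower[OF bdd that])
    finally show ?thesis .
  qed
  have phigh: "p x - 2 \<le> T" if "x \<in> \<Omega>" for x
    using cSUP_upper[OF that assms(6)] by (simp add: T_def)

  \<comment> \<open>One test function is treated at a time, so \<open>u\<close> and \<open>p\<close>
    only have to be right near its support and may be altered elsewhere.\<close>
  have final: "(LINT x:\<Omega>|lebesgue. norm (g' x) powr (p x - 2) * (g' x \<bullet> grad \<phi> x)) = 0" if \<phi>: "test_fun \<Omega> \<phi>" for \<phi>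
  proof -
    note \<phi>C = test_fun_C1c[OF \<phi>]
    obtain K where K: "compact K" "K \<subseteq> \<Omega>" "\<And>x. x \<notin> K \<Longrightarrow> \<phi> x = 0"
      using C1c_Cc(1)[OF \<phi>C] unfolding Cc_def csupp_def by blast
    obtain v Dv V1 where v: "C1c \<Omega> v Dv" "open V1" "K \<subseteq> V1" "V1 \<subseteq> \<Omega>" "\<And>x. x \<in> V1 \<Longrightarrow> v x = u x" "\<And>x. x \<in> V1 \<Longrightarrow> Dv x = grad u x"
      by (rule C1c_localize[OF \<Omega> uD gc K(1,2)]) (assumption, (rule that; assumption))
    obtain z V2 where z: "test_fun \<Omega> z" "open V2" "K \<subseteq> V2" "V2 \<subseteq> \<Omega>" "\<And>x. x \<in> V2 \<Longrightarrow> z x = 1" "\<And>x. 0 \<le> z x" "\<And>x. z x \<le> 1"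
      by (rule smooth_cutoff[OF K(1) \<Omega> K(2)]) (rule that; assumption)
    note zC = test_fun_C1c[OF z(1)]
    have z0: "z x = 0" if "x \<notin> \<Omega>" for x using C1c_Cc(1)[OF zC] that unfolding Cc_def csupp_def by blast
    \<comment> \<open>A convex combination of p and 2, equal to p near \<open>K\<close> and to 2 off
      \<Omega>. The bounds 1 + 2\<beta> and 2 + T hold for p on \<Omega> and for 2, hence for q on
      the whole space.\<close>
    define q where "q x = 2 + z x * (p x - 2)" for x
    define Dq where "Dq x = z x *\<^sub>R grad p x + (p x - 2) *\<^sub>R grad z x" for x
    have qC: "C1c \<Omega> (\<lambda>x. z x * (p x - 2)) Dq"
      unfolding Dq_def[abs_def]
      by (rule C1c_mult[OF zC _ pDc]) (use GDERIV_diff[OF pD GDERIV_const] in simp)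
    obtain B where B: "0 < B" "\<And>x. norm (Dq x) \<le> B" using Cc_bounded[OF C1c_Cc(2)[OF qC]] by metis
    \<comment> \<open>On this set both replacements are exact, so the flux of the locale coincides
      with the original one there.\<close>
    define V where "V = V1 \<inter> V2"
    have VK: "open V" "K \<subseteq> V" "V \<subseteq> \<Omega>" using v z by (auto simp: V_def)
    interpret plap_setting v Dv q Dq V \<beta> T B
    proof
      show "C1c UNIV v Dv" by (rule C1c_mono[OF v(1) subset_UNIV])
      show "GDERIV q x :> Dq x" for x
        unfolding q_def[abs_def] using GDERIV_add[OF GDERIV_const C1c_GDERIV[OF qC], of 2] by simp
      show "continuous_on UNIV Dq" using C1c_Cc(2)[OF qC] by (rule CcD(1))
      show "1 + 2 * \<beta> \<le> q x" for x
      proof (cases "x \<in> \<Omega>")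
        case True
        have "z x * (2 * \<beta> - 1) \<le> z x * (p x - 2)" using plow[OF True] z(6) by (intro mult_left_mono) auto
        moreover have "1 * (2 * \<beta> - 1) \<le> z x * (2 * \<beta> - 1)" using z(7) \<beta> by (intro mult_right_mono_neg) auto
        ultimately show ?thesis by (simp add: q_def)
      next
        case False then show ?thesis using z0 \<beta> by (simp add: q_def)
      qed
      show "q x \<le> 2 + T" for x
      proof (cases "x \<in> \<Omega>")
        case True
        have "z x * (p x - 2) \<le> z x * T" using phigh[OF True] z(6) by (intro mult_left_mono) auto
        also have "\<dots> \<le> T" using T z(6,7) by (intro mult_left_le_one_le) auto
        finally show ?thesis by (simp add: q_def)
      next
        case False then show ?thesis using z0 T by (simp add: q_def)
      qed
    qed (use B \<beta> T VK in auto)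
    have fluxV: "flux x = norm (g' x) powr (p x - 2) *\<^sub>R g' x" if "x \<in> V" for x
      using that v(6) z(5) VK(3) by (auto simp: flux_def g'_def q_def V_def)
    have inner_eq: "norm (g' x) powr (p x - 2) * (g' x \<bullet> grad \<psi> x) = flux x \<bullet> grad \<psi> x" if \<psi>: "test_fun V \<psi>" for \<psi> x
    proof (cases "x \<in> V")
      case True then show ?thesis by (simp add: fluxV)
    next
      case False
      then have "grad \<psi> x = 0" using C1c_Cc(2)[OF test_fun_C1c[OF \<psi>]] unfolding Cc_def csupp_def by blast
      then show ?thesis by simp
    qed
    let ?W = "V \<inter> {x. v x \<noteq> 0}"
    have W: "open ?W" using VK(1) u_cont by (intro open_Int open_Collect_neq continuous_intros)
    have WU: "?W \<subseteq> ?U" using VK(3) v(5) by (auto simp: V_def)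
    have "weakly_div_free ?W flux"
    proof (rule weakly_div_free_test_fun[OF W flux_cont])
      fix \<psi> assume \<psi>: "test_fun ?W \<psi>"
      have \<psi>U: "test_fun ?U \<psi>" using \<psi> WU unfolding test_fun_def by blast
      have \<psi>V: "test_fun V \<psi>" using \<psi> unfolding test_fun_def by blast
      have "Cc ?U (\<lambda>x. flux x \<bullet> grad \<psi> x)"
        by (rule Cc_inner_left[OF flux_cont C1c_Cc(2)[OF test_fun_C1c[OF \<psi>U]]])
      then show "(\<integral>x. flux x \<bullet> grad \<psi> x \<partial>lborel) = 0"
        using eqU[OF \<psi>U] by (simp add: Cc_set_lebesgue_integral inner_eq[OF \<psi>V])
    qed
    \<comment> \<open>The equation passes from the points of \<open>V\<close> where \<open>v\<close>
      is nonzero to those where its gradient is nonzero, and from there to all of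
      \<open>V\<close>.\<close>
    then have "weakly_div_free V flux"
      by (intro flux_weakly_div_free divergence_free_across_regular_zeros[OF u VK(1) flux_cont])
    moreover have \<phi>V: "test_fun V \<phi>"
    proof (rule test_funI[OF _ K(1) VK(2) K(3)])
      show "smooth_on UNIV \<phi>" using \<phi> unfolding test_fun_def by blast
    qed
    ultimately have "(\<integral>x. flux x \<bullet> grad \<phi> x \<partial>lborel) = 0"
      using weakly_div_freeD[OF _ test_fun_C1c[OF \<phi>V]] by blast
    moreover have "Cc \<Omega> (\<lambda>x. flux x \<bullet> grad \<phi> x)" by (rule Cc_inner_left[OF flux_cont C1c_Cc(2)[OF \<phi>C]])
    ultimately show ?thesis by (simp add: Cc_set_lebesgue_integral inner_eq[OF \<phi>V])
  qed
  show ?thesis unfolding p_harmonic_weak_def using sob final by blast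
qed

end
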